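(* Assume that $\mathcal{A}$ is stable and $\Sigma_{\mathrm{nom}}\succ0$. Consider the robust $H_2$ analysis problem: minimize $\operatorname{tr}(Q\Sigma_{\mathrm{nom}})+\lambda\gamma^2$ over $\lambda\ge0$, $Q=Q^\top\in\mathbb{R}^{n_w\times n_w}$, $\mathcal{P}=\mathcal{P}^\top\succ0$ in $\mathbb{R}^{2n_x\times2n_x}$, subject to $$\mathcal{A}^\top\mathcal{P}\mathcal{A}-\mathcal{P}+\mathcal{C}^\top\mathcal{C}\prec0,\qquad\begin{pmatrix}\mathcal{B}&0\\ \mathcal{D}&0\\ I&0\\0&I\end{pmatrix}^\top\begin{pmatrix}\mathcal{P}&0&0&0\\0&I&0&0\\0&0&-\lambda I&\lambda I\\0&0&\lambda I&-Q-\lambda I\end{pmatrix}\begin{pmatrix}\mathcal{B}&0\\ \mathcal{D}&0\\ I&0\\0&I\end{pmatrix}\prec0.$$ This problem is exact in the sense that there exists a worst-case uncertainty $\Delta\in\mathbb{R}^{n_w\times n_w}$ with $\|(I-\Delta)\Sigma_{\mathrm{nom}}^{1/2}\|_F\le\gamma$ such that the squared $\Sigma_{\mathrm{nom}}$-weighted $H_2$ norm of the uncertain system $$\chi_{k+1}=\mathcal{A}\chi_k+\mathcal{B}\Delta\hat w_k,\qquad z_k=\mathcal{C}\chi_k+\mathcal{D}\Delta\hat w_k$$ is equal to the optimal value (infimum) of the robust $H_2$ analysis problem. Moreover, this worst-case uncertainty corresponds to the optimal linear transport plan of the Wasserstein distance between $\mathbb{P}_{\mathrm{nom}}$ and $\mathbb{P}_{w(t)}$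 for a worst-case disturbance $w$: there is a disturbance $w\in\mathscr{W}_{\mathrm{ind}}$ attaining the supremum of $$\limsup_{T\to\infty}\frac1T\sum_{t=0}^{T-1}\mathbb{E}\|z(t)\|^2\quad\text{s.t.}\quad\chi(t+1)=\mathcal{A}\chi(t)+\mathcal{B}w(t),\ z(t)=\mathcal{C}\chi(t)+\mathcal{D}w(t),\ \chi(0)=0$$ over $\mathscr{W}_{\mathrm{ind}}$, such that for every $t\in\mathbb{N}_0$ one has $w(t)=\Delta\hat w(t)$ for some $\hat w(t)\sim\mathbb{P}_{\mathrm{nom}}$ and $\mathbb{W}(\mathbb{P}_{w(t)},\mathbb{P}_{\mathrm{nom}})=\sqrt{\operatorname{tr}\big((I-\Delta)\Sigma_{\mathrm{nom}}(I-\Delta)^\top\big)}$.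
   Context: Plant: $x(t+1)=Ax(t)+B_ww(t)+B_uu(t)$, $z(t)=C_zx(t)+D_{zw}w(t)+D_{zu}u(t)$, $y(t)=C_yx(t)+D_{yw}w(t)$, with real matrices of compatible dimensions, where $x(t)\in\mathbb{R}^{n_x}$, $w(t)\in\mathbb{R}^{n_w}$, $u(t)\in\mathbb{R}^{n_u}$, $z(t)\in\mathbb{R}^{n_z}$, $y(t)\in\mathbb{R}^{n_y}$. Controller (fixed): $x_c(t+1)=A_cx_c(t)+B_cy(t)$, $u(t)=C_cx_c(t)+D_cy(t)$, with $x_c(t)\in\mathbb{R}^{n_x}$. The closed-loop state is $\chi=(x^\top,x_c^\top)^\top$ and the closed-loop matrices are $$\mathcal{A}=\begin{pmatrix}A+B_uD_cC_y&B_uC_c\\ B_cC_y&A_c\end{pmatrix},\quad \mathcal{B}=\begin{pmatrix}B_w+B_uD_cD_{yw}\\ B_cD_{yw}\end{pmatrix},\quad \mathcal{C}=\begin{pmatrix}C_z+D_{zu}D_cC_y&D_{zu}C_c\end{pmatrix},\quad \mathcal{D}=D_{zw}+D_{zu}D_cD_{yw}.$$ Stable means that all eigenvalues of $\mathcal{A}$ lie in the open unit disc. $\|\cdot\|_F$ is the Frobenius norm. The $\Sigma_{\mathrm{nom}}$-weighted $H_2$ norm of the uncertain system is the $H_2$ norm of its transfer function from $\hat w$ to $z$ after scaling the input matrices $\mathcal{B}\Delta$ and $\mathcal{D}\Delta$ from the right by $\Sigma_{\mathrm{nom}}^{1/2}$; for stable $\mathcal{A}$ its square equals $\operatorname{tr}\big(\Delta^\top(\mathcal{B}^\top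 P\mathcal{B}+\mathcal{D}^\top\mathcal{D})\Delta\,\Sigma_{\mathrm{nom}}\big)$, where $P$ is the unique solution of $\mathcal{A}^\top P\mathcal{A}-P+\mathcal{C}^\top\mathcal{C}=0$. Stochastic processes are defined on a common (separable, metric) probability space $\Omega$, which is not fixed in advance: the supremum over $w$ is over all sequences with the listed properties on any such space. $\mathbb{P}_v$ is the distribution of $v$, and $\mathbb{W}$ is the 2-Wasserstein metric. Let $\gamma\ge0$ and let $\mathbb{P}_{\mathrm{nom}}$ be a fixed zero-mean normal distribution on $\mathbb{R}^{n_w}$ with second moment $\Sigma_{\mathrm{nom}}$. $\mathscr{W}_{\mathrm{ind}}$ is the set of all sequences $w:\mathbb{N}_0\to L_2(\Omega,\mathbb{R}^{n_w})$ of independent, zero-mean random variables with $\mathbb{W}(\mathbb{P}_{w(t)},\mathbb{P}_{\mathrm{nom}})\le\gamma$ for all $t\in\mathbb{N}_0$. *)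

theory Defs
  imports "HOL-Probability.Probability"
begin

section \<open>Matrices\<close>

definition hcat :: "'a^'m1^'n \<Rightarrow> 'a^'m2^'n \<Rightarrow> 'a^('m1 + 'm2)^'n"  (infixr \<open>|||\<close> 60)
  where "A ||| B = (\<chi> i j. case j of Inl k \<Rightarrow> A $ i $ k | Inr k \<Rightarrow> B $ i $ k)"

definition vcat :: "'a^'m^'n1 \<Rightarrow> 'a^'m^'n2 \<Rightarrow> 'a^'m^('n1 + 'n2)"  (infixr \<open>;;\<close> 55)
  where "A ;; B = (\<chi> i. case i of Inl k \<Rightarrow> A $ k | Inr k \<Rightarrow> B $ k)"

definition posdef :: "real^'n^'n \<Rightarrow> bool"
  where "posdef M \<longleftrightarrow> transpose M = M \<and> (\<forall>x. x \<noteq> 0 \<longrightarrow> 0 < x \<bullet> (M *v x))"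

definition possemidef :: "real^'n^'n \<Rightarrow> bool"
  where "possemidef M \<longleftrightarrow> transpose M = M \<and> (\<forall>x. 0 \<le> x \<bullet> (M *v x))"

abbreviation negdef :: "real^'n^'n \<Rightarrow> bool"
  where "negdef M \<equiv> posdef (- M)"

text \<open>The principal square root; used for positive semidefinite arguments only.\<close>

definition mat_sqrt :: "real^'n^'n \<Rightarrow> real^'n^'n"
  where "mat_sqrt M = (THE S. possemidef S \<and> S ** S = M)"

definition frobenius_norm :: "'a::real_normed_vector^'m^'n \<Rightarrow> real"
  where "frobenius_norm M = sqrt (\<Sum>i\<in>UNIV. \<Sum>j\<in>UNIV. (norm (M $ i $ j))\<^sup>2)"

abbreviation cmat :: "real^'m^'n \<Rightarrow> complex^'m^'n"
  where "cmat \<equiv> map_matrix complex_of_real"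

definition stable_matrix :: "real^'n^'n \<Rightarrow> bool"
  where "stable_matrix A \<longleftrightarrow>
    (\<forall>\<mu>::complex. (\<exists>v. v \<noteq> 0 \<and> cmat A *v v = \<mu> *s v) \<longrightarrow> cmod \<mu> < 1)"


section \<open>Closed loop and $H_2$ norm\<close>

definition closed_A ::
  "real^'nx^'nx \<Rightarrow> real^'nu^'nx \<Rightarrow> real^'nx^'ny \<Rightarrow>
   real^'nx^'nx \<Rightarrow> real^'ny^'nx \<Rightarrow> real^'nx^'nu \<Rightarrow> real^'ny^'nu \<Rightarrow> real^('nx + 'nx)^('nx + 'nx)"
  where "closed_A A B\<^sub>u C\<^sub>y A\<^sub>c B\<^sub>c C\<^sub>c D\<^sub>c =
    (A + B\<^sub>u ** D\<^sub>c ** C\<^sub>y ||| B\<^sub>u ** C\<^sub>c ;;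
     B\<^sub>c ** C\<^sub>y             ||| A\<^sub>c)"

definition closed_B ::
  "real^'nw^'nx \<Rightarrow> real^'nu^'nx \<Rightarrow> real^'nw^'ny \<Rightarrow>
   real^'ny^'nx \<Rightarrow> real^'ny^'nu \<Rightarrow> real^'nw^('nx + 'nx)"
  where "closed_B B\<^sub>w B\<^sub>u D\<^sub>y\<^sub>w B\<^sub>c D\<^sub>c = (B\<^sub>w + B\<^sub>u ** D\<^sub>c ** D\<^sub>y\<^sub>w ;; B\<^sub>c ** D\<^sub>y\<^sub>w)"

definition closed_C ::
  "real^'nx^'nz \<Rightarrow> real^'nu^'nz \<Rightarrow> real^'nx^'ny \<Rightarrow>
   real^'nx^'nu \<Rightarrow> real^'ny^'nu \<Rightarrow> real^('nx + 'nx)^'nz"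
  where "closed_C C\<^sub>z D\<^sub>z\<^sub>u C\<^sub>y C\<^sub>c D\<^sub>c = (C\<^sub>z + D\<^sub>z\<^sub>u ** D\<^sub>c ** C\<^sub>y ||| D\<^sub>z\<^sub>u ** C\<^sub>c)"

definition closed_D ::
  "real^'nw^'nz \<Rightarrow> real^'nu^'nz \<Rightarrow> real^'nw^'ny \<Rightarrow> real^'ny^'nu \<Rightarrow> real^'nw^'nz"
  where "closed_D D\<^sub>z\<^sub>w D\<^sub>z\<^sub>u D\<^sub>y\<^sub>w D\<^sub>c = D\<^sub>z\<^sub>w + D\<^sub>z\<^sub>u ** D\<^sub>c ** D\<^sub>y\<^sub>w"

definition transfer_function ::
  "real^'n^'n \<Rightarrow> real^'m^'n \<Rightarrow> real^'n^'p \<Rightarrow> real^'m^'p \<Rightarrow> complex \<Rightarrow> complex^'m^'p"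
  where "transfer_function A B C D \<zeta> =
    cmat C ** matrix_inv (mat \<zeta> - cmat A) ** cmat B + cmat D"

text \<open>The integrand is the trace of $G^* G$ at $e^{i\theta}$.  The integral over the unit circle is
  the $H_2$ norm only when \<open>A\<close> is stable.\<close>

definition h2_norm :: "real^'n^'n \<Rightarrow> real^'m^'n \<Rightarrow> real^'n^'p \<Rightarrow> real^'m^'p \<Rightarrow> real"
  where "h2_norm A B C D =
    sqrt (1 / (2 * pi) *
      integral {0..2 * pi} (\<lambda>\<theta>. (frobenius_norm (transfer_function A B C D (cis \<theta>)))\<^sup>2))"

definition weighted_h2_norm ::
  "real^'m^'m \<Rightarrow> real^'n^'n \<Rightarrow> real^'m^'n \<Rightarrow> real^'n^'p \<Rightarrow> real^'m^'p \<Rightarrow> real"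
  where "weighted_h2_norm \<Sigma> A B C D = h2_norm A (B ** mat_sqrt \<Sigma>) C (D ** mat_sqrt \<Sigma>)"


section \<open>Robust $H_2$ analysis problem\<close>

definition robust_h2_feasible ::
  "real^'n^'n \<Rightarrow> real^'m^'n \<Rightarrow> real^'n^'p \<Rightarrow> real^'m^'p \<Rightarrow> (real \<times> (real^'m^'m) \<times> (real^'n^'n)) set"
  where "robust_h2_feasible A B C D = {(l, Q, P).
    0 \<le> l \<and> transpose Q = Q \<and> posdef P \<and>
    negdef (transpose A ** P ** A - P + transpose C ** C) \<and>
    (let F = (B     ||| 0 ;;
              D     ||| 0 ;;
              mat 1 ||| 0 ;;
              0     ||| mat 1)
     in negdef (transpose F **
             (P ||| 0     ||| 0         ||| 0     ;;
              0 ||| mat 1 ||| 0         ||| 0     ;;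
              0 ||| 0     ||| - (mat l) ||| mat l ;;
              0 ||| 0     ||| mat l     ||| - Q - mat l) ** F))}"

definition robust_h2_value ::
  "real \<Rightarrow> real^'m^'m \<Rightarrow> real^'n^'n \<Rightarrow> real^'m^'n \<Rightarrow> real^'n^'p \<Rightarrow> real^'m^'p \<Rightarrow> ereal"
  where "robust_h2_value \<gamma> \<Sigma> A B C D =
    (INF (l, Q, P)\<in>robust_h2_feasible A B C D. ereal (trace (Q ** \<Sigma>) + l * \<gamma>\<^sup>2))"


section \<open>Distributions and disturbances\<close>

text \<open>Possibly degenerate normal distributions: every linear functional is univariate normal, where
  the normal distribution of standard deviation 0 is a point mass.\<close>

definition normal_distribution :: "(real^'n) measure \<Rightarrow> bool"
  where "normal_distribution P \<longleftrightarrow> prob_space P \<and> sets P = sets borel \<and>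
    (\<forall>a. \<exists>m s. 0 \<le> s \<and> distr P borel (\<lambda>x. a \<bullet> x) =
       (if s = 0 then return borel m else density lborel (normal_density m s)))"

definition second_moment :: "(real^'n) measure \<Rightarrow> real^'n^'n"
  where "second_moment P = (\<chi> i j. LINT x|P. x $ i * x $ j)"

definition couplings :: "(real^'n) measure \<Rightarrow> (real^'n) measure \<Rightarrow> ((real^'n) \<times> (real^'n)) measure set"
  where "couplings P P' = {\<pi>. prob_space \<pi> \<and> sets \<pi> = sets (borel \<Otimes>\<^sub>M borel) \<and>
    distr \<pi> borel fst = P \<and> distr \<pi> borel snd = P'}"

text \<open>Intended for distributions with finite second moments, for which the infimum is finite
  (\<open>enn2real\<close> would send \<open>\<infinity>\<close> to 0).\<close>

definition wasserstein2 :: "(real^'n) measure \<Rightarrow> (real^'n) measure \<Rightarrow> real"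
  where "wasserstein2 P P' =
    sqrt (enn2real (INF \<pi>\<in>couplings P P'. \<integral>\<^sup>+(x, y). ennreal ((norm (x - y))\<^sup>2) \<partial>\<pi>))"

definition separable_metric_prob_space :: "'s measure \<Rightarrow> bool"
  where "separable_metric_prob_space \<Omega> \<longleftrightarrow> prob_space \<Omega> \<and>
    (\<exists>d. Metric_space (space \<Omega>) d \<and>
      separable_space (Metric_space.mtopology (space \<Omega>) d) \<and>
      sets \<Omega> = sigma_sets (space \<Omega>) {U. openin (Metric_space.mtopology (space \<Omega>) d) U})"

text \<open>Since the probability space is not fixed, a disturbance comes paired with the space on which it
  is defined.  A separable metric space has at most the cardinality of the continuum, so up to
  isomorphism every admissible space is carried by a subset of the path type \<open>nat \<Rightarrow> real^'n\<close>;
  taking \<open>'s\<close> to be that type loses no disturbance.\<close>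

definition W_ind ::
  "real \<Rightarrow> (real^'n) measure \<Rightarrow> ('s measure \<times> (nat \<Rightarrow> 's \<Rightarrow> real^'n)) set"
  where "W_ind \<gamma> P = {(\<Omega>, w).
    separable_metric_prob_space \<Omega> \<and>
    (\<forall>t. w t \<in> borel_measurable \<Omega> \<and> integrable \<Omega> (\<lambda>\<omega>. (norm (w t \<omega>))\<^sup>2)) \<and>
    prob_space.indep_vars \<Omega> (\<lambda>_. borel) w UNIV \<and>
    (\<forall>t. (LINT \<omega>|\<Omega>. w t \<omega>) = 0) \<and>
    (\<forall>t. wasserstein2 (distr \<Omega> borel (w t)) P \<le> \<gamma>)}"

primrec closed_loop_state ::
  "real^'n^'n \<Rightarrow> real^'m^'n \<Rightarrow> (nat \<Rightarrow> real^'m) \<Rightarrow> nat \<Rightarrow> real^'n"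
  where
    "closed_loop_state A B w 0 = 0"
  | "closed_loop_state A B w (Suc t) = A *v closed_loop_state A B w t + B *v w t"

definition closed_loop_output ::
  "real^'n^'n \<Rightarrow> real^'m^'n \<Rightarrow> real^'n^'p \<Rightarrow> real^'m^'p \<Rightarrow> (nat \<Rightarrow> real^'m) \<Rightarrow> nat \<Rightarrow> real^'p"
  where "closed_loop_output A B C D w t = C *v closed_loop_state A B w t + D *v w t"

definition average_power ::
  "real^'n^'n \<Rightarrow> real^'m^'n \<Rightarrow> real^'n^'p \<Rightarrow> real^'m^'p \<Rightarrow>
   's measure \<Rightarrow> (nat \<Rightarrow> 's \<Rightarrow> real^'m) \<Rightarrow> ereal"
  where "average_power A B C D \<Omega> w =
    limsup (\<lambda>T. ereal (1 / real T *
      (\<Sum>t<T. LINT \<omega>|\<Omega>. (norm (closed_loop_output A B C D (\<lambda>s. w s \<omega>) t))\<^sup>2)))"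

end

theory Submission
  imports Defs "HOL-Computational_Algebra.Fundamental_Theorem_Algebra"
begin

text \<open>Let \<open>P\<close> solve \<open>A\<^sup>T P A - P + C\<^sup>T C = 0\<close> and put \<open>M = B\<^sup>T P B + D\<^sup>T D\<close>.  Both the squared \<open>H\<^sub>2\<close>
  norm and the average output power measure the input by the quadratic form of \<open>M\<close>: independent zero-mean
  inputs \<open>w t\<close> produce, up to the energy left in the final state, the average of \<open>E (w t \<bullet> M (w t))\<close>
  (\<open>summed_energy_balance\<close>), and the gain \<open>\<Delta>\<close> produces \<open>tr (\<Delta>\<^sup>T M \<Delta> \<Sigma>)\<close> (\<open>h2_norm_squared\<close>).  Everything
  therefore reduces to maximizing the second moment weighted by \<open>M\<close> within transport distance \<open>\<gamma>\<close> of the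
  nominal distribution.

  The multiplier of the transport constraint is \<open>l\<close>.  For \<open>l I \<succ> M\<close> the penalized problem
  \<open>a \<bullet> M a - l |a - b|\<^sup>2\<close> is concave in \<open>a\<close>, is maximized by \<open>a = E b\<close> with \<open>E = l (l I - M)\<^sup>-\<^sup>1\<close>, and has
  the maximum \<open>b \<bullet> (l E - l I) b\<close> (\<open>completed_square\<close>).  This one pointwise inequality, integrated
  in different ways, gives all upper bounds: the block inequality says that \<open>Q\<close> dominates these
  maxima, so feasible points bound the weighted norm (\<open>robust_h2_feasible_bound\<close>), and integrating
  against a coupling bounds the power of any admissible disturbance (\<open>storage_bound_of_wasserstein2\<close>).

  Exactness holds because \<open>\<Sigma>\<close> is positive definite, which excludes a degenerate multiplier: if \<open>M \<noteq> 0\<close>, the transport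
  cost of \<open>l (l I - M)\<^sup>-\<^sup>1\<close> blows up as \<open>l\<close> approaches the largest eigenvalue of \<open>M\<close> and vanishes as \<open>l\<close>
  grows, so for \<open>\<gamma> > 0\<close> some \<open>l\<close> spends the budget \<open>\<gamma>\<^sup>2\<close> exactly (\<open>ex_worst_case_gain\<close>).  For this \<open>l\<close> the upper bound
  is attained by \<open>\<Delta> = l (l I - M)\<^sup>-\<^sup>1\<close>.  When \<open>\<gamma> = 0\<close> or \<open>M = 0\<close>, the gain \<open>\<Delta> = I\<close> is optimal and the upper
  bounds come arbitrarily close to its value.  Since \<open>\<Delta>\<close> is symmetric positive definite, \<open>x \<mapsto> \<Delta> x\<close> is the gradient
  of a convex function, hence an optimal transport map (\<open>wasserstein2_posdef_image\<close>), and an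
  independent sequence of copies of \<open>\<Delta> x\<close> is a worst-case disturbance.\<close>

section \<open>Symmetric matrices\<close>

lemma inner_matrix_transpose:
  fixes A :: "real^'m^'n"
  shows "(A *v x) \<bullet> y = x \<bullet> (transpose A *v y)"
  by (metis dot_lmul_matrix inner_commute transpose_matrix_vector)

lemma inner_symmetric_matrix:
  fixes A :: "real^'n^'n"
  assumes "transpose A = A"
  shows "(A *v x) \<bullet> y = x \<bullet> (A *v y)"
  using inner_matrix_transpose[of A x y] assms by simp

lemma symmetric_matrixI:
  fixes A :: "real^'n^'n"
  assumes "\<And>x y. (A *v x) \<bullet> y = x \<bullet> (A *v y)"
  shows "transpose A = A"
proof -
  have "transpose A *v y = A *v y" for y
    by (metis assms inner_matrix_transpose vector_eq_ldot)
  then show ?thesis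
    by (simp add: matrix_eq)
qed

lemma matrix_vector_mult_left_minus [simp]:
  fixes A :: "real^'n^'m"
  shows "(- A) *v x = - (A *v x)"
  using matrix_vector_mult_diff_rdistrib[of 0 A x] by simp

lemma matrix_vector_mult_left_scaleR [simp]:
  fixes A :: "real^'n^'m"
  shows "(c *\<^sub>R A) *v x = c *\<^sub>R (A *v x)"
  by (simp add: scaleR_matrix_vector_assoc)

lemma transpose_add: "transpose (A + B) = transpose A + transpose B"
  and transpose_diff: "transpose (A - B) = transpose A - transpose B"
  and transpose_minus: "transpose (- A) = - transpose A"
  for A B :: "real^'n^'m"
  by (simp_all add: transpose_def vec_eq_iff)

lemma mat_vector_mult_real [simp]: "(mat c :: real^'n^'n) *v x = c *\<^sub>R x"
proof -
  have "(mat c :: real^'n^'n) = c *\<^sub>R mat 1"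
    by (simp add: mat_def vec_eq_iff)
  then show ?thesis by simp
qed

text \<open>Rayleigh's argument: a maximizer of the quadratic form on the unit sphere of an invariant
  subspace is an eigenvector, and its orthogonal complement is again invariant.\<close>

lemma selfadjoint_eigenbasis_of_subspace:
  fixes T :: "'a::euclidean_space \<Rightarrow> 'a"
  assumes lin: "linear T" and sym: "\<And>x y. T x \<bullet> y = x \<bullet> T y"
  assumes "subspace V" "T ` V \<subseteq> V"
  shows "\<exists>U. finite U \<and> U \<subseteq> V \<and> pairwise orthogonal U \<and> (\<forall>u\<in>U. norm u = 1) \<and> span U = V \<and>
    (\<forall>u\<in>U. \<exists>c. T u = c *\<^sub>R u)"
  using assms(3,4)
proof (induction "dim V" arbitrary: V rule: less_induct)
  case less
  note V = \<open>subspace V\<close> \<open>T ` V \<subseteq> V\<close>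
  show ?case
  proof (cases "V = {0}")
    case True
    then show ?thesis
      by (intro exI[of _ "{}"]) auto
  next
    case False
    let ?S = "V \<inter> sphere 0 1"
    obtain x where x: "x \<in> V" "x \<noteq> 0"
      using False V(1) subspace_0 by fastforce
    have "x /\<^sub>R norm x \<in> ?S"
      using x V(1) by (simp add: subspace_scale)
    then have "?S \<noteq> {}" by blast
    moreover have "compact ?S"
      by (simp add: closed_Int_compact closed_subspace V(1))
    moreover have "continuous_on ?S (\<lambda>x. x \<bullet> T x)"
      by (intro continuous_intros linear_continuous_on linear_conv_bounded_linear[THEN iffD1] lin)
    ultimately obtain v where v: "v \<in> ?S" and max: "\<And>y. y \<in> ?S \<Longrightarrow> y \<bullet> T y \<le> v \<bullet> T v"
      using continuous_attains_sup by metis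
    define m where "m = v \<bullet> T v"
    have nv: "v \<bullet> v = 1" and vV: "v \<in> V"
      using v by (auto simp: dot_square_norm)
    have max': "y \<bullet> T y \<le> m * (y \<bullet> y)" if "y \<in> V" for y
    proof (cases "y = 0")
      case True
      then show ?thesis by (simp add: linear_0[OF lin])
    next
      case y: False
      have "y /\<^sub>R norm y \<in> ?S"
        using y that V(1) by (simp add: subspace_scale)
      then have "(y /\<^sub>R norm y) \<bullet> T (y /\<^sub>R norm y) \<le> m"
        using max m_def by blast
      then have "(y \<bullet> T y) / (norm y)\<^sup>2 \<le> m"
        by (simp add: linear_scale[OF lin] power2_eq_square divide_simps)
      then show ?thesis
        using y by (simp add: divide_simps dot_square_norm mult.commute split: if_splits)
    qed
    define r where "r = T v - m *\<^sub>R v"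
    have rV: "r \<in> V"
      unfolding r_def using V vV by (auto intro!: subspace_diff subspace_scale)
    have rv: "r \<bullet> v = 0"
      unfolding r_def by (simp add: inner_diff_left inner_diff_right nv m_def inner_commute)
    have rTv: "r \<bullet> T v = r \<bullet> r"
      using rv by (simp add: r_def inner_diff_right)
    have main: "2 * (r \<bullet> r) \<le> t * (m * (r \<bullet> r) - r \<bullet> T r)" if "t > 0" for t
    proof -
      have "v + t *\<^sub>R r \<in> V"
        using V(1) vV rV by (simp add: subspace_add subspace_scale)
      from max'[OF this] have "2 * t * (r \<bullet> r) + t * t * (r \<bullet> T r) \<le> t * t * m * (r \<bullet> r)"
        using rv rTv sym[of v r] nv
        by (simp add: linear_add[OF lin] linear_scale[OF lin] inner_add_left inner_add_right m_def
          inner_commute algebra_simps)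
      then have "t * (2 * (r \<bullet> r)) \<le> t * (t * (m * (r \<bullet> r) - r \<bullet> T r))"
        by (simp add: algebra_simps)
      then show ?thesis using that by simp
    qed
    have "((\<lambda>t. t * (m * (r \<bullet> r) - r \<bullet> T r)) \<longlongrightarrow> 0 * (m * (r \<bullet> r) - r \<bullet> T r)) (at_right 0)"
      by (intro tendsto_intros)
    then have "2 * (r \<bullet> r) \<le> 0"
      by (intro tendsto_lowerbound[where F="at_right (0::real)"])
         (auto simp: eventually_at_right_less intro!: eventually_mono[OF eventually_at_right_less main])
    then have "r = 0"
      by (metis inner_eq_zero_iff inner_ge_zero mult_le_0_iff not_numeral_le_zero order_antisym)
    then have Tv: "T v = m *\<^sub>R v"
      by (simp add: r_def)
    define V' where "V' = V \<inter> {x. v \<bullet> x = 0}"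
    have V': "subspace V'"
      unfolding V'_def by (intro subspace_inter V(1) subspace_hyperplane)
    moreover have "T ` V' \<subseteq> V'"
      using V(2) by (auto simp: V'_def sym[symmetric] Tv)
    moreover have "dim V' < dim V"
    proof (rule ccontr)
      assume "\<not> dim V' < dim V"
      then have "V' = V"
        using V' V(1) by (intro subspace_dim_equal) (auto simp: V'_def)
      with vV have "v \<bullet> v = 0" unfolding V'_def by blast
      with nv show False by simp
    qed
    ultimately obtain U where U: "finite U" "U \<subseteq> V'" "pairwise orthogonal U" "\<forall>u\<in>U. norm u = 1"
        "span U = V'" "\<forall>u\<in>U. \<exists>c. T u = c *\<^sub>R u"
      using less.hyps[of V'] by blast
    have "span (insert v U) = V"
    proof
      show "span (insert v U) \<subseteq> V"
        using U(2) vV V(1) by (intro span_minimal) (auto simp: V'_def)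
      show "V \<subseteq> span (insert v U)"
      proof
        fix x assume x: "x \<in> V"
        have "x - (v \<bullet> x) *\<^sub>R v \<in> V'"
          using x vV V(1) nv by (auto simp: V'_def inner_diff_right subspace_diff subspace_scale)
        then show "x \<in> span (insert v U)"
          using U(5) by (auto simp: span_insert)
      qed
    qed
    moreover have "pairwise orthogonal (insert v U)"
      using U(2,3) by (auto simp: pairwise_insert V'_def orthogonal_def inner_commute)
    ultimately show ?thesis
      using U Tv nv vV by (intro exI[of _ "insert v U"]) (auto simp: V'_def norm_eq_1)
  qed
qed

locale orthonormal_basis =
  fixes U :: "(real^'n) set"
  assumes finite: "finite U" and orthogonal: "pairwise orthogonal U"
    and unit: "\<And>u. u \<in> U \<Longrightarrow> norm u = 1" and spanning: "span U = UNIV"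
begin

lemma expand: "(\<Sum>u\<in>U. (u \<bullet> x) *\<^sub>R u) = x"
  using orthonormal_basis_expand[OF orthogonal unit _ finite, of x] spanning
  by (simp add: inner_commute)

lemma inner_basis: "u \<in> U \<Longrightarrow> v \<in> U \<Longrightarrow> u \<bullet> v = (if u = v then 1 else 0)"
  using orthogonal unit by (auto simp: pairwise_def orthogonal_def norm_eq_1)

lemma matrix_eqI:
  fixes A B :: "real^'n^'m"
  assumes "\<And>u. u \<in> U \<Longrightarrow> A *v u = B *v u"
  shows "A = B"
proof -
  have "A *v x = B *v x" for x
  proof -
    have "A *v (\<Sum>u\<in>U. (u \<bullet> x) *\<^sub>R u) = B *v (\<Sum>u\<in>U. (u \<bullet> x) *\<^sub>R u)"
      using assms by (simp add: linear_sum[OF matrix_vector_mul_linear] matrix_vector_mult_scaleR)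
    then show ?thesis by (simp add: expand)
  qed
  then show ?thesis by (simp add: matrix_eq)
qed

text \<open>Functional calculus: the matrix with eigenvectors \<open>u \<in> U\<close> and eigenvalues \<open>f u\<close>.\<close>

definition spectral_matrix :: "(real^'n \<Rightarrow> real) \<Rightarrow> real^'n^'n"
  where "spectral_matrix f = matrix (\<lambda>x. \<Sum>u\<in>U. (f u * (u \<bullet> x)) *\<^sub>R u)"

lemma spectral_matrix_mult: "spectral_matrix f *v x = (\<Sum>u\<in>U. (f u * (u \<bullet> x)) *\<^sub>R u)"
proof -
  have "linear (\<lambda>x. \<Sum>u\<in>U. (f u * (u \<bullet> x)) *\<^sub>R u)"
    by (intro linearI) (auto simp: inner_add_right algebra_simps sum.distrib scaleR_sum_right)
  then show ?thesis
    unfolding spectral_matrix_def by (simp add: matrix_works linear_matrix_vector_mul_eq)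
qed

lemma spectral_matrix_basis: "u \<in> U \<Longrightarrow> spectral_matrix f *v u = f u *\<^sub>R u"
proof -
  assume u: "u \<in> U"
  have "(\<Sum>v\<in>U. (f v * (v \<bullet> u)) *\<^sub>R v) = (\<Sum>v\<in>U. if v = u then f u *\<^sub>R u else 0)"
    using u by (intro sum.cong) (auto simp: inner_basis)
  then show ?thesis using u finite by (simp add: spectral_matrix_mult)
qed

lemma spectral_matrix_mul: "spectral_matrix f ** spectral_matrix g = spectral_matrix (\<lambda>u. f u * g u)"
  by (rule matrix_eqI)
     (simp add: matrix_vector_mul_assoc[symmetric] spectral_matrix_basis matrix_vector_mult_scaleR mult.commute)

lemma spectral_matrix_diff: "spectral_matrix f - spectral_matrix g = spectral_matrix (\<lambda>u. f u - g u)"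
  by (rule matrix_eqI) (simp add: matrix_vector_mult_diff_rdistrib spectral_matrix_basis scaleR_left_diff_distrib)

lemma spectral_matrix_scaleR: "c *\<^sub>R spectral_matrix f = spectral_matrix (\<lambda>u. c * f u)"
  by (rule matrix_eqI) (simp add: spectral_matrix_basis)

lemma spectral_matrix_const: "spectral_matrix (\<lambda>_. c) = mat c"
  by (rule matrix_eqI) (simp add: spectral_matrix_basis)

lemma spectral_matrix_cong: "(\<And>u. u \<in> U \<Longrightarrow> f u = g u) \<Longrightarrow> spectral_matrix f = spectral_matrix g"
  by (rule matrix_eqI) (simp add: spectral_matrix_basis)

lemma transpose_spectral_matrix: "transpose (spectral_matrix f) = spectral_matrix f"
  by (rule symmetric_matrixI)
     (auto simp: spectral_matrix_mult inner_sum_left inner_sum_right inner_commute mult_ac intro!: sum.cong)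

lemma spectral_matrix_form: "x \<bullet> (spectral_matrix f *v x) = (\<Sum>u\<in>U. f u * (u \<bullet> x)\<^sup>2)"
  by (simp add: spectral_matrix_mult inner_sum_right power2_eq_square inner_commute mult_ac)

lemma posdef_spectral_matrix:
  assumes "\<And>u. u \<in> U \<Longrightarrow> f u > 0"
  shows "posdef (spectral_matrix f)"
  unfolding posdef_def
proof (intro conjI transpose_spectral_matrix allI impI)
  fix x :: "real^'n" assume "x \<noteq> 0"
  then have "(\<Sum>u\<in>U. (u \<bullet> x) *\<^sub>R u) \<noteq> 0" by (simp add: expand)
  then obtain u where u: "u \<in> U" "u \<bullet> x \<noteq> 0"
    by (metis (mono_tags, lifting) scale_zero_left sum.neutral)
  show "0 < x \<bullet> (spectral_matrix f *v x)"
    unfolding spectral_matrix_form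
    by (rule sum_pos2[OF finite u(1)]) (use u assms in \<open>auto intro!: mult_nonneg_nonneg simp: less_imp_le\<close>)
qed

lemma trace_spectral_matrix_mul:
  "trace (spectral_matrix f ** S) = (\<Sum>u\<in>U. f u * (u \<bullet> (S *v u)))"
proof -
  have entry: "spectral_matrix f $ i $ j = (\<Sum>u\<in>U. f u * u $ i * u $ j)" for i j
  proof -
    have "spectral_matrix f $ i $ j = (spectral_matrix f *v axis j 1) $ i"
      by (simp add: matrix_vector_mult_basis column_def)
    also have "\<dots> = (\<Sum>u\<in>U. f u * u $ i * u $ j)"
      by (auto simp: spectral_matrix_mult inner_axis mult_ac intro!: sum.cong)
    finally show ?thesis .
  qed
  have "trace (spectral_matrix f ** S) = (\<Sum>i\<in>UNIV. \<Sum>j\<in>UNIV. \<Sum>u\<in>U. f u * u $ i * u $ j * S $ j $ i)"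
    by (simp add: trace_def matrix_matrix_mult_def entry sum_distrib_right)
  also have "\<dots> = (\<Sum>i\<in>UNIV. \<Sum>u\<in>U. \<Sum>j\<in>UNIV. f u * u $ i * u $ j * S $ j $ i)"
    by (intro sum.cong refl sum.swap)
  also have "\<dots> = (\<Sum>u\<in>U. \<Sum>i\<in>UNIV. \<Sum>j\<in>UNIV. f u * u $ i * u $ j * S $ j $ i)"
    by (rule sum.swap)
  also have "\<dots> = (\<Sum>u\<in>U. \<Sum>j\<in>UNIV. \<Sum>i\<in>UNIV. f u * u $ i * u $ j * S $ j $ i)"
    by (intro sum.cong refl sum.swap)
  also have "\<dots> = (\<Sum>u\<in>U. f u * (u \<bullet> (S *v u)))"
    by (simp add: inner_vec_def matrix_vector_mult_def sum_distrib_left mult_ac)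
  finally show ?thesis .
qed

end

lemma symmetric_matrix_diagonalization:
  fixes M :: "real^'n^'n"
  assumes "transpose M = M"
  obtains U f where "orthonormal_basis U" "M = orthonormal_basis.spectral_matrix U f"
    "\<And>u. u \<in> U \<Longrightarrow> M *v u = f u *\<^sub>R u"
proof -
  obtain U where U: "finite U" "pairwise orthogonal U" "\<forall>u\<in>U. norm u = 1" "span U = UNIV"
      "\<forall>u\<in>U. \<exists>c. M *v u = c *\<^sub>R u"
    using selfadjoint_eigenbasis_of_subspace[of "(*v) M" UNIV, OF matrix_vector_mul_linear
      inner_symmetric_matrix[OF assms]] subspace_UNIV by auto
  then interpret orthonormal_basis U by unfold_locales auto
  obtain f where f: "\<forall>u\<in>U. M *v u = f u *\<^sub>R u"
    using bchoice[OF U(5)] by blast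
  have "M = spectral_matrix f"
    by (rule matrix_eqI) (simp add: f spectral_matrix_basis)
  then show ?thesis
    by (rule that[OF orthonormal_basis_axioms]) (use f in blast)
qed

lemma posdef_imp_possemidef: "posdef M \<Longrightarrow> possemidef M"
  unfolding posdef_def possemidef_def
  by (metis inner_zero_left less_eq_real_def)

text \<open>Uniqueness of the root: if \<open>T\<^sup>2 = S\<close> and \<open>S u = f u\<close>, then \<open>(T + \<surd>f) (T - \<surd>f) u = 0\<close>, and the
  first factor is positive definite.  So every root acts on the eigenvectors of \<open>S\<close> in the same way.\<close>

lemma mat_sqrt_posdef:
  fixes S :: "real^'n^'n"
  assumes S: "posdef S"
  shows "transpose (mat_sqrt S) = mat_sqrt S" "mat_sqrt S ** mat_sqrt S = S"
proof -
  obtain U f where U: "orthonormal_basis U" and Sf: "S = orthonormal_basis.spectral_matrix U f"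
      and ev: "\<And>u. u \<in> U \<Longrightarrow> S *v u = f u *\<^sub>R u"
    by (rule symmetric_matrix_diagonalization[of S]) (use S in \<open>auto simp: posdef_def\<close>)
  interpret orthonormal_basis U by fact
  have fpos: "f u > 0" if u: "u \<in> U" for u
  proof -
    have "u \<noteq> 0" using unit[OF u] by auto
    then have "0 < u \<bullet> (S *v u)" using S by (simp add: posdef_def)
    then show ?thesis using inner_basis[OF u u] by (simp add: ev[OF u])
  qed
  define R where "R = spectral_matrix (\<lambda>u. sqrt (f u))"
  have R: "possemidef R" "R ** R = S"
  proof -
    have "posdef R"
      unfolding R_def using fpos by (intro posdef_spectral_matrix) auto
    then show "possemidef R"
      by (rule posdef_imp_possemidef)
    show "R ** R = S"
      unfolding R_def spectral_matrix_mul Sf using fpos by (intro spectral_matrix_cong) (auto simp: less_imp_le)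
  qed
  have "T = R" if T: "possemidef T" "T ** T = S" for T
  proof (rule matrix_eqI)
    fix u assume u: "u \<in> U"
    (* y = 0 because T + sqrt (f u) annihilates it *)
    define y where "y = T *v u - sqrt (f u) *\<^sub>R u"
    have "T *v (T *v u) = f u *\<^sub>R u"
      using T(2) ev[OF u] by (simp add: matrix_vector_mul_assoc)
    then have "T *v y + sqrt (f u) *\<^sub>R y = 0"
      using fpos[OF u] by (simp add: y_def matrix_vector_mult_diff_distrib matrix_vector_mult_scaleR algebra_simps)
    then have "y \<bullet> (T *v y + sqrt (f u) *\<^sub>R y) = 0"
      by simp
    then have "y \<bullet> (T *v y) + sqrt (f u) * (y \<bullet> y) = 0"
      by (simp add: inner_add_right)
    moreover have "0 \<le> y \<bullet> (T *v y)" using T(1) by (simp add: possemidef_def)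
    moreover have "0 \<le> sqrt (f u) * (y \<bullet> y)" using fpos[OF u] by simp
    ultimately have "sqrt (f u) * (y \<bullet> y) = 0" by linarith
    then have "y = 0" using fpos[OF u] by simp
    then show "T *v u = R *v u"
      by (simp add: y_def R_def spectral_matrix_basis u)
  qed
  with R have "possemidef (mat_sqrt S) \<and> mat_sqrt S ** mat_sqrt S = S"
    unfolding mat_sqrt_def by (intro theI[of "\<lambda>T. possemidef T \<and> T ** T = S" R]) blast+
  then show "transpose (mat_sqrt S) = mat_sqrt S" "mat_sqrt S ** mat_sqrt S = S"
    by (auto simp: possemidef_def)
qed

section \<open>Stability\<close>

lemma driven_contraction_tendsto_zero:
  fixes a e :: "nat \<Rightarrow> real"
  assumes r: "0 \<le> r" "r < 1" and a: "\<And>k. 0 \<le> a k" and step: "\<And>k. a (Suc k) \<le> r * a k + e k"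
    and e: "e \<longlonglongrightarrow> 0"
  shows "a \<longlonglongrightarrow> 0"
proof (rule LIMSEQ_I)
  fix d :: real assume d: "0 < d"
  have "0 < (1 - r) * (d / 2)" using r d by simp
  then have "\<forall>\<^sub>F k in sequentially. e k < (1 - r) * (d / 2)"
    using e by (rule order_tendstoD(2)[rotated])
  then obtain K where K: "\<And>k. k \<ge> K \<Longrightarrow> e k \<le> (1 - r) * (d / 2)"
    by (metis eventually_sequentially less_imp_le)
  have bound: "a (K + j) - d / 2 \<le> r ^ j * a K" for j
  proof (induction j)
    case 0
    then show ?case using d by simp
  next
    case (Suc j)
    have "a (K + Suc j) - d / 2 \<le> r * (a (K + j) - d / 2)"
      using step[of "K + j"] K[of "K + j"] by (simp add: algebra_simps)
    also have "\<dots> \<le> r * (r ^ j * a K)"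
      using Suc r by (intro mult_left_mono)
    finally show ?case by simp
  qed
  have "(\<lambda>j. r ^ j * a K) \<longlonglongrightarrow> 0 * a K"
    using r by (intro tendsto_mult tendsto_const LIMSEQ_realpow_zero)
  then have "\<forall>\<^sub>F j in sequentially. r ^ j * a K < d / 2"
    using d by (intro order_tendstoD(2)[where y=0]) auto
  then obtain J where J: "\<And>j. j \<ge> J \<Longrightarrow> r ^ j * a K < d / 2"
    by (metis eventually_sequentially)
  show "\<exists>no. \<forall>n\<ge>no. norm (a n - 0) < d"
  proof (intro exI allI impI)
    fix n assume "n \<ge> K + J"
    then have "K + (n - K) = n" "J \<le> n - K" by auto
    then have "a n < d"
      using bound[of "n - K"] J[of "n - K"] by (simp only:) simp
    then show "norm (a n - 0) < d" using a[of n] by simp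
  qed
qed

lemma norm_vector_scalar_mult: "norm (c *s x) = norm c * norm x"
  for x :: "('a::real_normed_field)^'n"
  by (simp add: norm_vec_def vector_scalar_mult_def norm_mult L2_set_right_distrib)

abbreviation matrix_iterate :: "('a::semiring_1)^'n^'n \<Rightarrow> nat \<Rightarrow> 'a^'n \<Rightarrow> 'a^'n"
  where "matrix_iterate A k \<equiv> ((*v) A ^^ k)"

lemma matrix_iterate_commute: "matrix_iterate A k (A *v x) = A *v matrix_iterate A k x"
  by (metis comp_apply funpow_Suc_right funpow.simps(2))

lemma matrix_iterate_diff:
  fixes A :: "('a::comm_ring_1)^'n^'n"
  shows "matrix_iterate A k (x - y) = matrix_iterate A k x - matrix_iterate A k y"
  by (induction k) (auto simp: matrix_vector_mult_diff_distrib)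

lemma matrix_iterate_scalar:
  fixes A :: "('a::field)^'n^'n"
  shows "matrix_iterate A k (c *s x) = c *s matrix_iterate A k x"
  by (induction k) (auto simp: vector_scalar_commute)

text \<open>A vector annihilated by a nonzero polynomial in \<open>A\<close> decays under iteration.  One root
  \<open>\<mu>\<close> of the polynomial is removed at a time: if \<open>cmod \<mu> < 1\<close>, the iterates of \<open>v\<close> are driven
  through a contraction by those of \<open>A v - \<mu> v\<close>; otherwise \<open>\<mu>\<close> is no eigenvalue and the factor
  can be cancelled.\<close>

lemma polynomial_annihilated_imp_decay:
  fixes A :: "complex^'n^'n"
  assumes ev: "\<And>\<mu> v. v \<noteq> 0 \<Longrightarrow> A *v v = \<mu> *s v \<Longrightarrow> cmod \<mu> < 1"
  assumes "p \<noteq> 0" "degree p \<le> N" "(\<Sum>i\<le>N. coeff p i *s matrix_iterate A i v) = 0"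
  shows "(\<lambda>k. matrix_iterate A k v) \<longlonglongrightarrow> 0"
  using assms(2-)
proof (induction N arbitrary: p v)
  case 0
  then have "coeff p 0 \<noteq> 0"
    by (metis le_zero_eq leading_coeff_neq_0)
  with 0 have "v = 0" by simp
  moreover have "matrix_iterate A k 0 = 0" for k
    using matrix_iterate_diff[where x=0 and y=0] by simp
  ultimately show ?case by simp
next
  case (Suc N)
  show ?case
  proof (cases "degree p \<le> N")
    case True
    then show ?thesis using Suc by (auto simp: coeff_eq_0)
  next
    case False
    then have deg: "degree p = Suc N" using Suc by simp
    then obtain \<mu> where "poly p \<mu> = 0"
      using fundamental_theorem_of_algebra[of p] constant_degree[of p] by auto
    then obtain q where q: "p = [:-\<mu>, 1:] * q"
      by (auto simp: poly_eq_0_iff_dvd dvd_def)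
    with Suc(2) have q0: "q \<noteq> 0" by auto
    have degq: "degree q = N"
      using deg q q0 by (simp add: q degree_mult_eq del: mult_pCons_left)
    define y where "y = (\<Sum>i\<le>N. coeff q i *s matrix_iterate A i v)"
    have cp: "coeff p i = coeff (pCons 0 q) i - \<mu> * coeff q i" for i
      by (simp add: q)
    have qN: "coeff q (Suc N) = 0" by (simp add: coeff_eq_0 degq)
    have "0 = (\<Sum>i\<le>Suc N. coeff (pCons 0 q) i *s matrix_iterate A i v) - (\<Sum>i\<le>Suc N. (\<mu> * coeff q i) *s matrix_iterate A i v)"
      using Suc(4) by (simp only: cp vector_sub_rdistrib sum_subtractf)
    also have "(\<Sum>i\<le>Suc N. (\<mu> * coeff q i) *s matrix_iterate A i v) = \<mu> *s y"
      by (simp add: qN y_def vec.scale_sum_right vector_smult_assoc del: sum.atMost_Suc)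
         (simp add: qN)
    also have "(\<Sum>i\<le>Suc N. coeff (pCons 0 q) i *s matrix_iterate A i v) = A *v y"
      by (simp add: sum.atMost_Suc_shift y_def matrix_vector_mult_scaleR vec.linear_sum[OF matrix_vector_mul_linear_gen]
          vector_scalar_commute del: sum.atMost_Suc)
    finally have Ay: "A *v y = \<mu> *s y" by simp
    have Avmv: "(\<Sum>i\<le>N. coeff q i *s matrix_iterate A i (A *v v - \<mu> *s v)) = A *v y - \<mu> *s y"
      by (simp add: matrix_iterate_diff matrix_iterate_commute matrix_iterate_scalar y_def vector_ssub_ldistrib sum_subtractf
         vec.linear_sum[OF matrix_vector_mul_linear_gen] vector_scalar_commute vec.scale_sum_right vector_smult_assoc mult.commute)
    show ?thesis
    proof (cases "cmod \<mu> < 1")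
      case True
      define e where "e k = matrix_iterate A k (A *v v - \<mu> *s v)" for k
      have "e \<longlonglongrightarrow> 0"
        unfolding e_def using Suc.IH[OF q0, of "A *v v - \<mu> *s v"] degq Avmv Ay by simp
      then have e: "(\<lambda>k. norm (e k)) \<longlonglongrightarrow> 0" by (rule tendsto_norm_zero)
      have "(\<lambda>k. norm (matrix_iterate A k v)) \<longlonglongrightarrow> 0"
      proof (rule driven_contraction_tendsto_zero[OF norm_ge_zero True _ _ e])
        fix k
        have "matrix_iterate A (Suc k) v = \<mu> *s matrix_iterate A k v + e k"
          by (simp add: e_def matrix_iterate_diff matrix_iterate_scalar matrix_iterate_commute)
        then show "norm (matrix_iterate A (Suc k) v) \<le> cmod \<mu> * norm (matrix_iterate A k v) + norm (e k)"
          by (metis norm_triangle_ineq norm_vector_scalar_mult)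
      qed auto
      then show ?thesis by (rule tendsto_norm_zero_cancel)
    next
      case False
      then have "y = 0" using ev Ay by blast
      then show ?thesis
        using Suc.IH[OF q0, of v] degq by (simp add: y_def)
    qed
  qed
qed

text \<open>More than \<open>DIM(complex^'n)\<close> iterates of a vector are linearly dependent or repeat.\<close>

lemma ex_annihilating_polynomial:
  fixes A :: "complex^'n^'n"
  obtains p N where "p \<noteq> 0" "degree p \<le> N" "(\<Sum>i\<le>N. coeff p i *s matrix_iterate A i v) = 0"
proof -
  define N where "N = DIM(complex^'n)"
  let ?f = "\<lambda>i. matrix_iterate A i v"
  show ?thesis
  proof (cases "inj_on ?f {..N}")
    case True
    then have "card (?f ` {..N}) = Suc N" by (simp add: card_image)
    then have "dependent (?f ` {..N})"
      using N_def by (intro dependent_biggerset) auto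
    then obtain g where g: "\<exists>w\<in>?f ` {..N}. g w \<noteq> 0" "(\<Sum>w\<in>?f ` {..N}. g w *\<^sub>R w) = 0"
      by (auto simp: dependent_finite)
    define p where "p = (\<Sum>i\<le>N. monom (complex_of_real (g (?f i))) i)"
    have cp: "coeff p i = (if i \<le> N then complex_of_real (g (?f i)) else 0)" for i
      by (auto simp: p_def coeff_sum if_distrib[of "\<lambda>x. coeff x _"] coeff_monom)
    have "p \<noteq> 0" using g(1) cp by (auto simp: poly_eq_iff)
    moreover have "degree p \<le> N" using cp by (intro degree_le) auto
    moreover have "(\<Sum>i\<le>N. coeff p i *s ?f i) = (\<Sum>i\<le>N. g (?f i) *\<^sub>R ?f i)"
      by (intro sum.cong) (auto simp: cp vec_eq_iff scaleR_conv_of_real[where 'a=complex])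
    moreover have "\<dots> = 0" using g(2) True by (simp add: sum.reindex)
    ultimately show ?thesis using that by metis
  next
    case False
    then obtain i j where ij: "i \<le> N" "j \<le> N" "i \<noteq> j" "?f i = ?f j"
      by (auto simp: inj_on_def)
    define p where "p = monom (1::complex) i - monom 1 j"
    have "coeff p i = 1" using ij by (simp add: p_def)
    then have "p \<noteq> 0" by auto
    moreover have "degree p \<le> N" using ij by (intro degree_le) (auto simp: p_def)
    moreover have "(\<Sum>k\<le>N. coeff p k *s ?f k)
        = (\<Sum>k\<le>N. (if k = i then ?f i else 0)) - (\<Sum>k\<le>N. (if k = j then ?f j else 0))"
      unfolding sum_subtractf[symmetric] by (intro sum.cong) (auto simp: p_def)
    ultimately show ?thesis using that[of p N] ij by simp
  qed
qed

lemma stable_matrix_iterates_tendsto_zero_complex: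
  assumes "stable_matrix A"
  shows "(\<lambda>k. matrix_iterate (cmat A) k v) \<longlonglongrightarrow> 0"
proof -
  obtain p N where "p \<noteq> 0" "degree p \<le> N" "(\<Sum>i\<le>N. coeff p i *s matrix_iterate (cmat A) i v) = 0"
    by (rule ex_annihilating_polynomial)
  then show ?thesis
    by (rule polynomial_annihilated_imp_decay[rotated 1, where p=p and N=N])
       (use assms in \<open>unfold stable_matrix_def, blast\<close>)
qed

abbreviation cvec :: "real^'n \<Rightarrow> complex^'n"
  where "cvec x \<equiv> (\<chi> i. complex_of_real (x $ i))"

lemma cmat_mult_cvec: "cmat A *v cvec x = cvec (A *v x)"
  by (simp add: vec_eq_iff matrix_vector_mult_def)

lemma stable_matrix_iterates_tendsto_zero:
  fixes A :: "real^'n^'n"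
  assumes "stable_matrix A"
  shows "(\<lambda>k. matrix_iterate A k x) \<longlonglongrightarrow> 0"
proof -
  have eq: "matrix_iterate (cmat A) k (cvec x) = cvec (matrix_iterate A k x)" for k
    by (induction k) (auto simp: cmat_mult_cvec)
  have "(\<lambda>k. matrix_iterate A k x $ i) \<longlonglongrightarrow> 0" for i
  proof -
    have "(\<lambda>k. matrix_iterate (cmat A) k (cvec x) $ i) \<longlonglongrightarrow> 0 $ i"
      by (intro tendsto_vec_nth stable_matrix_iterates_tendsto_zero_complex assms)
    then show ?thesis
      unfolding eq using tendsto_of_real_iff[of "\<lambda>k. matrix_iterate A k x $ i" 0 sequentially, where 'a=complex]
      by simp
  qed
  then show ?thesis
    by (intro vec_tendstoI) simp
qed

lemma lyapunov_form:
  fixes A :: "real^'m^'n"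
  shows "x \<bullet> ((transpose A ** P ** B) *v y) = (A *v x) \<bullet> (P *v (B *v y))"
  by (simp add: inner_matrix_transpose matrix_vector_mul_assoc[symmetric] del: transpose_matrix_vector)

text \<open>The form of \<open>P\<close> does not increase along trajectories, and trajectories tend to zero.\<close>

lemma lyapunov_solution_possemidef:
  fixes A P :: "real^'n^'n"
  assumes stable: "stable_matrix A" and "transpose P = P"
    and Q: "\<And>x. 0 \<le> x \<bullet> ((P - transpose A ** P ** A) *v x)"
  shows "possemidef P"
proof -
  have "0 \<le> x \<bullet> (P *v x)" for x
  proof (rule LIMSEQ_le_const2)
    show "(\<lambda>k. matrix_iterate A k x \<bullet> (P *v matrix_iterate A k x)) \<longlonglongrightarrow> 0"
      using tendsto_inner[OF stable_matrix_iterates_tendsto_zero[OF stable, of x]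
        bounded_linear.tendsto[OF matrix_vector_mul_bounded_linear[of P] stable_matrix_iterates_tendsto_zero[OF stable, of x]]]
      by simp
    have "matrix_iterate A k x \<bullet> (P *v matrix_iterate A k x) \<le> x \<bullet> (P *v x)" for k
    proof (induction k)
      case (Suc k)
      let ?y = "matrix_iterate A k x"
      show ?case using Suc lyapunov_form[of ?y A P A ?y] Q[of ?y]
        by (simp add: matrix_vector_mult_diff_rdistrib inner_diff_right)
    qed simp
    then show "\<exists>N. \<forall>n\<ge>N. matrix_iterate A n x \<bullet> (P *v matrix_iterate A n x) \<le> x \<bullet> (P *v x)" by blast
  qed
  then show ?thesis using assms(2) by (simp add: possemidef_def)
qed

text \<open>The Stein operator \<open>P - A\<^sup>T P A\<close> is injective because a fixed point of \<open>P \<mapsto> A\<^sup>T P A\<close> equals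
  all its iterates, which tend to zero; in finite dimension it is therefore surjective.\<close>

lemma ex_lyapunov_solution:
  fixes A Q :: "real^'n^'n"
  assumes stable: "stable_matrix A" and Q: "possemidef Q"
  obtains P where "possemidef P" "P - transpose A ** P ** A = Q"
proof -
  let ?L = "\<lambda>P. P - transpose A ** P ** A"
  have lin: "linear ?L"
    by (intro linearI)
       (simp_all add: matrix_eq matrix_vector_mult_add_rdistrib matrix_vector_mult_diff_rdistrib
          matrix_vector_mul_assoc[symmetric] matrix_vector_right_distrib matrix_vector_mult_scaleR
          scaleR_diff_right del: transpose_matrix_vector)
  have inj: "P = 0" if "?L P = 0" for P
  proof -
    have P: "P = transpose A ** P ** A" using that by simp
    have "x \<bullet> (P *v y) = matrix_iterate A k x \<bullet> (P *v matrix_iterate A k y)" for x y k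
    proof (induction k)
      case (Suc k)
      then show ?case using lyapunov_form[of "matrix_iterate A k x" A P A "matrix_iterate A k y"] P by simp
    qed simp
    moreover have "(\<lambda>k. matrix_iterate A k x \<bullet> (P *v matrix_iterate A k y)) \<longlonglongrightarrow> 0 \<bullet> (P *v 0)" for x y
      by (intro tendsto_inner bounded_linear.tendsto[OF matrix_vector_mul_bounded_linear]
        stable_matrix_iterates_tendsto_zero stable)
    ultimately have "x \<bullet> (P *v y) = 0" for x y
      by (simp add: LIMSEQ_const_iff)
    then have "P *v y = 0 *v y" for y
      by (metis inner_eq_zero_iff matrix_vector_mult_0)
    then show "P = 0" by (simp add: matrix_eq)
  qed
  have "inj ?L"
    using inj by (simp add: linear_injective_0[OF lin])
  then have "surj ?L" by (rule linear_inj_imp_surj[OF lin])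
  from surjD[OF this, of Q] obtain P where P: "?L P = Q" by blast
  have "?L (transpose P) = transpose (?L P)"
    by (simp add: transpose_diff matrix_transpose_mul matrix_mul_assoc)
  also have "\<dots> = ?L P" using P Q by (simp add: possemidef_def)
  finally have "transpose P = P" by (rule injD[OF \<open>inj ?L\<close>])
  then have "possemidef P"
    by (rule lyapunov_solution_possemidef[OF stable]) (use P Q in \<open>simp add: possemidef_def\<close>)
  then show ?thesis using P that by blast
qed

section \<open>The $H_2$ norm\<close>

lemma cmat_matrix_mul: "cmat (A ** B) = cmat A ** cmat B"
  by (simp add: vec_eq_iff matrix_matrix_mult_def)

lemma cmat_transpose_adjoint: "(cmat N *v x) \<bullet> y = x \<bullet> (cmat (transpose N) *v y)"
proof -
  have "(cmat N *v x) \<bullet> y = (\<Sum>i\<in>UNIV. \<Sum>j\<in>UNIV. N $ i $ j * (x $ j \<bullet> y $ i))"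
    by (simp add: inner_vec_def matrix_vector_mult_def inner_sum_left scaleR_conv_of_real[symmetric])
  also have "\<dots> = (\<Sum>j\<in>UNIV. \<Sum>i\<in>UNIV. N $ i $ j * (x $ j \<bullet> y $ i))"
    by (rule sum.swap)
  also have "\<dots> = x \<bullet> (cmat (transpose N) *v y)"
    by (simp add: inner_vec_def matrix_vector_mult_def inner_sum_right transpose_def scaleR_conv_of_real[symmetric])
  finally show ?thesis .
qed

lemma inner_unimodular_scale:
  fixes x y :: "complex^'n"
  assumes "cmod z = 1"
  shows "(z *s x) \<bullet> (z *s y) = x \<bullet> y"
proof -
  have "(z * a) \<bullet> (z * b) = a \<bullet> b" for a b :: complex
  proof -
    have "(z * a) \<bullet> (z * b) = ((Re z)\<^sup>2 + (Im z)\<^sup>2) * (a \<bullet> b)"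
      by (simp add: inner_complex_def algebra_simps power2_eq_square)
    then show ?thesis using assms by (simp add: cmod_def)
  qed
  then show ?thesis by (simp add: inner_vec_def)
qed

lemma inner_cvec: "cvec x \<bullet> cvec y = x \<bullet> y"
  by (simp add: inner_vec_def inner_complex_def)

text \<open>Since \<open>A\<close> has no eigenvalue on the unit circle, compactness of the circle and the sphere gives a
  bound that is uniform in \<open>z\<close>.\<close>

lemma stable_resolvent_bounded_below:
  fixes A :: "real^'n^'n"
  assumes "stable_matrix A"
  obtains c where "0 < c" "\<And>z x. cmod z = 1 \<Longrightarrow> c * norm x \<le> norm (z *s x - cmat A *v x)"
proof -
  let ?K = "sphere (0::complex) 1 \<times> sphere (0::complex^'n) 1"
  let ?g = "\<lambda>(z, x). norm (z *s x - cmat A *v x)"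
  have "compact ?K" by (intro compact_Times compact_sphere)
  moreover have "?K \<noteq> {}"
  proof -
    obtain x :: "complex^'n" where "norm x = 1"
      using vector_choose_size[of 1] by auto
    then have "(1, x) \<in> ?K" by simp
    then show ?thesis by blast
  qed
  moreover have "continuous_on ?K ?g"
  proof -
    have "continuous_on ?K (\<lambda>p. fst p *s snd p)"
      unfolding vector_scalar_mult_def
      by (rule continuous_on_vec_lambda) (auto intro!: continuous_on_mult continuous_on_component
        continuous_on_fst continuous_on_snd continuous_on_id)
    moreover have "continuous_on ?K (\<lambda>p. cmat A *v snd p)"
      by (rule bounded_linear.continuous_on[OF matrix_vector_mul_bounded_linear continuous_on_snd[OF continuous_on_id]])
    ultimately show ?thesis
      unfolding case_prod_beta by (rule continuous_on_norm[OF continuous_on_diff])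
  qed
  ultimately obtain p where p: "p \<in> ?K" and min: "\<And>q. q \<in> ?K \<Longrightarrow> ?g p \<le> ?g q"
    using continuous_attains_inf[of ?K ?g] by blast
  obtain z0 x0 where zx: "p = (z0, x0)" by (cases p)
  show ?thesis
  proof (rule that[of "?g p"])
    have "x0 \<noteq> 0" "cmod z0 = 1" using p zx by auto
    then have "cmat A *v x0 \<noteq> z0 *s x0"
      using assms unfolding stable_matrix_def by force
    then show "0 < ?g p" by (simp add: zx)
  next
    fix z and x :: "complex^'n" assume z: "cmod z = 1"
    show "?g p * norm x \<le> norm (z *s x - cmat A *v x)"
    proof (cases "x = 0")
      case False
      let ?y = "complex_of_real (inverse (norm x)) *s x"
      have "(z, ?y) \<in> ?K"
        using False z by (simp only: mem_Times_iff fst_conv snd_conv mem_sphere_0 norm_vector_scalar_mult norm_of_real) simp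
      then have "?g p \<le> norm (z *s ?y - cmat A *v ?y)" using min by fastforce
      also have "z *s ?y - cmat A *v ?y = complex_of_real (inverse (norm x)) *s (z *s x - cmat A *v x)"
        by (simp add: vector_scalar_commute vector_ssub_ldistrib vector_smult_assoc mult.commute)
      also have "norm \<dots> = norm (z *s x - cmat A *v x) / norm x"
        by (simp only: norm_vector_scalar_mult norm_of_real) (simp add: divide_inverse mult.commute)
      finally show ?thesis using False by (simp add: divide_simps split: if_splits)
    qed simp
  qed
qed

lemma mat_vector_mult_scalar: "mat z *v x = z *s x"
  for x :: "('a::comm_ring_1)^'n"
  by (simp add: vec_eq_iff mat_def matrix_vector_mult_def if_distrib if_distribR cong: if_cong)

lemma has_integral_cis_zero:
  assumes "k \<ge> 1"
  shows "((\<lambda>t. cis (- (real k * t))) has_integral 0) {0..2 * pi}"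
proof -
  let ?F = "\<lambda>t. (\<i> / of_nat k) * cis (- (real k * t))"
  have "((\<lambda>t. cis (- (real k * t))) has_integral ?F (2 * pi) - ?F 0) {0..2 * pi}"
  proof (rule fundamental_theorem_of_calculus)
    fix t assume "t \<in> {0..2 * pi}"
    show "(?F has_vector_derivative cis (- (real k * t))) (at t within {0..2 * pi})"
      unfolding cis_conv_exp
      by (rule derivative_eq_intros refl has_vector_derivative_real_field | use assms in \<open>simp add: field_simps\<close>)+
  qed simp
  moreover have "cis (- (real k * (2 * pi))) = 1"
    using cis_multiple_2pi[of "- real k"] by (simp add: mult_ac)
  ultimately show ?thesis by simp
qed

text \<open>The resolvent \<open>X = (e\<^sup>i\<^sup>\<theta> - A)\<^sup>-\<^sup>1 b\<close> has mean zero on the unit circle.  With \<open>J\<^sub>m\<close> the integral of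
  \<open>e\<^sup>-\<^sup>i\<^sup>m\<^sup>\<theta> X\<close>, the resolvent equation gives \<open>J\<^sub>m = A J\<^sub>m\<^sub>+\<^sub>1\<close>, so \<open>J\<^sub>0 = A\<^sup>k J\<^sub>k\<close>, which tends to zero.\<close>

lemma stable_resolvent:
  fixes A :: "real^'n^'n" and b :: "complex^'n"
  defines "X \<equiv> \<lambda>\<theta>. matrix_inv (mat (cis \<theta>) - cmat A) *v b"
  assumes stable: "stable_matrix A"
  shows stable_resolvent_equation: "cis \<theta> *s X \<theta> = cmat A *v X \<theta> + b"
    and stable_resolvent_mean: "(X has_integral 0) {0..2 * pi}"
proof -
  obtain c where c: "0 < c" and below: "\<And>z x. cmod z = 1 \<Longrightarrow> c * norm x \<le> norm (z *s x - cmat A *v x)"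
    using stable_resolvent_bounded_below[OF stable] by blast
  have eq: "cis \<theta> *s X \<theta> - cmat A *v X \<theta> = b" for \<theta>
  proof -
    let ?R = "mat (cis \<theta>) - cmat A"
    have "\<forall>x. ?R *v x = 0 \<longrightarrow> x = 0"
    proof (intro allI impI)
      fix x assume "?R *v x = 0"
      then have "c * norm x \<le> 0"
        using below[of "cis \<theta>" x] by (simp add: matrix_vector_mult_diff_rdistrib mat_vector_mult_scalar)
      then show "x = 0" using c by (simp add: mult_le_0_iff)
    qed
    then have "invertible ?R"
      using matrix_left_invertible_ker invertible_left_inverse by blast
    then have "?R ** matrix_inv ?R = mat 1" 
      unfolding matrix_inv_def invertible_def by (rule someI2_ex) blast
    then have "?R *v X \<theta> = b" by (simp add: X_def matrix_vector_mul_assoc)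
    then show ?thesis by (simp add: matrix_vector_mult_diff_rdistrib mat_vector_mult_scalar)
  qed
  then show "cis \<theta> *s X \<theta> = cmat A *v X \<theta> + b" for \<theta>
    by (metis diff_eq_eq add.commute)
  have bound: "norm (X \<theta>) \<le> norm b / c" for \<theta>
    using below[of "cis \<theta>" "X \<theta>"] eq[of \<theta>] c by (simp add: field_simps)
  have cont: "continuous_on UNIV X"
    unfolding continuous_on_def
  proof
    fix \<theta>
    have lip: "norm (X t - X \<theta>) \<le> cmod (cis t - cis \<theta>) * (norm b / c) / c" for t
    proof -
      have "cis t *s (X t - X \<theta>) - cmat A *v (X t - X \<theta>) = (cis \<theta> - cis t) *s X \<theta>"
        using eq[of t] eq[of \<theta>]
        by (simp add: vector_ssub_ldistrib matrix_vector_mult_diff_distrib vector_sub_rdistrib algebra_simps)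
      then have "c * norm (X t - X \<theta>) \<le> cmod (cis \<theta> - cis t) * norm (X \<theta>)"
        using below[of "cis t" "X t - X \<theta>"] by (simp only: norm_vector_scalar_mult norm_cis)
      also have "\<dots> \<le> cmod (cis t - cis \<theta>) * (norm b / c)"
        using mult_left_mono[OF bound norm_ge_zero] by (simp only: norm_minus_commute[of "cis \<theta>"])
      finally show ?thesis using c by (simp add: field_simps)
    qed
    have "((\<lambda>t. cmod (cis t - cis \<theta>) * (norm b / c) / c) \<longlongrightarrow> cmod (cis \<theta> - cis \<theta>) * (norm b / c) / c) (at \<theta>)"
      unfolding cis_conv_exp by (intro tendsto_intros) (use c in auto)
    then have "((\<lambda>t. cmod (cis t - cis \<theta>) * (norm b / c) / c) \<longlongrightarrow> 0) (at \<theta>)"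
      by simp
    then have "((\<lambda>t. X t - X \<theta>) \<longlongrightarrow> 0) (at \<theta>)"
      by (rule Lim_null_comparison[OF always_eventually, rotated]) (rule allI, rule lip)
    then show "(X \<longlongrightarrow> X \<theta>) (at \<theta> within UNIV)"
      by (simp add: LIM_zero_iff)
  qed
  define Y where "Y m \<theta> = cis (- (real m * \<theta>)) *s X \<theta>" for m \<theta>
  define J where "J m = integral {0..2 * pi} (Y m)" for m
  have contY: "continuous_on S (Y m)" for m S
    unfolding Y_def vector_scalar_mult_def cis_conv_exp
    by (intro continuous_intros continuous_on_subset[OF cont]) auto
  have intY: "(Y m has_integral J m) {0..2 * pi}" for m
    unfolding J_def by (intro integrable_integral integrable_continuous_interval contY)
  have step: "J m = cmat A *v J (Suc m)" for m
  proof -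
    have "Y m \<theta> = cmat A *v Y (Suc m) \<theta> + cis (- (real (Suc m) * \<theta>)) *s b" for \<theta>
    proof -
      have "Y m \<theta> = cis (- (real (Suc m) * \<theta>)) *s (cis \<theta> *s X \<theta>)"
        by (simp add: Y_def vector_smult_assoc cis_mult algebra_simps)
      also have "cis \<theta> *s X \<theta> = cmat A *v X \<theta> + b" using eq[of \<theta>] by (simp add: algebra_simps)
      finally show ?thesis
        by (simp add: Y_def vector_add_ldistrib vector_scalar_commute)
    qed
    moreover have "((\<lambda>\<theta>. cmat A *v Y (Suc m) \<theta>) has_integral cmat A *v J (Suc m)) {0..2 * pi}"
      using has_integral_linear[OF intY matrix_vector_mul_bounded_linear] by (simp add: o_def)
    moreover have "((\<lambda>\<theta>. cis (- (real (Suc m) * \<theta>)) *s b) has_integral 0 *s b) {0..2 * pi}"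
    proof -
      have "bounded_linear (\<lambda>z. z *s b)"
        by (intro bounded_linear_intro[where K="norm b"])
           (auto simp: vec_eq_iff norm_vector_scalar_mult algebra_simps)
      from has_integral_linear[OF has_integral_cis_zero[of "Suc m"] this] show ?thesis
        by (simp add: o_def)
    qed
    ultimately have "((\<lambda>\<theta>. Y m \<theta>) has_integral cmat A *v J (Suc m) + 0 *s b) {0..2 * pi}"
      by (simp only:) (rule has_integral_add)
    from has_integral_unique[OF intY this] show ?thesis by simp
  qed
  have J0: "J 0 = matrix_iterate (cmat A) k (J k)" for k
    by (induction k) (auto simp: step[symmetric] matrix_iterate_commute[symmetric])
  define K where "K = norm b / c * (2 * pi)"
  have normJ: "norm (J k) \<le> K" for k
  proof -
    have "norm (J k) \<le> norm b / c * measure lborel (cbox 0 (2 * pi))"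
      using intY[of k] bound c
      by (intro has_integral_bound[where f="Y k"]) (auto simp: Y_def norm_vector_scalar_mult)
    then show ?thesis by (simp add: K_def)
  qed
  have "norm (J 0) \<le> (\<Sum>i\<in>UNIV. K * norm (matrix_iterate (cmat A) k (axis i 1)))" for k
  proof -
    have lin: "matrix_iterate (cmat A) k (\<Sum>i\<in>S. f i *s axis i 1) = (\<Sum>i\<in>S. f i *s matrix_iterate (cmat A) k (axis i 1))"
      if "finite S" for S and f :: "'n \<Rightarrow> complex"
      using that
    proof (induction S)
      case empty
      then show ?case using matrix_iterate_diff[where x=0 and y=0 and A="cmat A" and k=k] by simp
    next
      case (insert i S)
      have "matrix_iterate (cmat A) k (x + y) = matrix_iterate (cmat A) k x + matrix_iterate (cmat A) k y" for x y
        by (induction k) (auto simp: matrix_vector_right_distrib)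
      then show ?case using insert by (simp add: matrix_iterate_scalar)
    qed
    have "J 0 = matrix_iterate (cmat A) k (\<Sum>i\<in>UNIV. (J k $ i) *s axis i 1)"
      by (subst basis_expansion) (rule J0)
    also have "\<dots> = (\<Sum>i\<in>UNIV. (J k $ i) *s matrix_iterate (cmat A) k (axis i 1))"
      by (rule lin) simp
    finally have "norm (J 0) \<le> (\<Sum>i\<in>UNIV. norm ((J k $ i) *s matrix_iterate (cmat A) k (axis i 1)))"
      using norm_sum by metis
    also have "\<dots> \<le> (\<Sum>i\<in>UNIV. K * norm (matrix_iterate (cmat A) k (axis i 1)))"
      unfolding norm_vector_scalar_mult
      by (intro sum_mono mult_right_mono order_trans[OF Finite_Cartesian_Product.norm_nth_le normJ]) auto
    finally show ?thesis .
  qed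
  moreover have "(\<lambda>k. \<Sum>i\<in>UNIV. K * norm (matrix_iterate (cmat A) k (axis i 1))) \<longlonglongrightarrow> (\<Sum>i\<in>(UNIV::'n set). K * 0)"
    by (intro tendsto_sum tendsto_mult tendsto_const tendsto_norm_zero
      stable_matrix_iterates_tendsto_zero_complex stable)
  ultimately have "norm (J 0) \<le> (\<Sum>i\<in>(UNIV::'n set). K * 0)"
    by (intro LIMSEQ_le_const) auto
  then have "J 0 = 0" by simp
  moreover have "Y 0 = X" by (simp add: Y_def fun_eq_iff)
  ultimately show "(X has_integral 0) {0..2 * pi}"
    using intY[of 0] by simp
qed

text \<open>The Lyapunov equation makes the energy of the frequency response constant on the circle up to a
  term linear in the resolvent: \<open>z X\<close> and \<open>X\<close> have equal \<open>P\<close>-energy, so the resolvent equation expresses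
  \<open>|C X|\<^sup>2\<close> by terms in which \<open>X\<close> occurs at most linearly.\<close>

lemma resolvent_energy:
  fixes A :: "real^'n^'n" and B :: "real^'m^'n" and C :: "real^'n^'p" and D :: "real^'m^'p"
  assumes sym: "transpose P = P" and lyap: "P - transpose A ** P ** A = transpose C ** C"
    and z: "cmod z = 1" and X: "z *s X = cmat A *v X + cvec (B *v v)"
  shows "(norm (cmat C *v X + cvec (D *v v)))\<^sup>2 =
    v \<bullet> ((transpose B ** P ** B + transpose D ** D) *v v)
    + 2 * (X \<bullet> cvec ((transpose A ** P ** B + transpose C ** D) *v v))"
proof -
  have adj: "(cmat N *v x) \<bullet> cvec y = x \<bullet> cvec (transpose N *v y)" for N :: "real^'q^'r" and x y
    by (simp add: cmat_transpose_adjoint cmat_mult_cvec del: transpose_matrix_vector)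
  have "X \<bullet> (cmat P *v X) = (z *s X) \<bullet> (cmat P *v (z *s X))"
    by (simp add: inner_unimodular_scale[OF z] vector_scalar_commute)
  also have "\<dots> = (cmat A *v X) \<bullet> (cmat P *v (cmat A *v X)) + (cmat A *v X) \<bullet> (cmat P *v cvec (B *v v))
     + (cmat P *v (cmat A *v X)) \<bullet> cvec (B *v v) + cvec (B *v v) \<bullet> (cmat P *v cvec (B *v v))"
    by (simp add: X matrix_vector_right_distrib inner_add_left inner_add_right inner_commute)
  also have "(cmat P *v (cmat A *v X)) \<bullet> cvec (B *v v) = (cmat A *v X) \<bullet> (cmat P *v cvec (B *v v))"
    by (simp add: adj cmat_mult_cvec sym)
  finally have e1: "X \<bullet> (cmat P *v X) - (cmat A *v X) \<bullet> (cmat P *v (cmat A *v X)) =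
      2 * ((cmat A *v X) \<bullet> (cmat P *v cvec (B *v v))) + (B *v v) \<bullet> (P *v (B *v v))"
    by (simp add: cmat_mult_cvec inner_cvec)
  have "(norm (cmat C *v X))\<^sup>2 = X \<bullet> (cmat (transpose C ** C) *v X)"
    by (simp add: power2_norm_eq_inner cmat_transpose_adjoint cmat_matrix_mul matrix_vector_mul_assoc)
  also have "cmat (transpose C ** C) = cmat P - cmat (transpose A ** P ** A)"
    unfolding lyap[symmetric] by (simp add: vec_eq_iff)
  also have "X \<bullet> (\<dots> *v X) = X \<bullet> (cmat P *v X) - (cmat A *v X) \<bullet> (cmat P *v (cmat A *v X))"
    by (simp add: matrix_vector_mult_diff_rdistrib inner_diff_right cmat_matrix_mul cmat_transpose_adjoint matrix_vector_mul_assoc matrix_mul_assoc)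
  finally have e2: "(norm (cmat C *v X))\<^sup>2 = 2 * ((cmat A *v X) \<bullet> (cmat P *v cvec (B *v v))) + (B *v v) \<bullet> (P *v (B *v v))"
    using e1 by simp
  have "(norm (cmat C *v X + cvec (D *v v)))\<^sup>2 = (norm (cmat C *v X))\<^sup>2 + 2 * ((cmat C *v X) \<bullet> cvec (D *v v)) + (D *v v) \<bullet> (D *v v)"
    by (simp add: power2_norm_eq_inner inner_add_left inner_add_right inner_cvec inner_commute)
  moreover have "cvec (x + y) = cvec x + cvec y" for x y :: "real^'n" by (simp add: vec_eq_iff)
  moreover have "v \<bullet> ((transpose D ** D) *v v) = (D *v v) \<bullet> (D *v v)"
    by (simp add: inner_matrix_transpose matrix_vector_mul_assoc del: transpose_matrix_vector)
  ultimately show ?thesis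
    unfolding e2
    by (simp add: matrix_vector_mult_add_rdistrib inner_add_right lyapunov_form adj cmat_mult_cvec
      matrix_vector_mul_assoc[symmetric] inner_matrix_transpose[symmetric] del: transpose_matrix_vector)
qed

lemma trace_eq_sum_axis: "trace N = (\<Sum>j\<in>UNIV. axis j 1 \<bullet> (N *v axis j 1))"
  for N :: "real^'n^'n"
  by (simp add: trace_def inner_axis' matrix_vector_mult_basis column_def)

lemma frobenius_norm_squared_columns:
  fixes G :: "complex^'m^'p"
  shows "(frobenius_norm G)\<^sup>2 = (\<Sum>j\<in>UNIV. (norm (G *v axis j 1))\<^sup>2)"
proof -
  have "(G *v axis j 1) $ i = G $ i $ j" for i j
    by (simp add: matrix_vector_mult_def axis_def if_distrib[of "\<lambda>x. _ * x"] cong: if_cong)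
  then have "(norm (G *v axis j 1))\<^sup>2 = (\<Sum>i\<in>UNIV. (norm (G $ i $ j))\<^sup>2)" for j
    by (simp add: power2_norm_eq_inner inner_vec_def)
  moreover have "(\<Sum>i\<in>UNIV. \<Sum>j\<in>UNIV. (norm (G $ i $ j))\<^sup>2) = (\<Sum>j\<in>UNIV. \<Sum>i\<in>UNIV. (norm (G $ i $ j))\<^sup>2)"
    by (rule sum.swap)
  ultimately show ?thesis
    by (simp add: frobenius_norm_def real_sqrt_pow2 sum_nonneg)
qed

text \<open>Integrated over the circle, the terms linear in the resolvent vanish.\<close>

lemma h2_norm_squared:
  fixes A :: "real^'n^'n" and B :: "real^'m^'n" and C :: "real^'n^'p" and D :: "real^'m^'p"
  assumes stable: "stable_matrix A" and sym: "transpose P = P"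
    and lyap: "P - transpose A ** P ** A = transpose C ** C"
  shows "(h2_norm A B C D)\<^sup>2 = trace (transpose B ** P ** B + transpose D ** D)"
proof -
  let ?e = "\<lambda>j. axis j 1 :: real^'m"
  let ?M = "transpose B ** P ** B + transpose D ** D"
  let ?w = "\<lambda>j. cvec ((transpose A ** P ** B + transpose C ** D) *v ?e j)"
  define X where "X j \<theta> = matrix_inv (mat (cis \<theta>) - cmat A) *v cvec (B *v ?e j)" for j \<theta>
  have col: "(norm (transfer_function A B C D (cis \<theta>) *v axis j 1))\<^sup>2 = ?e j \<bullet> (?M *v ?e j) + 2 * (X j \<theta> \<bullet> ?w j)" for j \<theta>
  proof -
    have ax: "(axis j 1 :: complex^'m) = cvec (?e j)" by (simp add: vec_eq_iff axis_def)
    have "transfer_function A B C D (cis \<theta>) *v axis j 1 = cmat C *v X j \<theta> + cvec (D *v ?e j)"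
      unfolding ax transfer_function_def X_def
      by (simp add: matrix_vector_mult_add_rdistrib matrix_vector_mul_assoc[symmetric] cmat_mult_cvec)
    moreover have "cis \<theta> *s X j \<theta> = cmat A *v X j \<theta> + cvec (B *v ?e j)"
      unfolding X_def by (rule stable_resolvent_equation[OF stable])
    ultimately show ?thesis
      using resolvent_energy[OF sym lyap, of "cis \<theta>"] by simp
  qed
  have "((\<lambda>\<theta>. \<Sum>j\<in>UNIV. ?e j \<bullet> (?M *v ?e j) + 2 * (X j \<theta> \<bullet> ?w j)) has_integral
      (\<Sum>j\<in>UNIV. (2 * pi) *\<^sub>R (?e j \<bullet> (?M *v ?e j)) + 2 * (0 \<bullet> ?w j))) {0..2 * pi}"
  proof (intro has_integral_sum has_integral_add)
    fix j
    show "((\<lambda>\<theta>. ?e j \<bullet> (?M *v ?e j)) has_integral (2 * pi) *\<^sub>R (?e j \<bullet> (?M *v ?e j))) {0..2 * pi}"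
      using has_integral_const_real[of "?e j \<bullet> (?M *v ?e j)" 0 "2 * pi"] by simp
    have "(X j has_integral 0) {0..2 * pi}"
      unfolding X_def by (rule stable_resolvent_mean[OF stable])
    then show "((\<lambda>\<theta>. 2 * (X j \<theta> \<bullet> ?w j)) has_integral 2 * (0 \<bullet> ?w j)) {0..2 * pi}"
      using has_integral_mult_right[OF has_integral_linear[OF _ bounded_linear_inner_left, unfolded o_def]]
      by blast
  qed simp
  then have "((\<lambda>\<theta>. (frobenius_norm (transfer_function A B C D (cis \<theta>)))\<^sup>2) has_integral 2 * pi * trace ?M) {0..2 * pi}"
    unfolding frobenius_norm_squared_columns col trace_eq_sum_axis
    by (simp add: sum_distrib_left)
  moreover from this have "0 \<le> 2 * pi * trace ?M"
    by (rule has_integral_nonneg) simp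
  then have "0 \<le> trace ?M"
    using pi_gt_zero by (simp add: zero_le_mult_iff)
  ultimately show ?thesis
    by (simp add: h2_norm_def integral_unique)
qed

section \<open>The worst-case gain\<close>

lemma trace_congruence: "trace (transpose G ** X ** G ** S) = trace (X ** (G ** S ** transpose G))"
  for G :: "real^'n^'m"
proof -
  have "trace (transpose G ** (X ** G ** S)) = trace ((X ** G ** S) ** transpose G)"
    by (rule trace_mul_sym)
  then show ?thesis by (simp add: matrix_mul_assoc)
qed

lemma trace_add: "trace (X + Y) = trace X + trace Y"
  and trace_diff: "trace (X - Y) = trace X - trace Y"
  and trace_scaleR: "trace (c *\<^sub>R X) = c * trace X"
  for X Y :: "real^'n^'n"
  by (simp_all add: trace_def sum.distrib sum_subtractf sum_distrib_left)

text \<open>With \<open>S = R\<^sup>2\<close> the trace is that of the positive semidefinite matrix \<open>R X R\<close>.\<close>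

lemma trace_mul_posdef_nonneg:
  fixes X S :: "real^'n^'n"
  assumes X: "\<And>x. 0 \<le> x \<bullet> (X *v x)" and S: "posdef S"
  shows "0 \<le> trace (X ** S)"
proof -
  let ?R = "mat_sqrt S"
  have "trace (X ** S) = trace ((X ** ?R) ** ?R)"
    by (metis mat_sqrt_posdef(2)[OF S] matrix_mul_assoc)
  also have "\<dots> = trace (transpose ?R ** X ** ?R)"
    by (subst trace_mul_sym) (simp add: mat_sqrt_posdef(1)[OF S] matrix_mul_assoc)
  also have "\<dots> \<ge> 0"
    unfolding trace_eq_sum_axis lyapunov_form by (intro sum_nonneg X)
  finally show ?thesis .
qed

lemma filterlim_diff_const_at_top: "filterlim (\<lambda>l::real. l - c) at_top at_top"
  unfolding filterlim_at_top
proof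
  fix Z
  show "\<forall>\<^sub>F l in at_top. Z \<le> l - c"
    using eventually_ge_at_top[of "Z + c"] by eventually_elim simp
qed

lemma tendsto_resolvent_scalar: "((\<lambda>l::real. a / (l - c)) \<longlongrightarrow> 0) at_top"
  by (intro tendsto_divide_0[OF tendsto_const] filterlim_at_top_imp_at_infinity filterlim_diff_const_at_top)

text \<open>For \<open>m\<close> the eigenvalues of \<open>M\<close> and \<open>s u = u \<bullet> S u\<close>, the sum is the squared transport cost of the
  gain \<open>l (l - M)\<^sup>-\<^sup>1\<close>.  It runs continuously from infinity at the largest eigenvalue of \<open>M\<close>, because every
  direction carries positive weight, down to zero at infinity; so some \<open>l\<close> spends the budget exactly.\<close>

lemma ex_multiplier_spending_budget:
  fixes m s :: "'u \<Rightarrow> real"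
  assumes U: "finite U" and m: "\<And>u. u \<in> U \<Longrightarrow> 0 \<le> m u" and s: "\<And>u. u \<in> U \<Longrightarrow> 0 < s u"
    and u: "u \<in> U" "0 < m u" and g: "0 < g"
  obtains l where "\<And>u. u \<in> U \<Longrightarrow> m u < l" "(\<Sum>u\<in>U. (m u / (l - m u))\<^sup>2 * s u) = g\<^sup>2"
proof -
  define mx where "mx = Max (m ` U)"
  have mx: "m v \<le> mx" if "v \<in> U" for v
    using that U by (simp add: mx_def)
  have "mx \<in> m ` U" unfolding mx_def using U u by (intro Max_in) auto
  then obtain u0 where u0: "u0 \<in> U" "m u0 = mx" by auto
  have mx0: "0 < mx" using mx[OF u(1)] u(2) by simp
  let ?f = "\<lambda>l. \<Sum>u\<in>U. (m u / (l - m u))\<^sup>2 * s u"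
  (* at l1 the term of a maximal eigenvalue alone equals the budget *)
  define l1 where "l1 = mx + mx * sqrt (s u0) / g"
  have l1: "mx < l1" using mx0 g s[OF u0(1)] by (simp add: l1_def)
  have "g\<^sup>2 = (m u0 / (l1 - m u0))\<^sup>2 * s u0"
    using mx0 g s[OF u0(1)] u0(2) by (simp add: l1_def power_divide power_mult_distrib)
  also have "\<dots> \<le> ?f l1"
    using U u0 s by (intro member_le_sum) (auto simp: less_imp_le)
  finally have low: "g\<^sup>2 \<le> ?f l1" .
  have "(?f \<longlongrightarrow> (\<Sum>u\<in>U. 0\<^sup>2 * s u)) at_top"
    by (intro tendsto_sum tendsto_mult tendsto_power tendsto_const tendsto_resolvent_scalar)
  then have "\<forall>\<^sub>F l in at_top. ?f l < g\<^sup>2"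
    using g by (intro order_tendstoD) auto
  then have "\<forall>\<^sub>F l in at_top. ?f l < g\<^sup>2 \<and> l1 \<le> l"
    by (intro eventually_conj eventually_ge_at_top)
  then obtain l2 where l2: "?f l2 < g\<^sup>2" "l1 \<le> l2"
    using eventually_happens' trivial_limit_at_top_linorder by blast
  have "continuous_on {l1..l2} ?f"
    using l1 mx by (intro continuous_intros) force
  then obtain l where l: "l1 \<le> l" "?f l = g\<^sup>2"
    using IVT2'[of ?f l2 "g\<^sup>2" l1] low l2 by auto
  have "m v < l" if "v \<in> U" for v
    using mx[OF that] l1 l(1) by simp
  with l(2) that show ?thesis by blast
qed

text \<open>In an eigenbasis of \<open>M\<close> primal value and dual function become sums over eigenvalues.  If the
  budget can be spent, the dual function at the budget-spending \<open>l\<close> equals the primal value of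
  \<open>\<Delta> = l (l - M)\<^sup>-\<^sup>1\<close>.  Otherwise \<open>\<gamma> = 0\<close> or \<open>M = 0\<close>; then \<open>\<Delta> = I\<close>, and the dual function comes
  arbitrarily close to the primal value as \<open>l \<rightarrow> \<infinity>\<close> or \<open>l \<rightarrow> 0\<close>.  The tolerance \<open>e\<close> covers all cases.\<close>

lemma ex_worst_case_gain:
  fixes M S :: "real^'n^'n" and \<gamma> :: real
  assumes M: "possemidef M" and S: "posdef S" and \<gamma>: "0 \<le> \<gamma>"
  obtains \<Delta> where "posdef \<Delta>"
    "trace ((mat 1 - \<Delta>) ** S ** transpose (mat 1 - \<Delta>)) \<le> \<gamma>\<^sup>2"
    "\<And>e. 0 < e \<Longrightarrow> \<exists>l E. 0 < l \<and> posdef (mat l - M) \<and> transpose E = E \<and> (mat l - M) ** E = mat l \<and>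
      l * \<gamma>\<^sup>2 + trace ((l *\<^sub>R E - mat l) ** S) \<le> trace (\<Delta> ** M ** \<Delta> ** S) + e"
proof -
  obtain U m where U: "orthonormal_basis U" and Mm: "M = orthonormal_basis.spectral_matrix U m"
      and ev: "\<And>u. u \<in> U \<Longrightarrow> M *v u = m u *\<^sub>R u"
    by (rule symmetric_matrix_diagonalization[of M]) (use M in \<open>auto simp: possemidef_def\<close>)
  interpret orthonormal_basis U by fact
  define s where "s u = u \<bullet> (S *v u)" for u
  have s: "0 < s u" if "u \<in> U" for u
  proof -
    have "u \<noteq> 0" using unit[OF that] by auto
    then show ?thesis using S by (simp add: posdef_def s_def)
  qed
  have m: "0 \<le> m u" if "u \<in> U" for u
  proof -
    have "0 \<le> u \<bullet> (M *v u)" using M by (simp add: possemidef_def)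
    then show ?thesis using inner_basis[OF that that] by (simp add: ev[OF that])
  qed
  define h where "h l = l * \<gamma>\<^sup>2 + (\<Sum>u\<in>U. (l * (l / (l - m u)) - l) * s u)" for l
  have tr: "trace (spectral_matrix f ** S) = (\<Sum>u\<in>U. f u * s u)" for f
    by (simp add: trace_spectral_matrix_mul s_def)
  have cost: "trace ((mat 1 - spectral_matrix d) ** S ** transpose (mat 1 - spectral_matrix d)) = (\<Sum>u\<in>U. (1 - d u)\<^sup>2 * s u)" for d
  proof -
    have "mat 1 - spectral_matrix d = spectral_matrix (\<lambda>u. 1 - d u)"
      by (simp add: spectral_matrix_diff[symmetric] spectral_matrix_const)
    then show ?thesis
      by (simp add: transpose_spectral_matrix trace_mul_sym[of "_ ** S"] matrix_mul_assoc spectral_matrix_mul tr power2_eq_square)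
  qed
  have val: "trace (spectral_matrix d ** M ** spectral_matrix d ** S) = (\<Sum>u\<in>U. (d u)\<^sup>2 * m u * s u)" for d
    by (simp add: Mm spectral_matrix_mul tr power2_eq_square mult_ac)
  have dual: "\<exists>l E. 0 < l \<and> posdef (mat l - M) \<and> transpose E = E \<and> (mat l - M) ** E = mat l \<and>
      l * \<gamma>\<^sup>2 + trace ((l *\<^sub>R E - mat l) ** S) \<le> v" if l: "0 < l" "\<And>u. u \<in> U \<Longrightarrow> m u < l" "h l \<le> v" for l v
  proof (intro exI[of _ l] exI[of _ "spectral_matrix (\<lambda>u. l / (l - m u))"] conjI)
    have lM: "mat l - M = spectral_matrix (\<lambda>u. l - m u)"
      by (simp add: Mm spectral_matrix_diff[symmetric] spectral_matrix_const)
    show "0 < l" by fact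
    show "posdef (mat l - M)"
      unfolding lM using l(2) by (intro posdef_spectral_matrix) simp
    show "transpose (spectral_matrix (\<lambda>u. l / (l - m u))) = spectral_matrix (\<lambda>u. l / (l - m u))"
      by (rule transpose_spectral_matrix)
    have "(mat l - M) ** spectral_matrix (\<lambda>u. l / (l - m u)) = spectral_matrix (\<lambda>_. l)"
      unfolding lM spectral_matrix_mul using l(2) by (intro spectral_matrix_cong) fastforce
    then show "(mat l - M) ** spectral_matrix (\<lambda>u. l / (l - m u)) = mat l"
      by (simp only: spectral_matrix_const)
    have "l *\<^sub>R spectral_matrix (\<lambda>u. l / (l - m u)) - mat l = spectral_matrix (\<lambda>u. l * (l / (l - m u)) - l)"
      by (simp only: spectral_matrix_scaleR spectral_matrix_const[symmetric] spectral_matrix_diff)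
    then show "l * \<gamma>\<^sup>2 + trace ((l *\<^sub>R spectral_matrix (\<lambda>u. l / (l - m u)) - mat l) ** S) \<le> v"
      using l(3) by (simp add: tr h_def)
  qed
  show ?thesis
  proof (cases "0 < \<gamma> \<and> (\<exists>u\<in>U. 0 < m u)")
    case True
    then obtain u where "u \<in> U" "0 < m u" "0 < \<gamma>" by blast
    then have "\<exists>l. (\<forall>u\<in>U. m u < l) \<and> (\<Sum>u\<in>U. (m u / (l - m u))\<^sup>2 * s u) = \<gamma>\<^sup>2"
      by - (rule ex_multiplier_spending_budget[of U m s u \<gamma>, OF finite], (use m s in blast)+)
    then obtain l where l: "\<And>u. u \<in> U \<Longrightarrow> m u < l" and eq: "(\<Sum>u\<in>U. (m u / (l - m u))\<^sup>2 * s u) = \<gamma>\<^sup>2"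
      by blast
    have l0: "0 < l" using l[OF \<open>u \<in> U\<close>] \<open>0 < m u\<close> by simp
    let ?\<Delta> = "spectral_matrix (\<lambda>u. l / (l - m u))"
    have "(1 - l / (l - m u))\<^sup>2 = (m u / (l - m u))\<^sup>2" if "u \<in> U" for u
      using l[OF that] by (simp add: field_simps power2_eq_square)
    then have budget: "trace ((mat 1 - ?\<Delta>) ** S ** transpose (mat 1 - ?\<Delta>)) \<le> \<gamma>\<^sup>2"
      unfolding cost eq[symmetric] by simp
    have pd: "posdef ?\<Delta>"
      using l l0 by (intro posdef_spectral_matrix) simp
    have hl: "h l = trace (?\<Delta> ** M ** ?\<Delta> ** S)"
    proof -
      have "l * ((m u / (l - m u))\<^sup>2 * s u) + (l * (l / (l - m u)) - l) * s u = (l / (l - m u))\<^sup>2 * m u * s u"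
        if "u \<in> U" for u
      proof -
        have "l - m u \<noteq> 0" using l[OF that] by simp
        then have "l * (m u / (l - m u))\<^sup>2 + (l * (l / (l - m u)) - l) = (l / (l - m u))\<^sup>2 * m u"
          by (simp add: divide_simps power2_eq_square) (simp add: algebra_simps)
        then show ?thesis by (metis distrib_right mult.assoc)
      qed
      then show ?thesis
        unfolding h_def val eq[symmetric] sum_distrib_left sum.distrib[symmetric] by (intro sum.cong) auto
    qed
    have "\<exists>k E. 0 < k \<and> posdef (mat k - M) \<and> transpose E = E \<and> (mat k - M) ** E = mat k \<and>
      k * \<gamma>\<^sup>2 + trace ((k *\<^sub>R E - mat k) ** S) \<le> trace (?\<Delta> ** M ** ?\<Delta> ** S) + e" if "0 < e" for e
      using that by (intro dual[OF l0 l]) (simp_all add: hl)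
    then show ?thesis by (rule that[OF pd budget])
  next
    case False
    have "spectral_matrix (\<lambda>_. 1) = mat 1" by (simp add: spectral_matrix_const)
    then have one: "trace (mat 1 ** M ** mat 1 ** S) = (\<Sum>u\<in>U. m u * s u)"
      using val[of "\<lambda>_. 1"] by simp
    have ex: "\<exists>l>0. (\<forall>u\<in>U. m u < l) \<and> h l \<le> (\<Sum>u\<in>U. m u * s u) + e" if e: "0 < e" for e
    proof (cases "\<exists>u\<in>U. 0 < m u")
      case False
      then have "m u = 0" if "u \<in> U" for u using m[OF that] that by force
      moreover have "e / (\<gamma>\<^sup>2 + 1) * \<gamma>\<^sup>2 \<le> e"
        using e by (simp add: divide_simps add_nonneg_pos)
      moreover have "0 < e / (\<gamma>\<^sup>2 + 1)" using e by (simp add: add_nonneg_pos)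
      ultimately show ?thesis
        by (intro exI[of _ "e / (\<gamma>\<^sup>2 + 1)"]) (auto simp: h_def)
    next
      case True
      with False \<gamma> have g0: "\<gamma> = 0" by auto
      have hl: "h l = (\<Sum>u\<in>U. (m u + m u * (m u / (l - m u))) * s u)" if "\<forall>u\<in>U. m u < l" for l
        unfolding h_def g0 using that by (auto intro!: sum.cong simp: field_simps)
      have "((\<lambda>l. \<Sum>u\<in>U. (m u + m u * (m u / (l - m u))) * s u) \<longlongrightarrow> (\<Sum>u\<in>U. (m u + m u * 0) * s u)) at_top"
        by (intro tendsto_sum tendsto_mult tendsto_add tendsto_const tendsto_resolvent_scalar)
      then have "\<forall>\<^sub>F l in at_top. (\<Sum>u\<in>U. (m u + m u * (m u / (l - m u))) * s u) < (\<Sum>u\<in>U. m u * s u) + e"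
        using e by (intro order_tendstoD) auto
      moreover have "\<forall>\<^sub>F l in at_top. \<forall>u\<in>U. m u < l"
        using finite by (simp add: eventually_ball_finite eventually_gt_at_top)
      ultimately have "\<forall>\<^sub>F l in at_top. (\<Sum>u\<in>U. (m u + m u * (m u / (l - m u))) * s u) < (\<Sum>u\<in>U. m u * s u) + e
          \<and> (\<forall>u\<in>U. m u < l) \<and> 0 < l"
        by (intro eventually_conj eventually_gt_at_top)
      then obtain l where "(\<Sum>u\<in>U. (m u + m u * (m u / (l - m u))) * s u) < (\<Sum>u\<in>U. m u * s u) + e"
          "\<forall>u\<in>U. m u < l" "0 < l"
        using eventually_happens' trivial_limit_at_top_linorder by blast
      then show ?thesis using hl by (intro exI[of _ l]) auto
    qed
    have budget: "trace ((mat 1 - mat 1) ** S ** transpose (mat 1 - mat 1)) \<le> \<gamma>\<^sup>2"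
      by (simp add: trace_def)
    have pd: "posdef (mat 1 :: real^'n^'n)"
      by (simp add: posdef_def)
    have "\<exists>l E. 0 < l \<and> posdef (mat l - M) \<and> transpose E = E \<and> (mat l - M) ** E = mat l \<and>
      l * \<gamma>\<^sup>2 + trace ((l *\<^sub>R E - mat l) ** S) \<le> trace (mat 1 ** M ** mat 1 ** S) + e" if "0 < e" for e
      using ex[OF that] dual unfolding one by blast
    then show ?thesis by (rule that[OF pd budget])
  qed
qed

section \<open>The robust $H_2$ analysis problem\<close>

lemma matrix_add_rdistrib: "(X + Y) ** Z = X ** Z + Y ** Z"
  and matrix_sub_rdistrib: "(X - Y) ** Z = X ** Z - Y ** Z"
  and matrix_sub_ldistrib: "T ** (X - Y) = T ** X - T ** Y"
  for X Y :: "real^'n^'m" and Z :: "real^'k^'n" and T :: "real^'m^'j"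
  by (simp_all add: matrix_eq matrix_vector_mul_assoc[symmetric] matrix_vector_mult_add_rdistrib
      matrix_vector_mult_diff_rdistrib matrix_vector_mult_diff_distrib)

definition stack :: "real^'m \<Rightarrow> real^'n \<Rightarrow> real^('m + 'n)"
  where "stack x y = (\<chi> i. case i of Inl k \<Rightarrow> x $ k | Inr k \<Rightarrow> y $ k)"

lemma sum_UNIV_sum: "(\<Sum>i\<in>(UNIV :: ('a::finite + 'b::finite) set). f i) = (\<Sum>i\<in>UNIV. f (Inl i)) + (\<Sum>i\<in>UNIV. f (Inr i))"
  by (simp add: UNIV_Plus_UNIV[symmetric] sum.Plus del: UNIV_Plus_UNIV)

lemma stack_cases: obtains a b where "x = stack a b"
proof
  show "x = stack (\<chi> i. x $ Inl i) (\<chi> i. x $ Inr i)"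
    by (auto simp: stack_def vec_eq_iff split: sum.split)
qed

lemma inner_stack: "stack a b \<bullet> stack c d = a \<bullet> c + b \<bullet> d"
  by (simp add: inner_vec_def sum_UNIV_sum stack_def)

lemma stack_eq_0_iff: "stack a b = 0 \<longleftrightarrow> a = 0 \<and> b = 0"
  by (auto simp: vec_eq_iff stack_def split: sum.splits)

lemma hcat_mult_stack: "(A ||| B) *v stack a b = A *v a + B *v b"
  by (simp add: vec_eq_iff matrix_vector_mult_def sum_UNIV_sum stack_def hcat_def)

lemma vcat_mult: "(A ;; B) *v x = stack (A *v x) (B *v x)"
  by (auto simp: vec_eq_iff matrix_vector_mult_def stack_def vcat_def split: sum.split)

lemmas block_simps = hcat_mult_stack vcat_mult inner_stack

text \<open>Read as a quadratic form in \<open>(a, b)\<close>, the block inequality says that \<open>b \<bullet> Q b\<close> strictly exceeds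
  the value of playing \<open>a\<close> instead of the nominal \<open>b\<close> at transport price \<open>l\<close>.\<close>

lemma robust_lmi_iff:
  fixes B :: "real^'m^'n" and D :: "real^'m^'p"
  assumes P: "transpose P = P" and Q: "transpose Q = Q"
  shows "(let F = (B     ||| 0 ;;
              D     ||| 0 ;;
              mat 1 ||| 0 ;;
              0     ||| mat 1)
     in negdef (transpose F **
             (P ||| 0     ||| 0         ||| 0     ;;
              0 ||| mat 1 ||| 0         ||| 0     ;;
              0 ||| 0     ||| - (mat l) ||| mat l ;;
              0 ||| 0     ||| mat l     ||| - Q - mat l) ** F)) \<longleftrightarrow>
    (\<forall>a b. (a, b) \<noteq> (0, 0) \<longrightarrow>
      a \<bullet> ((transpose B ** P ** B + transpose D ** D) *v a) - l * ((a - b) \<bullet> (a - b)) < b \<bullet> (Q *v b))"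
proof -
  define F where "F = (B ||| 0 ;; D ||| 0 ;; mat 1 ||| 0 ;; (0 :: real^'m^'m) ||| mat 1)"
  define W where "W = (P ||| 0     ||| 0         ||| 0     ;;
              0 ||| (mat 1 :: real^'p^'p) ||| 0         ||| 0     ;;
              0 ||| 0     ||| - (mat l) ||| mat l ;;
              0 ||| 0     ||| mat l     ||| - Q - mat l)"
  have F: "F *v stack a b = stack (B *v a) (stack (D *v a) (stack a b))" for a b
    by (simp add: F_def block_simps)
  have W: "W *v stack p (stack q (stack r s)) =
      stack (P *v p) (stack q (stack (l *\<^sub>R s - l *\<^sub>R r) (l *\<^sub>R r + (- (Q *v s) - l *\<^sub>R s))))" for p q r s
    by (simp add: W_def block_simps matrix_vector_mult_diff_rdistrib)
  have symW: "transpose W = W"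
  proof (rule symmetric_matrixI)
    fix x y :: "real^('n + 'p + 'm + 'm)"
    obtain p q r s p' q' r' s' where "x = stack p (stack q (stack r s))" "y = stack p' (stack q' (stack r' s'))"
      by (metis stack_cases)
    then show "(W *v x) \<bullet> y = x \<bullet> (W *v y)"
      using inner_symmetric_matrix[OF P, of p p'] inner_symmetric_matrix[OF Q, of s s']
      by (simp add: W inner_stack inner_diff_left inner_diff_right inner_commute algebra_simps)
  qed
  have sym: "transpose (- (transpose F ** W ** F)) = - (transpose F ** W ** F)"
    by (simp add: transpose_minus matrix_transpose_mul symW matrix_mul_assoc)
  have form: "stack a b \<bullet> (- (transpose F ** W ** F) *v stack a b) =
      b \<bullet> (Q *v b) - (a \<bullet> ((transpose B ** P ** B + transpose D ** D) *v a) - l * ((a - b) \<bullet> (a - b)))" for a b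
  proof -
    have "a \<bullet> ((transpose D ** D) *v a) = (D *v a) \<bullet> (D *v a)"
      using lyapunov_form[of a D "mat 1" D a] by simp
    then show ?thesis
      by (simp add: lyapunov_form F W inner_stack matrix_vector_mult_add_rdistrib inner_diff_left inner_diff_right
          inner_add_right inner_commute algebra_simps)
  qed
  have "negdef (transpose F ** W ** F) \<longleftrightarrow>
      (\<forall>a b. stack a b \<noteq> 0 \<longrightarrow> 0 < stack a b \<bullet> (- (transpose F ** W ** F) *v stack a b))"
    unfolding posdef_def using sym by (metis stack_cases)
  then show ?thesis
    unfolding F_def[symmetric] W_def[symmetric] Let_def form by (auto simp: stack_eq_0_iff)
qed

lemma posdef_bounded_below:
  fixes R :: "real^'n^'n"
  assumes "posdef R"
  obtains c where "0 < c" "\<And>x. c * (x \<bullet> x) \<le> x \<bullet> (R *v x)"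
proof -
  let ?S = "sphere (0::real^'n) 1"
  have "continuous_on ?S (\<lambda>x. x \<bullet> (R *v x))"
    by (intro continuous_intros bounded_linear.continuous_on[OF matrix_vector_mul_bounded_linear])
  moreover have "?S \<noteq> {}"
  proof -
    obtain x :: "real^'n" where "norm x = 1" using vector_choose_size[of 1] by auto
    then show ?thesis by auto
  qed
  ultimately obtain x0 where x0: "x0 \<in> ?S" and min: "\<And>x. x \<in> ?S \<Longrightarrow> x0 \<bullet> (R *v x0) \<le> x \<bullet> (R *v x)"
    using continuous_attains_inf[OF compact_sphere, of 0 1 "\<lambda>x. x \<bullet> (R *v x)"] by blast
  show ?thesis
  proof (rule that[of "x0 \<bullet> (R *v x0)"])
    have "x0 \<noteq> 0" using x0 by auto
    then show "0 < x0 \<bullet> (R *v x0)" using assms by (simp add: posdef_def)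
  next
    fix x :: "real^'n"
    show "x0 \<bullet> (R *v x0) * (x \<bullet> x) \<le> x \<bullet> (R *v x)"
    proof (cases "x = 0")
      case False
      have "x0 \<bullet> (R *v x0) \<le> (x /\<^sub>R norm x) \<bullet> (R *v (x /\<^sub>R norm x))"
        using False by (intro min) simp
      also have "\<dots> = (x \<bullet> (R *v x)) / (x \<bullet> x)"
        by (simp add: matrix_vector_mult_scaleR dot_square_norm power2_eq_square divide_simps)
      finally show ?thesis using False by (simp add: divide_simps split: if_splits)
    qed simp
  qed
qed

text \<open>For \<open>l I \<succ> M\<close>, the gain \<open>E = l (l - M)\<^sup>-\<^sup>1\<close> maps \<open>b\<close> to the maximizer over \<open>a\<close> of
  \<open>a \<bullet> M a - l |a - b|\<^sup>2\<close>, and \<open>l E - l\<close> is the form of the maximal values.\<close>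

lemma completed_square:
  fixes M E :: "real^'n^'n"
  assumes M: "transpose M = M" and E: "transpose E = E" and ME: "(mat l - M) ** E = mat l"
  shows "b \<bullet> ((l *\<^sub>R E - mat l) *v b) - (a \<bullet> (M *v a) - l * ((a - b) \<bullet> (a - b)))
    = (a - E *v b) \<bullet> ((mat l - M) *v (a - E *v b))"
proof -
  have RE: "(mat l - M) *v (E *v b) = l *\<^sub>R b"
    by (simp add: matrix_vector_mul_assoc ME)
  have sym: "transpose (mat l - M) = mat l - M" by (simp add: transpose_diff M transpose_mat)
  have "(E *v b) \<bullet> ((mat l - M) *v a) = l * (b \<bullet> a)"
    using inner_symmetric_matrix[OF sym, of "E *v b" a] RE by simp
  then show ?thesis
    unfolding matrix_vector_mult_diff_distrib RE
    by (simp add: inner_diff_left inner_diff_right matrix_vector_mult_diff_rdistrib inner_commute algebra_simps)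
qed

context
  fixes A P :: "real^'n^'n" and B :: "real^'m^'n" and C :: "real^'n^'p" and D :: "real^'m^'p" and M :: "real^'m^'m"
  assumes stable: "stable_matrix A" and P: "possemidef P"
    and lyap: "P - transpose A ** P ** A = transpose C ** C"
    and M_def: "M = transpose B ** P ** B + transpose D ** D"
begin

lemma transpose_storage: "transpose M = M"
  using P by (simp add: M_def possemidef_def transpose_add matrix_transpose_mul matrix_mul_assoc)

text \<open>Any feasible \<open>P'\<close> dominates the Lyapunov solution \<open>P\<close>, since their difference solves a
  Lyapunov equation with positive right-hand side.\<close>

lemma robust_h2_feasible_bound:
  assumes "(l, Q, P') \<in> robust_h2_feasible A B C D"
  shows "a \<bullet> (M *v a) - l * ((a - b) \<bullet> (a - b)) \<le> b \<bullet> (Q *v b)"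
proof -
  have Q: "transpose Q = Q" and P': "transpose P' = P'"
    and lmi: "\<And>x. x \<noteq> 0 \<Longrightarrow> 0 < x \<bullet> (- (transpose A ** P' ** A - P' + transpose C ** C) *v x)"
    using assms by (auto simp: robust_h2_feasible_def posdef_def)
  from assms have blk: "(a, b) \<noteq> (0, 0) \<Longrightarrow>
      a \<bullet> ((transpose B ** P' ** B + transpose D ** D) *v a) - l * ((a - b) \<bullet> (a - b)) < b \<bullet> (Q *v b)"
    unfolding robust_h2_feasible_def by (simp add: robust_lmi_iff[OF P' Q] del: transpose_matrix_vector)
  have "possemidef (P' - P)"
  proof (rule lyapunov_solution_possemidef[OF stable])
    show "transpose (P' - P) = P' - P" using P P' by (simp add: transpose_diff possemidef_def)
    fix x
    have "P' - P - transpose A ** (P' - P) ** A = - (transpose A ** P' ** A - P' + transpose C ** C)"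
      unfolding lyap[symmetric] by (simp add: matrix_sub_ldistrib matrix_sub_rdistrib)
    moreover have "0 \<le> x \<bullet> (- (transpose A ** P' ** A - P' + transpose C ** C) *v x)"
      using less_imp_le[OF lmi, of x] by (cases "x = 0") (simp, blast)
    ultimately show "0 \<le> x \<bullet> ((P' - P - transpose A ** (P' - P) ** A) *v x)"
      by (simp only:)
  qed
  then have "0 \<le> (B *v a) \<bullet> ((P' - P) *v (B *v a))"
    by (simp add: possemidef_def)
  then have "a \<bullet> (M *v a) \<le> a \<bullet> ((transpose B ** P' ** B + transpose D ** D) *v a)"
    by (simp add: M_def matrix_vector_mult_add_rdistrib matrix_vector_mult_diff_rdistrib inner_add_right
      inner_diff_right lyapunov_form)
  then show ?thesis using blk by (cases "(a, b) = (0, 0)") auto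
qed

text \<open>The Lyapunov solution itself is not strictly feasible; adding a small multiple of the solution
  for the right-hand side \<open>I\<close>, and \<open>k I\<close> to \<open>Q\<close>, makes all inequalities strict.\<close>

lemma ex_robust_h2_feasible:
  assumes l: "0 < l" "posdef (mat l - M)" and E: "transpose E = E" "(mat l - M) ** E = mat l" and k: "0 < k"
  shows "\<exists>P'. (l, l *\<^sub>R E - mat l + mat k, P') \<in> robust_h2_feasible A B C D"
proof -
  have "possemidef (mat 1 :: real^'n^'n)" by (simp add: possemidef_def)
  then obtain P0 where P0: "possemidef P0" "P0 - transpose A ** P0 ** A = mat 1"
    using ex_lyapunov_solution[OF stable] by blast
  define N where "N = transpose B ** P0 ** B"
  obtain c where c: "0 < c" "\<And>x. c * (x \<bullet> x) \<le> x \<bullet> ((mat l - M) *v x)"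
    using posdef_bounded_below[OF l(2)] by blast
  obtain v where v: "0 < v" "\<And>x. norm (N *v x) \<le> norm x * v"
    using bounded_linear.pos_bounded[OF matrix_vector_mul_bounded_linear[of N]] by blast
  obtain d where d: "0 < d" "\<And>x. norm (E *v x) \<le> norm x * d"
    using bounded_linear.pos_bounded[OF matrix_vector_mul_bounded_linear[of E]] by blast
  (* The perturbation e N is controlled by c |a - E b|^2 + k |b|^2: since a = (a - E b) + E b,
     |a|^2 is at most 2 |a - E b|^2 + 2 d^2 |b|^2, and half of each coefficient suffices. *)
  define e where "e = min (c / (4 * v)) (k / (4 * v * d\<^sup>2))"
  have e: "0 < e" "2 * e * v \<le> c / 2" "2 * e * v * d\<^sup>2 \<le> k / 2"
  proof -
    show "0 < e" using c v d k by (simp add: e_def)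
    have "e \<le> c / (4 * v)" by (simp add: e_def)
    then show "2 * e * v \<le> c / 2" using v by (simp add: field_simps)
    have "e \<le> k / (4 * v * d\<^sup>2)" by (simp add: e_def)
    then show "2 * e * v * d\<^sup>2 \<le> k / 2" using v d by (simp add: field_simps)
  qed
  define P' where "P' = P + e *\<^sub>R P0"
  define Q where "Q = l *\<^sub>R E - mat l + mat k"
  have symP: "transpose P = P" "transpose P0 = P0" using P P0 by (auto simp: possemidef_def)
  have tP': "transpose P' = P'"
    by (simp add: P'_def transpose_add symP transpose_scalar)
  have tQ: "transpose Q = Q"
    by (simp add: Q_def transpose_add transpose_diff transpose_scalar E transpose_mat)
  have P0pos: "x \<bullet> x \<le> x \<bullet> (P0 *v x)" for x
  proof -
    have "x \<bullet> ((P0 - transpose A ** P0 ** A) *v x) = x \<bullet> x" using P0(2) by simp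
    moreover have "0 \<le> (A *v x) \<bullet> (P0 *v (A *v x))" using P0(1) by (simp add: possemidef_def)
    ultimately show ?thesis
      by (simp add: matrix_vector_mult_diff_rdistrib inner_diff_right lyapunov_form)
  qed
  have "posdef P'"
    unfolding posdef_def
  proof (intro conjI tP' allI impI)
    fix x :: "real^'n" assume "x \<noteq> 0"
    then have "0 < x \<bullet> (P0 *v x)" using P0pos[of x] by (smt (verit) inner_gt_zero_iff)
    moreover have "0 \<le> x \<bullet> (P *v x)" using P by (simp add: possemidef_def)
    ultimately show "0 < x \<bullet> (P' *v x)"
      using e(1) by (simp add: P'_def matrix_vector_mult_add_rdistrib inner_add_right add_nonneg_pos)
  qed
  moreover have "negdef (transpose A ** P' ** A - P' + transpose C ** C)"
  proof -
    have "- (transpose A ** P' ** A - P' + transpose C ** C) = e *\<^sub>R (P0 - transpose A ** P0 ** A)"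
      unfolding lyap[symmetric] P'_def
      by (simp add: matrix_eq matrix_vector_mult_add_rdistrib matrix_vector_mult_diff_rdistrib
          matrix_vector_mul_assoc[symmetric] matrix_vector_right_distrib matrix_vector_mult_scaleR
          scaleR_diff_right del: transpose_matrix_vector)
    then show ?thesis
      using e(1) by (simp add: P0(2) posdef_def transpose_scalar transpose_mat)
  qed
  moreover have "a \<bullet> ((transpose B ** P' ** B + transpose D ** D) *v a) - l * ((a - b) \<bullet> (a - b)) < b \<bullet> (Q *v b)"
    if ab: "(a, b) \<noteq> (0, 0)" for a b
  proof -
    let ?c = "a - E *v b"
    have "norm a \<le> norm ?c + norm (E *v b)" using norm_triangle_ineq[of ?c "E *v b"] by simp
    also have "\<dots> \<le> norm ?c + norm b * d" using d(2) by simp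
    finally have "(norm a)\<^sup>2 \<le> (norm ?c + norm b * d)\<^sup>2" by (intro power_mono) auto
    also have "\<dots> \<le> 2 * (norm ?c)\<^sup>2 + 2 * (norm b * d)\<^sup>2"
      using sum_squares_ge_zero[of "norm ?c - norm b * d" 0] by (simp add: power2_eq_square algebra_simps)
    finally have na: "(norm a)\<^sup>2 \<le> 2 * (norm ?c)\<^sup>2 + 2 * d\<^sup>2 * (norm b)\<^sup>2" by (simp add: power_mult_distrib mult_ac)
    have "e * (a \<bullet> (N *v a)) \<le> e * (v * (norm a)\<^sup>2)"
    proof -
      have "a \<bullet> (N *v a) \<le> norm a * norm (N *v a)" by (rule norm_cauchy_schwarz)
      also have "\<dots> \<le> norm a * (norm a * v)" by (intro mult_left_mono v(2)) simp
      finally show ?thesis using e(1) by (simp add: power2_eq_square mult_ac)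
    qed
    also have "\<dots> \<le> e * (v * (2 * (norm ?c)\<^sup>2 + 2 * d\<^sup>2 * (norm b)\<^sup>2))"
      using na e(1) v(1) by (intro mult_left_mono) auto
    also have "\<dots> = (2 * e * v) * (norm ?c)\<^sup>2 + (2 * e * v * d\<^sup>2) * (norm b)\<^sup>2" by (simp add: algebra_simps)
    also have "\<dots> \<le> c / 2 * (norm ?c)\<^sup>2 + k / 2 * (norm b)\<^sup>2"
      by (intro add_mono mult_right_mono e) auto
    finally have "e * (a \<bullet> (N *v a)) \<le> c / 2 * (norm ?c)\<^sup>2 + k / 2 * (norm b)\<^sup>2" .
    moreover have "0 < c / 2 * (norm ?c)\<^sup>2 + k / 2 * (norm b)\<^sup>2"
    proof (cases "b = 0")
      case True
      with ab have "a \<noteq> 0" by simp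
      then show ?thesis using True c by simp
    next
      case False
      then show ?thesis using c k by (intro add_nonneg_pos) auto
    qed
    moreover have "c * (norm ?c)\<^sup>2 \<le> ?c \<bullet> ((mat l - M) *v ?c)"
      using c(2)[of ?c] by (simp add: dot_square_norm)
    moreover have "b \<bullet> (Q *v b) = b \<bullet> ((l *\<^sub>R E - mat l) *v b) + k * (norm b)\<^sup>2"
      by (simp add: Q_def matrix_vector_mult_add_rdistrib inner_add_right dot_square_norm)
    moreover have "a \<bullet> ((transpose B ** P' ** B + transpose D ** D) *v a) = a \<bullet> (M *v a) + e * (a \<bullet> (N *v a))"
      by (simp add: M_def N_def P'_def lyapunov_form matrix_vector_mult_add_rdistrib inner_add_right)
    ultimately show ?thesis
      using completed_square[OF transpose_storage E, of b a] by linarith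
  qed
  then have "let F = (B     ||| 0 ;;
              D     ||| 0 ;;
              mat 1 ||| 0 ;;
              0     ||| mat 1)
     in negdef (transpose F **
             (P' ||| 0     ||| 0         ||| 0     ;;
              0 ||| mat 1 ||| 0         ||| 0     ;;
              0 ||| 0     ||| - (mat l) ||| mat l ;;
              0 ||| 0     ||| mat l     ||| - Q - mat l) ** F)"
    unfolding robust_lmi_iff[OF tP' tQ] by blast
  ultimately have "(l, Q, P') \<in> robust_h2_feasible A B C D"
    using less_imp_le[OF l(1)] tQ unfolding robust_h2_feasible_def by blast
  then show ?thesis unfolding Q_def by blast
qed

text \<open>Weak duality tests the block inequality at \<open>a = Dl b\<close> and averages over \<open>b\<close> with second moment
  \<open>S\<close>; the reverse inequality uses the feasible points with arbitrarily small slack.\<close>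

lemma robust_h2_value_eq:
  assumes S: "posdef S" and Dl: "transpose Dl = Dl"
    and budget: "trace ((mat 1 - Dl) ** S ** transpose (mat 1 - Dl)) \<le> \<gamma>\<^sup>2"
    and dual: "\<And>e. 0 < e \<Longrightarrow> \<exists>l E. 0 < l \<and> posdef (mat l - M) \<and> transpose E = E \<and> (mat l - M) ** E = mat l \<and>
      l * \<gamma>\<^sup>2 + trace ((l *\<^sub>R E - mat l) ** S) \<le> trace (Dl ** M ** Dl ** S) + e"
  shows "robust_h2_value \<gamma> S A B C D = ereal (trace (Dl ** M ** Dl ** S))"
proof (rule antisym)
  let ?v = "trace (Dl ** M ** Dl ** S)"
  show "ereal ?v \<le> robust_h2_value \<gamma> S A B C D"
    unfolding robust_h2_value_def
  proof (rule INF_greatest, clarify)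
    fix l Q P' assume f: "(l, Q, P') \<in> robust_h2_feasible A B C D"
    then have l: "0 \<le> l" by (simp add: robust_h2_feasible_def)
    let ?G = "mat 1 - Dl"
    let ?X = "Q - Dl ** M ** Dl + l *\<^sub>R (transpose ?G ** ?G)"
    have "0 \<le> trace (?X ** S)"
    proof (rule trace_mul_posdef_nonneg[OF _ S])
      fix x
      have "x \<bullet> ((Dl ** M ** Dl) *v x) = (Dl *v x) \<bullet> (M *v (Dl *v x))"
        using lyapunov_form[of x Dl M Dl x] by (simp add: Dl)
      moreover have "x \<bullet> ((transpose ?G ** ?G) *v x) = (Dl *v x - x) \<bullet> (Dl *v x - x)"
        using lyapunov_form[of x ?G "mat 1" ?G x]
        by (simp add: matrix_vector_mult_diff_rdistrib inner_diff_left inner_diff_right)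
      ultimately show "0 \<le> x \<bullet> (?X *v x)"
        using robust_h2_feasible_bound[OF f, of "Dl *v x" x]
        by (simp add: matrix_vector_mult_add_rdistrib matrix_vector_mult_diff_rdistrib inner_add_right inner_diff_right)
    qed
    moreover have "trace (?X ** S) = trace (Q ** S) - ?v + l * trace (?G ** S ** transpose ?G)"
      using trace_congruence[of ?G "mat 1" S]
      by (simp add: matrix_add_rdistrib matrix_sub_rdistrib trace_add trace_diff trace_scaleR scalar_matrix_assoc[symmetric])
    moreover have "l * trace (?G ** S ** transpose ?G) \<le> l * \<gamma>\<^sup>2"
      using budget l by (rule mult_left_mono)
    ultimately show "ereal ?v \<le> ereal (trace (Q ** S) + l * \<gamma>\<^sup>2)"
      by simp
  qed
  show "robust_h2_value \<gamma> S A B C D \<le> ereal ?v"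
  proof (rule ereal_le_epsilon2)
    fix e :: real assume e: "0 < e"
    obtain l E where lE: "0 < l" "posdef (mat l - M)" "transpose E = E" "(mat l - M) ** E = mat l"
        and val: "l * \<gamma>\<^sup>2 + trace ((l *\<^sub>R E - mat l) ** S) \<le> ?v + e / 2"
      using dual[of "e / 2"] e by auto
    (* slack whose contribution to the objective is at most e / 2 *)
    define k where "k = e / (2 * (\<bar>trace S\<bar> + 1))"
    have k: "0 < k" using e by (simp add: k_def add_nonneg_pos)
    have kS: "k * trace S \<le> e / 2"
    proof -
      have "k * trace S \<le> k * (\<bar>trace S\<bar> + 1)" using k by (intro mult_left_mono) auto
      also have "\<dots> = e / 2" by (simp add: k_def field_simps add_nonneg_pos)
      finally show ?thesis .
    qed
    obtain P' where f: "(l, l *\<^sub>R E - mat l + mat k, P') \<in> robust_h2_feasible A B C D"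
      using ex_robust_h2_feasible[OF lE k] by blast
    have "mat k ** S = k *\<^sub>R S"
      by (simp add: matrix_eq matrix_vector_mul_assoc[symmetric])
    then have "trace ((l *\<^sub>R E - mat l + mat k) ** S) = trace ((l *\<^sub>R E - mat l) ** S) + k * trace S"
      by (simp only: matrix_add_rdistrib trace_add trace_scaleR)
    then have bound: "trace ((l *\<^sub>R E - mat l + mat k) ** S) + l * \<gamma>\<^sup>2 \<le> ?v + e"
      using val kS by linarith
    have "robust_h2_value \<gamma> S A B C D \<le> ereal (trace ((l *\<^sub>R E - mat l + mat k) ** S) + l * \<gamma>\<^sup>2)"
      unfolding robust_h2_value_def by (rule INF_lower2[OF f]) simp
    also have "\<dots> \<le> ereal (?v + e)" using bound by simp
    finally show "robust_h2_value \<gamma> S A B C D \<le> ereal ?v + ereal e"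
      by simp
  qed
qed

end

section \<open>Second moments and Wasserstein distance\<close>

definition square_integrable :: "'a measure \<Rightarrow> ('a \<Rightarrow> real^'n) \<Rightarrow> bool"
  where "square_integrable M X \<longleftrightarrow> X \<in> borel_measurable M \<and> integrable M (\<lambda>\<omega>. (norm (X \<omega>))\<^sup>2)"

lemma borel_measurable_matrix_vector_mult [measurable]:
  fixes A :: "real^'n^'m"
  shows "X \<in> borel_measurable M \<Longrightarrow> (\<lambda>\<omega>. A *v X \<omega>) \<in> borel_measurable M"
  by (rule borel_measurable_continuous_onI[THEN measurable_compose_rev])
     (rule linear_continuous_on[OF matrix_vector_mul_bounded_linear])

lemma integrable_inner:
  fixes X Y :: "'a \<Rightarrow> real^'n"
  assumes X: "square_integrable M X" and Y: "square_integrable M Y"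
  shows "integrable M (\<lambda>\<omega>. X \<omega> \<bullet> Y \<omega>)"
proof (rule Bochner_Integration.integrable_bound)
  show "integrable M (\<lambda>\<omega>. (norm (X \<omega>))\<^sup>2 + (norm (Y \<omega>))\<^sup>2)"
    using X Y by (simp add: square_integrable_def)
  show "(\<lambda>\<omega>. X \<omega> \<bullet> Y \<omega>) \<in> borel_measurable M"
    using X Y by (auto simp: square_integrable_def)
  have "\<bar>x \<bullet> y\<bar> \<le> (norm x)\<^sup>2 + (norm y)\<^sup>2" for x y :: "real^'n"
  proof -
    have "\<bar>x \<bullet> y\<bar> \<le> norm x * norm y" by (rule Cauchy_Schwarz_ineq2)
    moreover have "0 \<le> (norm x - norm y)\<^sup>2" "0 \<le> (norm x)\<^sup>2 + (norm y)\<^sup>2" by auto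
    ultimately show ?thesis by (simp add: power2_diff)
  qed
  then show "AE \<omega> in M. norm (X \<omega> \<bullet> Y \<omega>) \<le> norm ((norm (X \<omega>))\<^sup>2 + (norm (Y \<omega>))\<^sup>2)"
    by simp
qed

lemma square_integrable_matrix:
  fixes A :: "real^'n^'m"
  assumes "square_integrable M X"
  shows "square_integrable M (\<lambda>\<omega>. A *v X \<omega>)"
  unfolding square_integrable_def
proof
  obtain K where K: "0 < K" "\<And>x. norm (A *v x) \<le> norm x * K"
    using bounded_linear.pos_bounded[OF matrix_vector_mul_bounded_linear[of A]] by blast
  show meas: "(\<lambda>\<omega>. A *v X \<omega>) \<in> borel_measurable M"
    using assms by (intro borel_measurable_matrix_vector_mult) (simp add: square_integrable_def)
  have "(norm (A *v x))\<^sup>2 \<le> K\<^sup>2 * (norm x)\<^sup>2" for x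
  proof -
    have "(norm (A *v x))\<^sup>2 \<le> (norm x * K)\<^sup>2" by (intro power_mono K) simp
    then show ?thesis by (simp add: power_mult_distrib mult.commute)
  qed
  note bound = this
  show "integrable M (\<lambda>\<omega>. (norm (A *v X \<omega>))\<^sup>2)"
  proof (rule Bochner_Integration.integrable_bound)
    show "integrable M (\<lambda>\<omega>. K\<^sup>2 * (norm (X \<omega>))\<^sup>2)"
      using assms by (simp add: square_integrable_def)
    show "(\<lambda>\<omega>. (norm (A *v X \<omega>))\<^sup>2) \<in> borel_measurable M"
      using meas by measurable
    show "AE \<omega> in M. norm ((norm (A *v X \<omega>))\<^sup>2) \<le> norm (K\<^sup>2 * (norm (X \<omega>))\<^sup>2)"
      using bound by simp
  qed
qed

lemma square_integrable_add:
  assumes X: "square_integrable M X" and Y: "square_integrable M Y"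
  shows "square_integrable M (\<lambda>\<omega>. X \<omega> + Y \<omega>)"
  using X Y integrable_inner[OF X Y] integrable_inner[OF X X] integrable_inner[OF Y Y]
  by (simp add: square_integrable_def power2_norm_eq_inner inner_add_left inner_add_right inner_commute)

lemma square_integrable_zero: "square_integrable M (\<lambda>_. 0)"
  by (simp add: square_integrable_def)

lemma square_integrable_distr:
  assumes "f \<in> M \<rightarrow>\<^sub>M N" "g \<in> borel_measurable N"
  shows "square_integrable (distr M N f) g \<longleftrightarrow> square_integrable M (\<lambda>x. g (f x))"
  using assms by (simp add: square_integrable_def integrable_distr_eq)

abbreviation finite_second_moment :: "(real^'n) measure \<Rightarrow> bool"
  where "finite_second_moment P \<equiv> square_integrable P (\<lambda>x. x)"

lemma expectation_quadratic_form:
  fixes P :: "(real^'n) measure"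
  assumes P: "finite_second_moment P"
  shows "integrable P (\<lambda>x. x \<bullet> (X *v x))" "(LINT x|P. x \<bullet> (X *v x)) = trace (X ** second_moment P)"
proof -
  show "integrable P (\<lambda>x. x \<bullet> (X *v x))"
    by (intro integrable_inner P square_integrable_matrix)
  have int: "integrable P (\<lambda>x. x $ j * x $ i)" for i j
  proof -
    let ?N = "axis j (axis i 1) :: real^'n^'n"
    have "(?N *v x) $ a = axis j (x $ i) $ a" for x :: "real^'n" and a
      by (cases "a = j") (simp_all add: matrix_vector_mul_component inner_axis' axis_nth axis_def[of j])
    then have "?N *v x = axis j (x $ i)" for x :: "real^'n"
      by (simp add: vec_eq_iff)
    then have "x \<bullet> (?N *v x) = x $ j * x $ i" for x :: "real^'n"
      by (simp add: inner_axis)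
    then show ?thesis
      using integrable_inner[OF P square_integrable_matrix[OF P, of ?N]] by simp
  qed
  have "x \<bullet> (X *v x) = (\<Sum>i\<in>UNIV. \<Sum>j\<in>UNIV. X $ i $ j * (x $ j * x $ i))" for x
    by (simp add: inner_vec_def matrix_vector_mult_def sum_distrib_left mult_ac)
  then have "(LINT x|P. x \<bullet> (X *v x)) = (\<Sum>i\<in>UNIV. \<Sum>j\<in>UNIV. X $ i $ j * (LINT x|P. x $ j * x $ i))"
    by (simp only:) (subst Bochner_Integration.integral_sum,
        intro Bochner_Integration.integrable_sum integrable_mult_right int,
        intro sum.cong refl, subst Bochner_Integration.integral_sum, intro integrable_mult_right int,
        simp only: integral_mult_right_zero)
  then show "(LINT x|P. x \<bullet> (X *v x)) = trace (X ** second_moment P)"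
    by (simp add: trace_def matrix_matrix_mult_def second_moment_def)
qed

lemma normal_distribution_finite_second_moment:
  fixes P :: "(real^'n) measure"
  assumes "normal_distribution P"
  shows "finite_second_moment P"
proof -
  interpret prob_space P using assms by (simp add: normal_distribution_def)
  have sets[measurable_cong]: "sets P = sets borel" using assms by (simp add: normal_distribution_def)
  have "integrable P (\<lambda>x. (x $ i)\<^sup>2)" for i
  proof -
    obtain m s where s: "0 \<le> s" and d: "distr P borel (\<lambda>x. axis i 1 \<bullet> x) =
       (if s = 0 then return borel m else density lborel (normal_density m s))"
      using assms unfolding normal_distribution_def by blast
    have "integrable (distr P borel (\<lambda>x. axis i 1 \<bullet> x)) (\<lambda>y::real. y\<^sup>2)"
    proof (cases "s = 0")
      case True
      have "integrable (return borel m) (\<lambda>y::real. y\<^sup>2)"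
        by (rule integrableI_bounded) (auto simp: nn_integral_return)
      then show ?thesis by (simp add: d True)
    next
      case False
      then have "0 < s" using s by simp
      note mom = integrable_normal_moment[OF this, of m]
      have "integrable lborel (\<lambda>x. normal_density m s x * (x - m)^2 + 2 * m * (normal_density m s x * (x - m)^1)
          + m\<^sup>2 * (normal_density m s x * (x - m)^0))"
        by (intro Bochner_Integration.integrable_add integrable_mult_right mom)
      also have "(\<lambda>x. normal_density m s x * (x - m)^2 + 2 * m * (normal_density m s x * (x - m)^1)
          + m\<^sup>2 * (normal_density m s x * (x - m)^0)) = (\<lambda>x. normal_density m s x *\<^sub>R x\<^sup>2)"
        by (auto simp: fun_eq_iff power2_eq_square algebra_simps)
      finally show ?thesis by (simp add: d False integrable_density)
    qed
    then have "integrable P (\<lambda>x. (axis i 1 \<bullet> x)\<^sup>2)"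
      by (subst (asm) integrable_distr_eq) auto
    then show ?thesis by (simp add: inner_axis')
  qed
  moreover have "(norm x)\<^sup>2 = (\<Sum>i\<in>UNIV. (x $ i)\<^sup>2)" for x :: "real^'n"
    unfolding power2_norm_eq_inner inner_vec_def by (simp add: power2_eq_square)
  ultimately show ?thesis
    by (simp add: square_integrable_def)
qed

lemma couplings_nonempty:
  fixes P P' :: "(real^'n) measure"
  assumes "prob_space P" "prob_space P'" and s: "sets P = sets borel" "sets P' = sets borel"
  shows "P \<Otimes>\<^sub>M P' \<in> couplings P P'"
proof -
  interpret P: prob_space P by fact
  interpret P': prob_space P' by fact
  interpret PP: pair_prob_space P P' ..
  interpret PP': pair_prob_space P' P ..
  have "distr (P \<Otimes>\<^sub>M P') P fst = P" by (rule P'.distr_pair_fst)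
  moreover have "distr (P \<Otimes>\<^sub>M P') P' snd = P'"
  proof -
    have "distr (P \<Otimes>\<^sub>M P') P' snd = distr (distr (P' \<Otimes>\<^sub>M P) (P \<Otimes>\<^sub>M P') (\<lambda>(x, y). (y, x))) P' snd"
      by (simp add: PP.distr_pair_swap[symmetric])
    also have "\<dots> = distr (P' \<Otimes>\<^sub>M P) P' fst"
      by (subst distr_distr) (auto intro!: distr_cong)
    finally show ?thesis by (simp add: P.distr_pair_fst)
  qed
  moreover have "distr (P \<Otimes>\<^sub>M P') borel fst = distr (P \<Otimes>\<^sub>M P') P fst"
    "distr (P \<Otimes>\<^sub>M P') borel snd = distr (P \<Otimes>\<^sub>M P') P' snd"
    by (simp_all add: s cong: distr_cong)
  moreover have "sets (P \<Otimes>\<^sub>M P') = sets (borel \<Otimes>\<^sub>M borel)"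
    by (rule sets_pair_measure_cong[OF s])
  ultimately show ?thesis
    using PP.prob_space_axioms by (simp add: couplings_def)
qed

context
  fixes P P' :: "(real^'n) measure" and \<pi>
  assumes P: "finite_second_moment P" and P': "finite_second_moment P'" and \<pi>: "\<pi> \<in> couplings P P'"
begin

lemma coupling_measurable:
  "fst \<in> borel_measurable \<pi>" "snd \<in> borel_measurable \<pi>"
  using \<pi> measurable_cong_sets[of \<pi> "borel \<Otimes>\<^sub>M borel"] by (auto simp: couplings_def)

lemma coupling_square_integrable: "square_integrable \<pi> fst" "square_integrable \<pi> snd"
proof -
  have "square_integrable (distr \<pi> borel fst) (\<lambda>x. x)" "square_integrable (distr \<pi> borel snd) (\<lambda>x. x)"
    using P P' \<pi> by (auto simp: couplings_def)
  then show "square_integrable \<pi> fst" "square_integrable \<pi> snd"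
    using coupling_measurable by (auto simp: square_integrable_distr)
qed

lemma coupling_expectation:
  "(LINT p|\<pi>. fst p \<bullet> (X *v fst p)) = trace (X ** second_moment P)"
  "(LINT p|\<pi>. snd p \<bullet> (X *v snd p)) = trace (X ** second_moment P')"
proof -
  have "(LINT x|distr \<pi> borel fst. x \<bullet> (X *v x)) = trace (X ** second_moment P)"
    "(LINT x|distr \<pi> borel snd. x \<bullet> (X *v x)) = trace (X ** second_moment P')"
    using \<pi> expectation_quadratic_form(2)[OF P] expectation_quadratic_form(2)[OF P'] by (auto simp: couplings_def)
  then show "(LINT p|\<pi>. fst p \<bullet> (X *v fst p)) = trace (X ** second_moment P)"
    "(LINT p|\<pi>. snd p \<bullet> (X *v snd p)) = trace (X ** second_moment P')"
    using coupling_measurable by (simp_all add: integral_distr)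
qed

lemma coupling_cost_integrable: "integrable \<pi> (\<lambda>p. (norm (fst p - snd p))\<^sup>2)"
proof -
  have "square_integrable \<pi> (\<lambda>p. fst p + (- mat 1) *v snd p)"
    by (intro square_integrable_add square_integrable_matrix coupling_square_integrable)
  then show ?thesis by (simp add: square_integrable_def)
qed

lemma coupling_cost: "(\<integral>\<^sup>+(x, y). ennreal ((norm (x - y))\<^sup>2) \<partial>\<pi>) = ennreal (LINT p|\<pi>. (norm (fst p - snd p))\<^sup>2)"
  unfolding split_beta' using nn_integral_eq_integral[OF coupling_cost_integrable] by simp

text \<open>Weak Kantorovich duality with quadratic potentials.\<close>

lemma quadratic_potential_bound:
  assumes "\<And>x y. x \<bullet> (X *v x) - l * ((x - y) \<bullet> (x - y)) \<le> y \<bullet> (Y *v y)"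
  shows "trace (X ** second_moment P) \<le> l * (LINT p|\<pi>. (norm (fst p - snd p))\<^sup>2) + trace (Y ** second_moment P')"
proof -
  have i: "integrable \<pi> (\<lambda>p. fst p \<bullet> (X *v fst p))" "integrable \<pi> (\<lambda>p. snd p \<bullet> (Y *v snd p))"
    by (intro integrable_inner square_integrable_matrix coupling_square_integrable)+
  have "(LINT p|\<pi>. fst p \<bullet> (X *v fst p)) \<le> (LINT p|\<pi>. l * (norm (fst p - snd p))\<^sup>2 + snd p \<bullet> (Y *v snd p))"
  proof (rule integral_mono[OF i(1)])
    show "integrable \<pi> (\<lambda>p. l * (norm (fst p - snd p))\<^sup>2 + snd p \<bullet> (Y *v snd p))"
      by (intro Bochner_Integration.integrable_add integrable_mult_right coupling_cost_integrable i(2))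
    show "fst p \<bullet> (X *v fst p) \<le> l * (norm (fst p - snd p))\<^sup>2 + snd p \<bullet> (Y *v snd p)" for p
      using assms[of "fst p" "snd p"] by (simp add: power2_norm_eq_inner)
  qed
  also have "\<dots> = l * (LINT p|\<pi>. (norm (fst p - snd p))\<^sup>2) + (LINT p|\<pi>. snd p \<bullet> (Y *v snd p))"
    using i coupling_cost_integrable by simp
  finally show ?thesis by (simp add: coupling_expectation)
qed

end

lemma wasserstein2_le_imp_ex_coupling:
  fixes P P' :: "(real^'n) measure"
  assumes P: "prob_space P" "sets P = sets borel" "finite_second_moment P"
    and P': "prob_space P'" "sets P' = sets borel" "finite_second_moment P'"
    and W: "wasserstein2 P P' \<le> \<gamma>" and e: "0 < e"
  obtains \<pi> where "\<pi> \<in> couplings P P'" "(LINT p|\<pi>. (norm (fst p - snd p))\<^sup>2) \<le> \<gamma>\<^sup>2 + e"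
proof -
  let ?I = "INF \<pi>\<in>couplings P P'. \<integral>\<^sup>+(x, y). ennreal ((norm (x - y))\<^sup>2) \<partial>\<pi>"
  have "?I \<le> (\<integral>\<^sup>+(x, y). ennreal ((norm (x - y))\<^sup>2) \<partial>(P \<Otimes>\<^sub>M P'))"
    by (intro INF_lower couplings_nonempty P P')
  also have "\<dots> < top"
    by (subst coupling_cost[OF P(3) P'(3) couplings_nonempty[OF P(1) P'(1) P(2) P'(2)]]) simp
  finally have fin: "?I < top" .
  have "sqrt (enn2real ?I) \<le> \<gamma>" using W by (simp add: wasserstein2_def)
  then have "enn2real ?I \<le> \<gamma>\<^sup>2" by (rule sqrt_le_D)
  then have "enn2real ?I < \<gamma>\<^sup>2 + e" using e by simp
  then have "?I < ennreal (\<gamma>\<^sup>2 + e)"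
    using fin by (subst ennreal_enn2real[OF fin, symmetric]) (rule ennreal_lessI, auto simp: e add_nonneg_pos)
  then obtain \<pi> where \<pi>: "\<pi> \<in> couplings P P'" "(\<integral>\<^sup>+(x, y). ennreal ((norm (x - y))\<^sup>2) \<partial>\<pi>) < ennreal (\<gamma>\<^sup>2 + e)"
    by (auto simp: INF_less_iff)
  then have "(LINT p|\<pi>. (norm (fst p - snd p))\<^sup>2) \<le> \<gamma>\<^sup>2 + e"
    unfolding coupling_cost[OF P(3) P'(3) \<pi>(1)] using e by (subst (asm) ennreal_less_iff) auto
  with \<pi>(1) that show ?thesis by blast
qed

lemma wasserstein2_eqI:
  fixes P P' :: "(real^'n) measure"
  assumes P: "finite_second_moment P" and P': "finite_second_moment P'"
    and \<pi>: "\<pi> \<in> couplings P P'" "(LINT p|\<pi>. (norm (fst p - snd p))\<^sup>2) = c"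
    and lower: "\<And>\<pi>. \<pi> \<in> couplings P P' \<Longrightarrow> c \<le> (LINT p|\<pi>. (norm (fst p - snd p))\<^sup>2)"
  shows "wasserstein2 P P' = sqrt c"
proof -
  have "0 \<le> c" unfolding \<pi>(2)[symmetric] by (rule Bochner_Integration.integral_nonneg) simp
  moreover have "(INF \<pi>\<in>couplings P P'. \<integral>\<^sup>+(x, y). ennreal ((norm (x - y))\<^sup>2) \<partial>\<pi>) = ennreal c"
  proof (rule antisym)
    show "(INF \<pi>\<in>couplings P P'. \<integral>\<^sup>+(x, y). ennreal ((norm (x - y))\<^sup>2) \<partial>\<pi>) \<le> ennreal c"
      using \<pi> coupling_cost[OF P P' \<pi>(1)] by (intro INF_lower2[OF \<pi>(1)]) simp
    show "ennreal c \<le> (INF \<pi>\<in>couplings P P'. \<integral>\<^sup>+(x, y). ennreal ((norm (x - y))\<^sup>2) \<partial>\<pi>)"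
      using lower coupling_cost[OF P P'] by (intro INF_greatest) (simp add: ennreal_leI)
  qed
  ultimately show ?thesis by (simp add: wasserstein2_def)
qed

lemma second_moment_matrix_image:
  fixes P :: "(real^'n) measure"
  assumes P: "finite_second_moment P" and s: "sets P = sets borel"
  shows "finite_second_moment (distr P borel ((*v) G))"
    "trace (X ** second_moment (distr P borel ((*v) G))) = trace (X ** (G ** second_moment P ** transpose G))"
proof -
  have m: "(*v) G \<in> borel_measurable P"
    using P by (intro borel_measurable_matrix_vector_mult) (simp add: square_integrable_def)
  show fin: "finite_second_moment (distr P borel ((*v) G))"
    using m P by (simp add: square_integrable_distr square_integrable_matrix)
  have "trace (X ** second_moment (distr P borel ((*v) G))) = (LINT x|P. (G *v x) \<bullet> (X *v (G *v x)))"
    unfolding expectation_quadratic_form(2)[OF fin, symmetric] by (subst integral_distr[OF m]) auto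
  also have "\<dots> = trace (transpose G ** X ** G ** second_moment P)"
    unfolding expectation_quadratic_form(2)[OF P, symmetric] lyapunov_form ..
  finally show "trace (X ** second_moment (distr P borel ((*v) G))) = trace (X ** (G ** second_moment P ** transpose G))"
    by (simp add: trace_congruence)
qed

text \<open>The map \<open>x \<mapsto> G x\<close> is an optimal transport plan when \<open>G\<close> is symmetric positive definite, being
  the gradient of a convex quadratic function: with \<open>J = G\<^sup>-\<^sup>1\<close>, Young's inequality
  \<open>2 x \<bullet> y \<le> x \<bullet> J x + y \<bullet> G y\<close> is a matching dual certificate.\<close>

lemma wasserstein2_posdef_image:
  fixes P :: "(real^'n) measure"
  assumes P: "prob_space P" "finite_second_moment P" and s: "sets P = sets borel" and G: "posdef G"
  shows "wasserstein2 (distr P borel ((*v) G)) P =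
    sqrt (trace ((mat 1 - G) ** second_moment P ** transpose (mat 1 - G)))"
proof (rule wasserstein2_eqI)
  let ?P' = "distr P borel ((*v) G)" and ?S = "second_moment P"
  have tG: "transpose G = G" using G by (simp add: posdef_def)
  have m: "(*v) G \<in> borel_measurable P"
    using P by (intro borel_measurable_matrix_vector_mult) (simp add: square_integrable_def)
  have id: "(\<lambda>x. x) \<in> borel_measurable P" using P by (simp add: square_integrable_def)
  note fin = second_moment_matrix_image(1)[OF P(2) s, of G]
  show "finite_second_moment ?P'" by (rule fin)
  show "finite_second_moment P" by (rule P)
  let ?\<pi> = "distr P (borel \<Otimes>\<^sub>M borel) (\<lambda>x. (G *v x, x))"
  have mp: "(\<lambda>x. (G *v x, x)) \<in> P \<rightarrow>\<^sub>M borel \<Otimes>\<^sub>M borel"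
    using m id by (rule measurable_Pair)
  show "?\<pi> \<in> couplings ?P' P"
  proof -
    have "distr P borel (\<lambda>x. x) = P"
      by (rule distr_id2) (simp add: s)
    then show ?thesis
      using mp P(1) by (auto simp: couplings_def distr_distr o_def prob_space.prob_space_distr)
  qed
  have "(LINT p|?\<pi>. (norm (fst p - snd p))\<^sup>2) = (LINT x|P. x \<bullet> ((transpose (mat 1 - G) ** mat 1 ** (mat 1 - G)) *v x))"
    unfolding lyapunov_form
    by (subst integral_distr[OF mp])
       (auto simp: matrix_vector_mult_diff_rdistrib power2_norm_eq_inner inner_diff_left inner_diff_right inner_commute
          borel_prod[symmetric] intro!: Bochner_Integration.integral_cong)
  also have "\<dots> = trace ((mat 1 - G) ** ?S ** transpose (mat 1 - G))"
    unfolding expectation_quadratic_form(2)[OF P(2)] trace_congruence by simp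
  finally show cost: "(LINT p|?\<pi>. (norm (fst p - snd p))\<^sup>2) = trace ((mat 1 - G) ** ?S ** transpose (mat 1 - G))" .
  fix \<pi> assume \<pi>: "\<pi> \<in> couplings ?P' P"
  have "\<forall>x. G *v x = 0 \<longrightarrow> x = 0"
    using G by (metis inner_zero_right less_irrefl posdef_def)
  then obtain J where JG: "J ** G = mat 1"
    using matrix_left_invertible_ker by blast
  then have GJ: "G ** J = mat 1" using matrix_left_right_inverse by blast
  have young: "x \<bullet> ((mat 1 - J) *v x) - 1 * ((x - y) \<bullet> (x - y)) \<le> y \<bullet> ((G - mat 1) *v y)" for x y
  proof -
    let ?u = "y - J *v x"
    have "0 \<le> ?u \<bullet> (G *v ?u)"
      using posdef_imp_possemidef[OF G] by (simp add: possemidef_def)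
    moreover have GJx: "G *v (J *v x) = x" by (simp add: matrix_vector_mul_assoc GJ)
    moreover have "(J *v x) \<bullet> (G *v y) = x \<bullet> y"
      using inner_symmetric_matrix[OF tG, of "J *v x" y] GJx by simp
    ultimately show ?thesis
      by (simp add: matrix_vector_mult_diff_distrib matrix_vector_mult_diff_rdistrib inner_diff_left inner_diff_right inner_commute)
  qed
  have "trace ((mat 1 - J) ** second_moment ?P') = trace (G ** ?S ** G) - trace (G ** ?S)"
    unfolding second_moment_matrix_image(2)[OF P(2) s] tG
  proof -
    have "J ** (G ** ?S ** G) = ?S ** G" by (simp add: matrix_mul_assoc JG)
    then show "trace ((mat 1 - J) ** (G ** ?S ** G)) = trace (G ** ?S ** G) - trace (G ** ?S)"
      by (simp add: matrix_sub_rdistrib trace_diff trace_mul_sym[of ?S G])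
  qed
  moreover have "trace ((G - mat 1) ** ?S) = trace (G ** ?S) - trace ?S"
    by (simp add: matrix_sub_rdistrib trace_diff)
  moreover have "trace ((mat 1 - G) ** ?S ** transpose (mat 1 - G)) = trace ?S - trace (G ** ?S) - trace (G ** ?S) + trace (G ** ?S ** G)"
    by (simp add: transpose_diff tG matrix_sub_rdistrib matrix_sub_ldistrib trace_diff trace_mul_sym[of ?S G])
  ultimately show "trace ((mat 1 - G) ** ?S ** transpose (mat 1 - G)) \<le> (LINT p|\<pi>. (norm (fst p - snd p))\<^sup>2)"
    using quadratic_potential_bound[OF fin P(2) \<pi> young] by linarith
qed

text \<open>The infimum over couplings need not be attained, so the bound is proved with a coupling whose
  cost exceeds \<open>\<gamma>\<^sup>2\<close> by an arbitrarily small amount.\<close>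

lemma storage_bound_of_wasserstein2:
  fixes P P' :: "(real^'n) measure"
  assumes P: "prob_space P" "sets P = sets borel" "finite_second_moment P"
    and P': "prob_space P'" "sets P' = sets borel" "finite_second_moment P'"
    and W: "wasserstein2 P P' \<le> \<gamma>" and M: "transpose M = M" "0 \<le> l"
    and E: "posdef (mat l - M)" "transpose E = E" "(mat l - M) ** E = mat l"
  shows "trace (M ** second_moment P) \<le> l * \<gamma>\<^sup>2 + trace ((l *\<^sub>R E - mat l) ** second_moment P')"
proof (rule field_le_epsilon)
  fix e :: real assume e: "0 < e"
  have e': "0 < e / (l + 1)" using e M(2) by (simp add: add_nonneg_pos)
  obtain \<pi> where \<pi>: "\<pi> \<in> couplings P P'" and cost: "(LINT p|\<pi>. (norm (fst p - snd p))\<^sup>2) \<le> \<gamma>\<^sup>2 + e / (l + 1)"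
    using wasserstein2_le_imp_ex_coupling[OF P P' W e'] by blast
  have "x \<bullet> (M *v x) - l * ((x - y) \<bullet> (x - y)) \<le> y \<bullet> ((l *\<^sub>R E - mat l) *v y)" for x y
  proof -
    have "0 \<le> (x - E *v y) \<bullet> ((mat l - M) *v (x - E *v y))"
      using posdef_imp_possemidef[OF E(1)] by (simp add: possemidef_def)
    then show ?thesis using completed_square[OF M(1) E(2,3), of y x] by linarith
  qed
  from quadratic_potential_bound[OF P(3) P'(3) \<pi> this]
  have "trace (M ** second_moment P) \<le> l * (LINT p|\<pi>. (norm (fst p - snd p))\<^sup>2) + trace ((l *\<^sub>R E - mat l) ** second_moment P')" .
  also have "l * (LINT p|\<pi>. (norm (fst p - snd p))\<^sup>2) \<le> l * (\<gamma>\<^sup>2 + e / (l + 1))"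
    using cost M(2) by (rule mult_left_mono)
  also have "\<dots> \<le> l * \<gamma>\<^sup>2 + e"
    using e M(2) by (simp add: field_simps)
  finally show "trace (M ** second_moment P) \<le> l * \<gamma>\<^sup>2 + trace ((l *\<^sub>R E - mat l) ** second_moment P') + e"
    by simp
qed

section \<open>Average output power\<close>

text \<open>\<open>P\<close> is a storage function: it records the output energy that the present state will still produce.\<close>

lemma dissipation_identity:
  fixes A :: "real^'n^'n" and B :: "real^'m^'n" and C :: "real^'n^'p" and D :: "real^'m^'p"
  assumes sym: "transpose P = P" and lyap: "P - transpose A ** P ** A = transpose C ** C"
  shows "(A *v x + B *v w) \<bullet> (P *v (A *v x + B *v w)) + (norm (C *v x + D *v w))\<^sup>2 =
    x \<bullet> (P *v x) + w \<bullet> ((transpose B ** P ** B + transpose D ** D) *v w)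
    + 2 * (x \<bullet> ((transpose A ** P ** B + transpose C ** D) *v w))"
proof -
  have "x \<bullet> ((P - transpose A ** P ** A) *v x) = (C *v x) \<bullet> (C *v x)"
    unfolding lyap using lyapunov_form[of x C "mat 1" C x] by simp
  then have 1: "x \<bullet> (P *v x) = (A *v x) \<bullet> (P *v (A *v x)) + (C *v x) \<bullet> (C *v x)"
    by (simp add: matrix_vector_mult_diff_rdistrib inner_diff_right lyapunov_form)
  have 2: "w \<bullet> ((transpose D ** D) *v w) = (D *v w) \<bullet> (D *v w)" "x \<bullet> ((transpose C ** D) *v w) = (C *v x) \<bullet> (D *v w)"
    using lyapunov_form[of w D "mat 1" D w] lyapunov_form[of x C "mat 1" D w] by simp_all
  have 3: "(B *v w) \<bullet> (P *v (A *v x)) = (A *v x) \<bullet> (P *v (B *v w))"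
    using inner_symmetric_matrix[OF sym, of "B *v w" "A *v x"] by (simp add: inner_commute)
  show ?thesis
    by (simp add: 1 2 3 matrix_vector_right_distrib inner_add_left inner_add_right power2_norm_eq_inner
      matrix_vector_mult_add_rdistrib lyapunov_form inner_commute[of "D *v w" "C *v x"])
qed

text \<open>Independence and zero mean enter through the vanishing of the mixed second moments.\<close>

locale white_noise = prob_space \<Omega> for \<Omega> :: "'s measure" +
  fixes w :: "nat \<Rightarrow> 's \<Rightarrow> real^'m" and A :: "real^'n^'n" and B :: "real^'m^'n"
  assumes w: "square_integrable \<Omega> (w t)"
    and uncorrelated: "s \<noteq> t \<Longrightarrow> (LINT \<omega>|\<Omega>. w s \<omega> \<bullet> (N *v w t \<omega>)) = 0"
begin

abbreviation state :: "nat \<Rightarrow> 's \<Rightarrow> real^'n"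
  where "state t \<omega> \<equiv> closed_loop_state A B (\<lambda>s. w s \<omega>) t"

lemma state_square_integrable: "square_integrable \<Omega> (state t)"
  by (induction t) (auto intro!: square_integrable_zero square_integrable_add square_integrable_matrix w)

lemma state_uncorrelated:
  fixes N :: "real^'m^'n"
  assumes "t \<le> s"
  shows "(LINT \<omega>|\<Omega>. state t \<omega> \<bullet> (N *v w s \<omega>)) = 0"
  using assms
proof (induction t arbitrary: N)
  case (Suc t)
  have "state (Suc t) \<omega> \<bullet> (N *v w s \<omega>) =
      state t \<omega> \<bullet> ((transpose A ** N) *v w s \<omega>) + w t \<omega> \<bullet> ((transpose B ** N) *v w s \<omega>)" for \<omega>
    by (simp add: inner_add_left inner_matrix_transpose matrix_vector_mul_assoc del: transpose_matrix_vector)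
  moreover have "integrable \<Omega> (\<lambda>\<omega>. state t \<omega> \<bullet> ((transpose A ** N) *v w s \<omega>))"
      "integrable \<Omega> (\<lambda>\<omega>. w t \<omega> \<bullet> ((transpose B ** N) *v w s \<omega>))"
    by (intro integrable_inner square_integrable_matrix state_square_integrable w)+
  ultimately show ?case
    using Suc.IH[of "transpose A ** N"] uncorrelated[of t s "transpose B ** N"] Suc.prems by simp
qed simp

text \<open>The cross terms of the dissipation identity vanish in expectation, because the state depends on
  past inputs only.\<close>

lemma energy_balance:
  fixes C :: "real^'n^'p" and D :: "real^'m^'p"
  assumes sym: "transpose P = P" and lyap: "P - transpose A ** P ** A = transpose C ** C"
  shows "(LINT \<omega>|\<Omega>. state (Suc t) \<omega> \<bullet> (P *v state (Suc t) \<omega>))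
      + (LINT \<omega>|\<Omega>. (norm (closed_loop_output A B C D (\<lambda>s. w s \<omega>) t))\<^sup>2) =
    (LINT \<omega>|\<Omega>. state t \<omega> \<bullet> (P *v state t \<omega>))
      + (LINT \<omega>|\<Omega>. w t \<omega> \<bullet> ((transpose B ** P ** B + transpose D ** D) *v w t \<omega>))"
proof -
  let ?M = "transpose B ** P ** B + transpose D ** D"
  let ?N = "transpose A ** P ** B + transpose C ** D"
  let ?z = "\<lambda>\<omega>. closed_loop_output A B C D (\<lambda>s. w s \<omega>) t"
  have z: "square_integrable \<Omega> ?z"
    unfolding closed_loop_output_def
    by (intro square_integrable_add square_integrable_matrix state_square_integrable w)
  have i1: "integrable \<Omega> (\<lambda>\<omega>. state (Suc t) \<omega> \<bullet> (P *v state (Suc t) \<omega>))"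
    by (intro integrable_inner square_integrable_matrix state_square_integrable)
  have i2: "integrable \<Omega> (\<lambda>\<omega>. (norm (?z \<omega>))\<^sup>2)"
    using z by (simp add: square_integrable_def)
  have i3: "integrable \<Omega> (\<lambda>\<omega>. state t \<omega> \<bullet> (P *v state t \<omega>))"
    by (intro integrable_inner square_integrable_matrix state_square_integrable)
  have i4: "integrable \<Omega> (\<lambda>\<omega>. w t \<omega> \<bullet> (?M *v w t \<omega>))"
    by (intro integrable_inner square_integrable_matrix w)
  have i5: "integrable \<Omega> (\<lambda>\<omega>. state t \<omega> \<bullet> (?N *v w t \<omega>))"
    by (intro integrable_inner square_integrable_matrix w state_square_integrable)
  have "(LINT \<omega>|\<Omega>. state (Suc t) \<omega> \<bullet> (P *v state (Suc t) \<omega>)) + (LINT \<omega>|\<Omega>. (norm (?z \<omega>))\<^sup>2)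
      = (LINT \<omega>|\<Omega>. state (Suc t) \<omega> \<bullet> (P *v state (Suc t) \<omega>) + (norm (?z \<omega>))\<^sup>2)"
    by (rule Bochner_Integration.integral_add[symmetric, OF i1 i2])
  also have "\<dots> = (LINT \<omega>|\<Omega>. state t \<omega> \<bullet> (P *v state t \<omega>) + w t \<omega> \<bullet> (?M *v w t \<omega>) + 2 * (state t \<omega> \<bullet> (?N *v w t \<omega>)))"
    unfolding closed_loop_output_def closed_loop_state.simps dissipation_identity[OF sym lyap] ..
  also have "\<dots> = (LINT \<omega>|\<Omega>. state t \<omega> \<bullet> (P *v state t \<omega>)) + (LINT \<omega>|\<Omega>. w t \<omega> \<bullet> (?M *v w t \<omega>))
      + 2 * (LINT \<omega>|\<Omega>. state t \<omega> \<bullet> (?N *v w t \<omega>))"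
    using i3 i4 i5 by simp
  finally show ?thesis
    using state_uncorrelated[of t t ?N] by simp
qed

lemma summed_energy_balance:
  fixes C :: "real^'n^'p" and D :: "real^'m^'p"
  assumes "transpose P = P" and "P - transpose A ** P ** A = transpose C ** C"
  shows "(LINT \<omega>|\<Omega>. state T \<omega> \<bullet> (P *v state T \<omega>))
      + (\<Sum>t<T. LINT \<omega>|\<Omega>. (norm (closed_loop_output A B C D (\<lambda>s. w s \<omega>) t))\<^sup>2) =
    (\<Sum>t<T. LINT \<omega>|\<Omega>. w t \<omega> \<bullet> ((transpose B ** P ** B + transpose D ** D) *v w t \<omega>))"
proof (induction T)
  case (Suc T)
  then show ?case using energy_balance[OF assms, of T D] by (simp del: closed_loop_state.simps)
qed simp

lemma average_power_le:
  fixes C :: "real^'n^'p" and D :: "real^'m^'p"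
  assumes P: "possemidef P" and lyap: "P - transpose A ** P ** A = transpose C ** C"
    and le: "\<And>t. (LINT \<omega>|\<Omega>. w t \<omega> \<bullet> ((transpose B ** P ** B + transpose D ** D) *v w t \<omega>)) \<le> v"
  shows "average_power A B C D \<Omega> w \<le> ereal v"
  unfolding average_power_def
proof (rule Limsup_bounded, rule eventually_mono[OF eventually_gt_at_top[of 0]])
  fix T :: nat assume T: "0 < T"
  have sym: "transpose P = P" using P by (simp add: possemidef_def)
  have "0 \<le> (LINT \<omega>|\<Omega>. state T \<omega> \<bullet> (P *v state T \<omega>))"
    using P by (intro Bochner_Integration.integral_nonneg) (simp add: possemidef_def)
  then have "(\<Sum>t<T. LINT \<omega>|\<Omega>. (norm (closed_loop_output A B C D (\<lambda>s. w s \<omega>) t))\<^sup>2)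
      \<le> (\<Sum>t<T. LINT \<omega>|\<Omega>. w t \<omega> \<bullet> ((transpose B ** P ** B + transpose D ** D) *v w t \<omega>))"
    using summed_energy_balance[OF sym lyap, of T D] by linarith
  also have "\<dots> \<le> (\<Sum>t<T. v)" by (intro sum_mono le)
  finally show "ereal (1 / real T * (\<Sum>t<T. LINT \<omega>|\<Omega>. (norm (closed_loop_output A B C D (\<lambda>s. w s \<omega>) t))\<^sup>2)) \<le> ereal v"
    using T by (simp add: field_simps)
qed

text \<open>The Lyapunov function for the right-hand side \<open>I\<close> contracts by a fixed factor in each step, up
  to the constant energy injected by the noise.\<close>

lemma state_energy_bounded:
  assumes stable: "stable_matrix A" and stationary: "\<And>t N. (LINT \<omega>|\<Omega>. w t \<omega> \<bullet> (N *v w t \<omega>)) = trace (N ** S)"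
  shows "\<exists>K. \<forall>t. (LINT \<omega>|\<Omega>. (norm (state t \<omega>))\<^sup>2) \<le> K"
proof -
  have "possemidef (mat 1 :: real^'n^'n)" by (simp add: possemidef_def)
  then obtain P where P: "possemidef P" "P - transpose A ** P ** A = mat 1"
    using ex_lyapunov_solution[OF stable] by blast
  have sym: "transpose P = P" and lyap: "P - transpose A ** P ** A = transpose (mat 1) ** (mat 1 :: real^'n^'n)"
    using P by (auto simp: possemidef_def)
  define V where "V t = (LINT \<omega>|\<Omega>. state t \<omega> \<bullet> (P *v state t \<omega>))" for t
  define W where "W t = (LINT \<omega>|\<Omega>. (norm (state t \<omega>))\<^sup>2)" for t
  define q where "q = trace ((transpose B ** P ** B) ** S)"
  have step: "V (Suc t) + W t = V t + q" for t
    using energy_balance[OF sym lyap, of t "0 :: real^'m^'n"]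
    by (simp add: V_def W_def q_def stationary closed_loop_output_def del: closed_loop_state.simps)
  have i: "integrable \<Omega> (\<lambda>\<omega>. state t \<omega> \<bullet> (P *v state t \<omega>))" for t
    by (intro integrable_inner square_integrable_matrix state_square_integrable)
  have i': "integrable \<Omega> (\<lambda>\<omega>. (norm (state t \<omega>))\<^sup>2)" for t
    using state_square_integrable by (simp add: square_integrable_def)
  have WV: "W t \<le> V t" for t
    unfolding W_def V_def
  proof (rule integral_mono[OF i' i])
    fix \<omega>
    let ?x = "state t \<omega>"
    have "?x \<bullet> ((P - transpose A ** P ** A) *v ?x) = ?x \<bullet> ?x" using P(2) by simp
    moreover have "0 \<le> (A *v ?x) \<bullet> (P *v (A *v ?x))" using P(1) by (simp add: possemidef_def)
    ultimately show "(norm ?x)\<^sup>2 \<le> ?x \<bullet> (P *v ?x)"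
      by (simp add: matrix_vector_mult_diff_rdistrib inner_diff_right lyapunov_form power2_norm_eq_inner)
  qed
  obtain b where b: "0 < b" "\<And>x. norm (P *v x) \<le> norm x * b"
    using bounded_linear.pos_bounded[OF matrix_vector_mul_bounded_linear[of P]] by blast
  define c where "c = max 1 b"
  have c: "1 \<le> c" "b \<le> c" by (auto simp: c_def)
  have VW: "V t \<le> c * W t" for t
  proof -
    have "V t \<le> (LINT \<omega>|\<Omega>. c * (norm (state t \<omega>))\<^sup>2)"
      unfolding V_def
    proof (rule integral_mono[OF i integrable_mult_right[OF i']])
      fix \<omega>
      let ?x = "state t \<omega>"
      have "?x \<bullet> (P *v ?x) \<le> norm ?x * norm (P *v ?x)" by (rule norm_cauchy_schwarz)
      also have "\<dots> \<le> norm ?x * (norm ?x * c)"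
        using b(2)[of ?x] c(2) by (intro mult_left_mono order_trans[OF b(2)]) auto
      finally show "?x \<bullet> (P *v ?x) \<le> c * (norm ?x)\<^sup>2" by (simp add: power2_eq_square mult_ac)
    qed
    then show ?thesis by (simp add: W_def)
  qed
  have W0: "0 \<le> W t" for t
    unfolding W_def by (rule Bochner_Integration.integral_nonneg) simp
  have "0 \<le> (LINT \<omega>|\<Omega>. w 0 \<omega> \<bullet> ((transpose B ** P ** B) *v w 0 \<omega>))"
    using P(1) by (intro Bochner_Integration.integral_nonneg) (simp add: lyapunov_form possemidef_def)
  then have q: "0 \<le> q" by (simp add: stationary q_def)
  have "V t \<le> c * q" for t
  proof (induction t)
    case 0
    then show ?case using q c by (simp add: V_def)
  next
    case (Suc t)
    have "c * V (Suc t) = c * V t - c * W t + c * q"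
      using step[of t] by (simp add: algebra_simps) (metis distrib_left)
    also have "\<dots> \<le> (c - 1) * V t + c * q"
      using VW[of t] by (simp add: algebra_simps)
    also have "\<dots> \<le> (c - 1) * (c * q) + c * q"
      using Suc c by (intro add_right_mono mult_left_mono) auto
    also have "\<dots> = c * (c * q)" by (simp add: algebra_simps)
    finally show ?case using c by simp
  qed
  then have "W t \<le> c * q" for t using WV[of t] order_trans by blast
  then show ?thesis unfolding W_def by blast
qed

text \<open>The stored energy stays bounded, so its contribution vanishes in the average.\<close>

lemma average_power_eq:
  fixes C :: "real^'n^'p" and D :: "real^'m^'p"
  assumes stable: "stable_matrix A" and P: "possemidef P" and lyap: "P - transpose A ** P ** A = transpose C ** C"
    and stationary: "\<And>t N. (LINT \<omega>|\<Omega>. w t \<omega> \<bullet> (N *v w t \<omega>)) = trace (N ** S)"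
  shows "average_power A B C D \<Omega> w = ereal (trace ((transpose B ** P ** B + transpose D ** D) ** S))"
proof -
  let ?v = "trace ((transpose B ** P ** B + transpose D ** D) ** S)"
  define V where "V t = (LINT \<omega>|\<Omega>. state t \<omega> \<bullet> (P *v state t \<omega>))" for t
  have sym: "transpose P = P" using P by (simp add: possemidef_def)
  obtain K where K: "\<And>t. (LINT \<omega>|\<Omega>. (norm (state t \<omega>))\<^sup>2) \<le> K"
    using state_energy_bounded[OF stable stationary] by blast
  obtain b where b: "0 < b" "\<And>x. norm (P *v x) \<le> norm x * b"
    using bounded_linear.pos_bounded[OF matrix_vector_mul_bounded_linear[of P]] by blast
  have V0: "0 \<le> V t" for t
    unfolding V_def using P by (intro Bochner_Integration.integral_nonneg) (simp add: possemidef_def)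
  have Vb: "V t \<le> b * K" for t
  proof -
    have "V t \<le> (LINT \<omega>|\<Omega>. b * (norm (state t \<omega>))\<^sup>2)"
      unfolding V_def
    proof (rule integral_mono)
      show "integrable \<Omega> (\<lambda>\<omega>. state t \<omega> \<bullet> (P *v state t \<omega>))"
        by (intro integrable_inner square_integrable_matrix state_square_integrable)
      show "integrable \<Omega> (\<lambda>\<omega>. b * (norm (state t \<omega>))\<^sup>2)"
        using state_square_integrable by (simp add: square_integrable_def)
      fix \<omega>
      let ?x = "state t \<omega>"
      have "?x \<bullet> (P *v ?x) \<le> norm ?x * norm (P *v ?x)" by (rule norm_cauchy_schwarz)
      also have "\<dots> \<le> norm ?x * (norm ?x * b)" by (intro mult_left_mono b) simp
      finally show "?x \<bullet> (P *v ?x) \<le> b * (norm ?x)\<^sup>2" by (simp add: power2_eq_square mult_ac)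
    qed
    also have "\<dots> \<le> b * K" using K b by simp
    finally show ?thesis .
  qed
  have avg: "1 / real T * (\<Sum>t<T. LINT \<omega>|\<Omega>. (norm (closed_loop_output A B C D (\<lambda>s. w s \<omega>) t))\<^sup>2) = ?v - V T / real T"
    if "0 < T" for T
  proof -
    have "(\<Sum>t<T. LINT \<omega>|\<Omega>. (norm (closed_loop_output A B C D (\<lambda>s. w s \<omega>) t))\<^sup>2) = real T * ?v - V T"
      using summed_energy_balance[OF sym lyap, of T D] by (simp add: stationary V_def)
    then show ?thesis using that by (simp add: field_simps)
  qed
  have "(\<lambda>T. V T / real T) \<longlonglongrightarrow> 0"
  proof (rule Lim_null_comparison[OF always_eventually])
    show "\<forall>T. norm (V T / real T) \<le> b * K / real T"
      using V0 Vb by (simp add: divide_right_mono)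
    show "(\<lambda>T. b * K / real T) \<longlonglongrightarrow> 0" by (rule lim_const_over_n)
  qed
  then have "(\<lambda>T. ?v - V T / real T) \<longlonglongrightarrow> ?v - 0"
    by (intro tendsto_diff tendsto_const)
  then have "(\<lambda>T. 1 / real T * (\<Sum>t<T. LINT \<omega>|\<Omega>. (norm (closed_loop_output A B C D (\<lambda>s. w s \<omega>) t))\<^sup>2)) \<longlonglongrightarrow> ?v"
    by (elim Lim_transform_eventually[THEN tendsto_eq_rhs])
       (rule eventually_mono[OF eventually_gt_at_top[of 0]], rule avg[symmetric], assumption, simp)
  then show ?thesis
    unfolding average_power_def by (intro lim_imp_Limsup) auto
qed

end

lemma W_ind_white_noise:
  fixes P :: "(real^'m) measure" and \<Omega> :: "'s measure"
  assumes W: "(\<Omega>, w) \<in> W_ind \<gamma> P"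
  shows "white_noise \<Omega> w"
proof -
  interpret prob_space \<Omega> using W by (simp add: W_ind_def separable_metric_prob_space_def)
  have w: "square_integrable \<Omega> (w t)" for t
    using W by (simp add: W_ind_def square_integrable_def)
  have indep: "indep_vars (\<lambda>_. borel) w UNIV" and mean: "(LINT \<omega>|\<Omega>. w t \<omega>) = 0" for t
    using W by (auto simp: W_ind_def)
  have int: "integrable \<Omega> (w t)" for t
  proof (rule Bochner_Integration.integrable_bound)
    show "integrable \<Omega> (\<lambda>\<omega>. 1 + (norm (w t \<omega>))\<^sup>2)" using w[of t] by (simp add: square_integrable_def)
    show "w t \<in> borel_measurable \<Omega>" using w[of t] by (simp add: square_integrable_def)
    have "x \<le> 1 + x\<^sup>2" for x :: real
      using zero_le_power2[of "x - 1/2"] by (simp add: power2_eq_square algebra_simps)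
    then show "AE \<omega> in \<Omega>. norm (w t \<omega>) \<le> norm (1 + (norm (w t \<omega>))\<^sup>2)"
      by (intro AE_I2) (metis abs_ge_self order_trans real_norm_def)
  qed
  have comp: "integrable \<Omega> (\<lambda>\<omega>. w t \<omega> $ i)" "(LINT \<omega>|\<Omega>. w t \<omega> $ i) = 0" for t i
  proof -
    have "integrable \<Omega> (\<lambda>\<omega>. w t \<omega> \<bullet> axis i 1)" "(LINT \<omega>|\<Omega>. w t \<omega> \<bullet> axis i 1) = 0"
      by (simp_all add: int mean)
    then show "integrable \<Omega> (\<lambda>\<omega>. w t \<omega> $ i)" "(LINT \<omega>|\<Omega>. w t \<omega> $ i) = 0"
      by (simp_all add: inner_axis)
  qed
  have uc: "(LINT \<omega>|\<Omega>. w s \<omega> \<bullet> (N *v w t \<omega>)) = 0" if st: "s \<noteq> t" for s t N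
  proof -
    have prod: "integrable \<Omega> (\<lambda>\<omega>. w s \<omega> $ i * w t \<omega> $ j)" "(LINT \<omega>|\<Omega>. w s \<omega> $ i * w t \<omega> $ j) = 0" for i j
    proof -
      let ?X = "\<lambda>k \<omega>. w k \<omega> $ (if k = s then i else j)"
      have ind: "indep_vars (\<lambda>_. borel) ?X {s, t}"
        by (rule indep_vars_compose2[OF indep_vars_subset[OF indep]]) auto
      show "integrable \<Omega> (\<lambda>\<omega>. w s \<omega> $ i * w t \<omega> $ j)"
        using indep_vars_integrable[OF _ ind] comp(1) st by simp
      show "(LINT \<omega>|\<Omega>. w s \<omega> $ i * w t \<omega> $ j) = 0"
        using indep_vars_lebesgue_integral[OF _ ind] comp st by simp
    qed
    have "w s \<omega> \<bullet> (N *v w t \<omega>) = (\<Sum>i\<in>UNIV. \<Sum>j\<in>UNIV. N $ i $ j * (w s \<omega> $ i * w t \<omega> $ j))" for \<omega>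
      by (simp add: inner_vec_def matrix_vector_mult_def sum_distrib_left mult_ac)
    then have "(LINT \<omega>|\<Omega>. w s \<omega> \<bullet> (N *v w t \<omega>)) = (\<Sum>i\<in>UNIV. \<Sum>j\<in>UNIV. N $ i $ j * (LINT \<omega>|\<Omega>. w s \<omega> $ i * w t \<omega> $ j))"
      by (simp only:) (subst Bochner_Integration.integral_sum,
        intro Bochner_Integration.integrable_sum integrable_mult_right prod(1),
        intro sum.cong refl, subst Bochner_Integration.integral_sum, intro integrable_mult_right prod(1),
        simp only: integral_mult_right_zero)
    then show ?thesis by (simp add: prod(2))
  qed
  show ?thesis by unfold_locales (auto intro: w uc)
qed

section \<open>The worst-case disturbance\<close>

text \<open>Countable products of separable metric spaces are metrizable, with the product \<open>\<sigma>\<close>-algebra as Borel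
  \<open>\<sigma>\<close>-algebra.\<close>

lemma separable_metric_prob_space_PiM:
  fixes P :: "'a::{metric_space, second_countable_topology} measure"
  assumes P: "prob_space P" and s: "sets P = sets borel"
  shows "separable_metric_prob_space (Pi\<^sub>M (UNIV::nat set) (\<lambda>_. P))"
proof -
  let ?\<Omega> = "Pi\<^sub>M (UNIV::nat set) (\<lambda>_. P)"
  have space: "space ?\<Omega> = UNIV"
    using sets_eq_imp_space_eq[OF s] by (simp add: space_PiM)
  have "sets ?\<Omega> = sets (Pi\<^sub>M UNIV (\<lambda>_. borel))"
    by (rule sets_PiM_cong) (simp_all add: s)
  also have "\<dots> = sets borel" by (rule sets_PiM_equal_borel)
  also have "\<dots> = sigma_sets UNIV {U. open U}" unfolding borel_def by (rule sets_measure_of) simp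
  finally have sets: "sets ?\<Omega> = sigma_sets UNIV {U. open U}" .
  obtain Q :: "(nat \<Rightarrow> 'a) set" where Q: "countable Q" "\<And>X. open X \<Longrightarrow> X \<noteq> {} \<Longrightarrow> \<exists>d\<in>Q. d \<in> X"
    using countable_dense_exists[where 'a="nat \<Rightarrow> 'a"] by blast
  have "closure Q = UNIV"
  proof -
    have "x \<in> closure Q" for x
      unfolding closure_iff_nhds_not_empty using Q(2) by (metis IntI empty_iff inf_commute interiorI interior_subset open_interior subset_iff)
    then show ?thesis by blast
  qed
  then have "separable_space (euclidean :: (nat \<Rightarrow> 'a) topology)"
    using Q(1) by (auto simp: separable_space_def)
  moreover have "prob_space ?\<Omega>" by (intro prob_space_PiM P)
  ultimately show ?thesis
    unfolding separable_metric_prob_space_def space sets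
    by (intro conjI exI[of _ dist]) (simp_all add: Met_TC.Metric_space_axioms)
qed

lemma iid_linear_disturbance:
  fixes P :: "(real^'m) measure" and G :: "real^'m^'m"
  defines "\<Omega> \<equiv> Pi\<^sub>M (UNIV::nat set) (\<lambda>_. P)" and "w \<equiv> \<lambda>t \<omega>. G *v \<omega> t"
  assumes P: "prob_space P" "finite_second_moment P" and s: "sets P = sets borel"
    and mean: "(LINT x|P. x) = 0"
    and W: "wasserstein2 (distr P borel ((*v) G)) P \<le> \<gamma>"
  shows "(\<Omega>, w) \<in> W_ind \<gamma> P"
    and "(\<lambda>\<omega>. \<omega> t) \<in> borel_measurable \<Omega>" and "distr \<Omega> borel (\<lambda>\<omega>. \<omega> t) = P"
    and "distr \<Omega> borel (w t) = distr P borel ((*v) G)"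
proof -
  have coord: "(\<lambda>\<omega>. \<omega> t) \<in> \<Omega> \<rightarrow>\<^sub>M P" for t
    unfolding \<Omega>_def by (rule measurable_component_singleton) simp
  show coord': "(\<lambda>\<omega>. \<omega> t) \<in> borel_measurable \<Omega>" for t
    using coord[of t] measurable_cong_sets[OF refl s, of \<Omega>] by simp
  have law: "distr \<Omega> P (\<lambda>\<omega>. \<omega> t) = P" for t
    unfolding \<Omega>_def by (rule distr_PiM_component) (simp_all add: P)
  show law': "distr \<Omega> borel (\<lambda>\<omega>. \<omega> t) = P" for t
    using law[of t] by (simp add: s cong: distr_cong)
  have G: "(*v) G \<in> borel_measurable P" 
    using P by (intro borel_measurable_matrix_vector_mult) (simp add: square_integrable_def)
  show laww: "distr \<Omega> borel (w t) = distr P borel ((*v) G)" for t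
    using distr_distr[OF G coord[of t]] law[of t] by (simp add: w_def o_def)
  interpret prob_space \<Omega> unfolding \<Omega>_def by (intro prob_space_PiM P)
  have wm: "w t \<in> borel_measurable \<Omega>" for t
    unfolding w_def by (intro borel_measurable_matrix_vector_mult coord')
  have sq: "square_integrable \<Omega> (\<lambda>\<omega>. \<omega> t)" for t
    using P(2) square_integrable_distr[OF coord'[of t], of "\<lambda>x. x"] by (simp add: law')
  have sqw: "square_integrable \<Omega> (w t)" for t
    unfolding w_def by (intro square_integrable_matrix sq)
  have "indep_vars (\<lambda>_. P) (\<lambda>t \<omega>. \<omega> t) UNIV"
  proof (subst indep_vars_iff_distr_eq_PiM')
    show "distr \<Omega> (\<Pi>\<^sub>M i\<in>UNIV. P) (\<lambda>x. \<lambda>i\<in>UNIV. x i) = (\<Pi>\<^sub>M i\<in>UNIV. distr \<Omega> P (\<lambda>\<omega>. \<omega> i))"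
      unfolding law by (simp add: \<Omega>_def restrict_def distr_id2)
  qed (use coord in auto)
  then have indep: "indep_vars (\<lambda>_. borel) w UNIV"
    unfolding w_def by (rule indep_vars_compose2) (rule G)
  have mw: "(LINT \<omega>|\<Omega>. w t \<omega>) = 0" for t
  proof -
    interpret P: prob_space P by fact
    have id: "(\<lambda>x. x) \<in> borel_measurable P" using P(2) by (simp add: square_integrable_def)
    have "integrable P (\<lambda>x. x)"
    proof (rule Bochner_Integration.integrable_bound)
      show "integrable P (\<lambda>x. 1 + (norm x)\<^sup>2)" using P(2) by (simp add: square_integrable_def)
      show "(\<lambda>x. x) \<in> borel_measurable P" by (rule id)
      have "a \<le> 1 + a\<^sup>2" for a :: real
        using zero_le_power2[of "a - 1/2"] by (simp add: power2_eq_square algebra_simps)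
      then show "AE x in P. norm x \<le> norm (1 + (norm x)\<^sup>2)"
        by (intro AE_I2) (metis abs_ge_self order_trans real_norm_def)
    qed
    then have "(LINT x|P. G *v x) = G *v (LINT x|P. x)"
      by (intro integral_bounded_linear matrix_vector_mul_bounded_linear)
    moreover have "(LINT \<omega>|\<Omega>. w t \<omega>) = (LINT x|P. G *v x)"
      using integral_distr[OF coord[of t] G] by (simp add: law w_def)
    ultimately show ?thesis by (simp add: mean)
  qed
  show "(\<Omega>, w) \<in> W_ind \<gamma> P"
    unfolding W_ind_def
    using separable_metric_prob_space_PiM[OF P(1) s, folded \<Omega>_def] sqw indep mw W laww
    by (auto simp: square_integrable_def)
qed

theorem corollary1:
  fixes A :: "real^'nx^'nx" and B\<^sub>w :: "real^'nw^'nx" and B\<^sub>u :: "real^'nu^'nx"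
    and C\<^sub>z :: "real^'nx^'nz" and D\<^sub>z\<^sub>w :: "real^'nw^'nz" and D\<^sub>z\<^sub>u :: "real^'nu^'nz"
    and C\<^sub>y :: "real^'nx^'ny" and D\<^sub>y\<^sub>w :: "real^'nw^'ny"
    and A\<^sub>c :: "real^'nx^'nx" and B\<^sub>c :: "real^'ny^'nx"
    and C\<^sub>c :: "real^'nx^'nu" and D\<^sub>c :: "real^'ny^'nu"
    and cA :: "real^('nx + 'nx)^('nx + 'nx)" and cB :: "real^'nw^('nx + 'nx)"
    and cC :: "real^('nx + 'nx)^'nz" and cD :: "real^'nw^'nz"
    and \<gamma> :: real and P\<^sub>n\<^sub>o\<^sub>m :: "(real^'nw) measure" and \<Sigma>\<^sub>n\<^sub>o\<^sub>m :: "real^'nw^'nw"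
  assumes cA: "cA = closed_A A B\<^sub>u C\<^sub>y A\<^sub>c B\<^sub>c C\<^sub>c D\<^sub>c"
    and cB: "cB = closed_B B\<^sub>w B\<^sub>u D\<^sub>y\<^sub>w B\<^sub>c D\<^sub>c"
    and cC: "cC = closed_C C\<^sub>z D\<^sub>z\<^sub>u C\<^sub>y C\<^sub>c D\<^sub>c"
    and cD: "cD = closed_D D\<^sub>z\<^sub>w D\<^sub>z\<^sub>u D\<^sub>y\<^sub>w D\<^sub>c"
    and \<gamma>: "0 \<le> \<gamma>"
    and nom_normal: "normal_distribution P\<^sub>n\<^sub>o\<^sub>m"
    and nom_mean: "(LINT x|P\<^sub>n\<^sub>o\<^sub>m. x) = 0"
    and nom_second_moment: "second_moment P\<^sub>n\<^sub>o\<^sub>m = \<Sigma>\<^sub>n\<^sub>o\<^sub>m"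
    and stable: "stable_matrix cA"
    and \<Sigma>_posdef: "posdef \<Sigma>\<^sub>n\<^sub>o\<^sub>m"
  shows "\<exists>\<Delta> :: real^'nw^'nw.
    frobenius_norm ((mat 1 - \<Delta>) ** mat_sqrt \<Sigma>\<^sub>n\<^sub>o\<^sub>m) \<le> \<gamma> \<and>
    ereal ((weighted_h2_norm \<Sigma>\<^sub>n\<^sub>o\<^sub>m cA (cB ** \<Delta>) cC (cD ** \<Delta>))\<^sup>2)
      = robust_h2_value \<gamma> \<Sigma>\<^sub>n\<^sub>o\<^sub>m cA cB cC cD \<and>
    (\<exists>(\<Omega> :: (nat \<Rightarrow> real^'nw) measure) w.
      (\<Omega>, w) \<in> W_ind \<gamma> P\<^sub>n\<^sub>o\<^sub>m \<and>
      average_power cA cB cC cD \<Omega> w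
        = (SUP (\<Omega>', w')\<in>(W_ind \<gamma> P\<^sub>n\<^sub>o\<^sub>m :: ((nat \<Rightarrow> real^'nw) measure \<times> _) set).
             average_power cA cB cC cD \<Omega>' w') \<and>
      (\<forall>(\<Omega>', w')\<in>(W_ind \<gamma> P\<^sub>n\<^sub>o\<^sub>m :: ('s measure \<times> _) set).
         average_power cA cB cC cD \<Omega>' w' \<le> average_power cA cB cC cD \<Omega> w) \<and>
      (\<forall>t.
        (\<exists>w_hat. w_hat \<in> borel_measurable \<Omega> \<and> distr \<Omega> borel w_hat = P\<^sub>n\<^sub>o\<^sub>m \<and>
           (\<forall>\<omega>\<in>space \<Omega>. w t \<omega> = \<Delta> *v w_hat \<omega>)) \<and>
        wasserstein2 (distr \<Omega> borel (w t)) P\<^sub>n\<^sub>o\<^sub>m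
          = sqrt (trace ((mat 1 - \<Delta>) ** \<Sigma>\<^sub>n\<^sub>o\<^sub>m ** transpose (mat 1 - \<Delta>)))))"
proof -
  let ?S = "\<Sigma>\<^sub>n\<^sub>o\<^sub>m" and ?Pn = "P\<^sub>n\<^sub>o\<^sub>m"
  let ?R = "mat_sqrt ?S"
  have Pn: "prob_space ?Pn" "sets ?Pn = sets borel"
    using nom_normal by (auto simp: normal_distribution_def)
  have fin: "finite_second_moment ?Pn"
    by (rule normal_distribution_finite_second_moment[OF nom_normal])
  have "possemidef (transpose cC ** cC)"
    using lyapunov_form[of _ cC "mat 1" cC] by (simp add: possemidef_def matrix_transpose_mul)
  then obtain P where P: "possemidef P" and lyap: "P - transpose cA ** P ** cA = transpose cC ** cC"
    using ex_lyapunov_solution[OF stable] by blast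
  have tP: "transpose P = P" using P by (simp add: possemidef_def)
  define M where "M = transpose cB ** P ** cB + transpose cD ** cD"
  have tM: "transpose M = M"
    by (rule transpose_storage[OF stable P lyap M_def])
  have M: "possemidef M"
    unfolding possemidef_def
  proof (intro conjI tM allI)
    fix x
    show "0 \<le> x \<bullet> (M *v x)"
      using P lyapunov_form[of x cD "mat 1" cD x]
      by (simp add: M_def matrix_vector_mult_add_rdistrib inner_add_right lyapunov_form possemidef_def)
  qed
  obtain \<Delta> where \<Delta>: "posdef \<Delta>"
    and budget: "trace ((mat 1 - \<Delta>) ** ?S ** transpose (mat 1 - \<Delta>)) \<le> \<gamma>\<^sup>2"
    and dual: "\<And>e. 0 < e \<Longrightarrow> \<exists>l E. 0 < l \<and> posdef (mat l - M) \<and> transpose E = E \<and> (mat l - M) ** E = mat l \<and>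
      l * \<gamma>\<^sup>2 + trace ((l *\<^sub>R E - mat l) ** ?S) \<le> trace (\<Delta> ** M ** \<Delta> ** ?S) + e"
    using ex_worst_case_gain[OF M \<Sigma>_posdef \<gamma>] by blast
  have t\<Delta>: "transpose \<Delta> = \<Delta>" using \<Delta> by (simp add: posdef_def)
  let ?v = "trace (\<Delta> ** M ** \<Delta> ** ?S)"
  have robust: "robust_h2_value \<gamma> ?S cA cB cC cD = ereal ?v"
    by (rule robust_h2_value_eq[OF stable P lyap M_def \<Sigma>_posdef t\<Delta> budget dual])

  have frob: "frobenius_norm ((mat 1 - \<Delta>) ** ?R) \<le> \<gamma>"
  proof -
    let ?G = "(mat 1 - \<Delta>) ** ?R"
    have "(\<Sum>i\<in>UNIV. \<Sum>j\<in>UNIV. (norm (?G $ i $ j))\<^sup>2) = trace (?G ** transpose ?G)"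
      by (simp add: trace_def matrix_matrix_mult_def transpose_def power2_eq_square)
    also have "?G ** transpose ?G = (mat 1 - \<Delta>) ** (?R ** ?R) ** transpose (mat 1 - \<Delta>)"
      by (simp only: matrix_transpose_mul mat_sqrt_posdef(1)[OF \<Sigma>_posdef] matrix_mul_assoc)
    finally have "(\<Sum>i\<in>UNIV. \<Sum>j\<in>UNIV. (norm (?G $ i $ j))\<^sup>2) \<le> \<gamma>\<^sup>2"
      using budget by (simp only: mat_sqrt_posdef(2)[OF \<Sigma>_posdef])
    then have "sqrt (\<Sum>i\<in>UNIV. \<Sum>j\<in>UNIV. (norm (?G $ i $ j))\<^sup>2) \<le> sqrt (\<gamma>\<^sup>2)"
      by (rule real_sqrt_le_mono)
    then show ?thesis using \<gamma> by (simp add: frobenius_norm_def)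
  qed

  have h2: "(weighted_h2_norm ?S cA (cB ** \<Delta>) cC (cD ** \<Delta>))\<^sup>2 = ?v"
  proof -
    let ?K = "\<Delta> ** ?R"
    have "(weighted_h2_norm ?S cA (cB ** \<Delta>) cC (cD ** \<Delta>))\<^sup>2 =
        trace (transpose (cB ** \<Delta> ** ?R) ** P ** (cB ** \<Delta> ** ?R) + transpose (cD ** \<Delta> ** ?R) ** (cD ** \<Delta> ** ?R))"
      unfolding weighted_h2_norm_def by (rule h2_norm_squared[OF stable tP lyap])
    also have "transpose (cB ** \<Delta> ** ?R) ** P ** (cB ** \<Delta> ** ?R) + transpose (cD ** \<Delta> ** ?R) ** (cD ** \<Delta> ** ?R)
        = transpose ?K ** M ** ?K"
      by (simp add: M_def matrix_transpose_mul matrix_mul_assoc matrix_add_ldistrib matrix_add_rdistrib)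
    also have "trace \<dots> = trace (transpose ?R ** (\<Delta> ** M ** \<Delta>) ** ?R ** mat 1)"
      by (simp add: matrix_transpose_mul matrix_mul_assoc t\<Delta>)
    also have "\<dots> = trace ((\<Delta> ** M ** \<Delta>) ** (?R ** mat 1 ** transpose ?R))"
      by (rule trace_congruence)
    also have "\<dots> = ?v"
      by (simp add: mat_sqrt_posdef[OF \<Sigma>_posdef])
    finally show ?thesis .
  qed

  have upper: "average_power cA cB cC cD \<Omega>' w' \<le> ereal ?v"
    if W: "(\<Omega>', w') \<in> (W_ind \<gamma> ?Pn :: ('x measure \<times> _) set)" for \<Omega>' w'
  proof -
    interpret white_noise \<Omega>' w' cA cB by (rule W_ind_white_noise[OF W])
    have "(LINT \<omega>|\<Omega>'. w' t \<omega> \<bullet> (M *v w' t \<omega>)) \<le> ?v" for t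
    proof (rule field_le_epsilon)
      fix e :: real assume "0 < e"
      then obtain l E where l: "0 < l" and E: "posdef (mat l - M)" "transpose E = E" "(mat l - M) ** E = mat l"
        and le: "l * \<gamma>\<^sup>2 + trace ((l *\<^sub>R E - mat l) ** ?S) \<le> ?v + e"
        using dual by blast
      let ?L = "distr \<Omega>' borel (w' t)"
      have wm: "w' t \<in> borel_measurable \<Omega>'" using w[of t] by (simp add: square_integrable_def)
      have L: "prob_space ?L" "sets ?L = sets borel" "finite_second_moment ?L"
        using prob_space_distr[OF wm] w[of t] wm by (simp_all add: square_integrable_distr)
      have "wasserstein2 ?L ?Pn \<le> \<gamma>" using W by (simp add: W_ind_def)
      from storage_bound_of_wasserstein2[OF L Pn fin this tM less_imp_le[OF l] E]
      have "trace (M ** second_moment ?L) \<le> ?v + e" using le by (simp add: nom_second_moment)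
      moreover have "(LINT \<omega>|\<Omega>'. w' t \<omega> \<bullet> (M *v w' t \<omega>)) = trace (M ** second_moment ?L)"
        unfolding expectation_quadratic_form(2)[OF L(3), symmetric] by (subst integral_distr[OF wm]) auto
      ultimately show "(LINT \<omega>|\<Omega>'. w' t \<omega> \<bullet> (M *v w' t \<omega>)) \<le> ?v + e" by simp
    qed
    then show ?thesis
      unfolding M_def by (rule average_power_le[OF P lyap])
  qed

  define \<Omega> where "\<Omega> = Pi\<^sub>M (UNIV::nat set) (\<lambda>_. ?Pn)"
  define w where "w = (\<lambda>t (\<omega> :: nat \<Rightarrow> real^'nw). \<Delta> *v \<omega> t)"
  have W2: "wasserstein2 (distr ?Pn borel ((*v) \<Delta>)) ?Pn = sqrt (trace ((mat 1 - \<Delta>) ** ?S ** transpose (mat 1 - \<Delta>)))"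
    using wasserstein2_posdef_image[OF Pn(1) fin Pn(2) \<Delta>] by (simp add: nom_second_moment)
  have "\<dots> \<le> \<gamma>" using budget \<gamma> by (rule real_le_lsqrt[rotated])
  with W2 have "wasserstein2 (distr ?Pn borel ((*v) \<Delta>)) ?Pn \<le> \<gamma>" by simp
  note iid = iid_linear_disturbance[OF Pn(1) fin Pn(2) nom_mean this, folded \<Omega>_def, folded w_def]
  have law: "distr \<Omega> borel (w t) = distr ?Pn borel ((*v) \<Delta>)" for t
    using iid(4)[of t] by (simp add: w_def)
  have attained: "average_power cA cB cC cD \<Omega> w = ereal ?v"
  proof -
    interpret white_noise \<Omega> w cA cB by (rule W_ind_white_noise[OF iid(1)])
    have wm: "w t \<in> borel_measurable \<Omega>" for t using w[of t] by (simp add: square_integrable_def)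
    have "(LINT \<omega>|\<Omega>. w t \<omega> \<bullet> (N *v w t \<omega>)) = trace (N ** (\<Delta> ** ?S ** transpose \<Delta>))" for t N
    proof -
      have "(LINT \<omega>|\<Omega>. w t \<omega> \<bullet> (N *v w t \<omega>)) = (LINT x|distr \<Omega> borel (w t). x \<bullet> (N *v x))"
        by (subst integral_distr[OF wm]) auto
      also have "\<dots> = trace (N ** (\<Delta> ** ?S ** transpose \<Delta>))"
        unfolding law using second_moment_matrix_image[OF fin Pn(2), where G=\<Delta>]
        by (simp add: expectation_quadratic_form(2) nom_second_moment)
      finally show ?thesis .
    qed
    from average_power_eq[OF stable P lyap this]
    have "average_power cA cB cC cD \<Omega> w = ereal (trace (M ** (\<Delta> ** ?S ** transpose \<Delta>)))"
      by (simp add: M_def)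
    then show ?thesis
      by (simp only: trace_congruence[symmetric]) (simp only: t\<Delta>)
  qed
  have sup: "average_power cA cB cC cD \<Omega> w
        = (SUP (\<Omega>', w')\<in>(W_ind \<gamma> ?Pn :: ((nat \<Rightarrow> real^'nw) measure \<times> _) set). average_power cA cB cC cD \<Omega>' w')"
  proof (rule antisym)
    show "average_power cA cB cC cD \<Omega> w
        \<le> (SUP (\<Omega>', w')\<in>(W_ind \<gamma> ?Pn :: ((nat \<Rightarrow> real^'nw) measure \<times> _) set). average_power cA cB cC cD \<Omega>' w')"
      by (rule SUP_upper2[OF iid(1)]) simp
    show "(SUP (\<Omega>', w')\<in>(W_ind \<gamma> ?Pn :: ((nat \<Rightarrow> real^'nw) measure \<times> _) set). average_power cA cB cC cD \<Omega>' w')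
        \<le> average_power cA cB cC cD \<Omega> w"
      unfolding attained by (rule SUP_least) (use upper in auto)
  qed
  show ?thesis
  proof (intro exI[of _ \<Delta>] conjI exI[of _ \<Omega>] exI[of _ w] allI)
    show "frobenius_norm ((mat 1 - \<Delta>) ** ?R) \<le> \<gamma>" by (rule frob)
    show "ereal ((weighted_h2_norm ?S cA (cB ** \<Delta>) cC (cD ** \<Delta>))\<^sup>2) = robust_h2_value \<gamma> ?S cA cB cC cD"
      by (simp only: h2 robust)
    show "(\<Omega>, w) \<in> W_ind \<gamma> ?Pn" by (rule iid(1))
    show "average_power cA cB cC cD \<Omega> w
        = (SUP (\<Omega>', w')\<in>(W_ind \<gamma> ?Pn :: ((nat \<Rightarrow> real^'nw) measure \<times> _) set). average_power cA cB cC cD \<Omega>' w')"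
      by (rule sup)
    show "\<forall>(\<Omega>', w')\<in>(W_ind \<gamma> ?Pn :: ('s measure \<times> _) set).
         average_power cA cB cC cD \<Omega>' w' \<le> average_power cA cB cC cD \<Omega> w"
      unfolding attained using upper by blast
    fix t
    show "\<exists>w_hat. w_hat \<in> borel_measurable \<Omega> \<and> distr \<Omega> borel w_hat = ?Pn \<and> (\<forall>\<omega>\<in>space \<Omega>. w t \<omega> = \<Delta> *v w_hat \<omega>)"
      using iid(2,3)[of t] by (intro exI[of _ "\<lambda>\<omega>. \<omega> t"]) (simp add: w_def)
    show "wasserstein2 (distr \<Omega> borel (w t)) ?Pn = sqrt (trace ((mat 1 - \<Delta>) ** ?S ** transpose (mat 1 - \<Delta>)))"
      unfolding law by (rule W2)
  qed
qed

end
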